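(* Let $\mathbb{K}$ be a field of characteristic zero, let $d>0$, and let $\Delta$ be a simplicial complex on vertex set $[n]$ homeomorphic to a $d$-dimensional sphere. Then $\Delta$ has an unexpected linear system of parameters if and only if $\Delta$ is balanced. Moreover, in this case the colored sop of $\Delta$ is the unique unexpected linear system of parameters of $\Delta$ up to equality of ideals; that is, the colored sop $\theta_1,\dots,\theta_{d+1}$ is an unexpected linear system of parameters, and for every unexpected linear system of parameters $\theta_1',\dots,\theta_{d+1}'$ of $\Delta$ one has $I_\Delta+(\theta_1',\dots,\theta_{d+1}')=I_\Delta+(\theta_1,\dots,\theta_{d+1})$.
   Context: $R=\mathbb{K}[x_1,\dots,x_n]$ and $I_\Delta=(\prod_{i\in\sigma}x_i : \sigma\subseteq[n],\ \sigma\notin\Delta)\subset R$ is the Stanley-Reisner ideal of $\Delta$; every element of $[n]$ is a vertex of $\Delta$. $\mathrm{HF}(i,A)=\dim_{\mathbb{K}}A_i$. $h_\Delta(x)=\sum_i h_i x^i$ is the $h$-polynomial of the $d$-dimensional complex $\Delta$: $\sum_{i=0}^{d+1}f_{i-1}(x-1)^{d+1-i}=\sum_{i=0}^{d+1}h_i x^{d+1-i}$, where $f_j$ is the number of $j$-dimensional faces (equivalently, the Hilbert series of $R/I_\Delta$ is $h_\Delta(x)/(1-x)^{d+1}$). A system of parameters (sop) of $I_\Delta$ is a sequence of homogeneous elements $\theta_1,\dots,\theta_{d+1}\in R$ such that $R/(I_\Delta+(\theta_1,\dots,\theta_{d+1}))$ is a finite dimensional $\mathbb{K}$-vector space; it is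 linear if all $\theta_i$ are linear forms. Let $L=x_1+\dots+x_n$. For integers $a>0$ and $t\ge\deg h_\Delta(x)$, a sop $\theta_1,\dots,\theta_{d+1}$ of $I_\Delta$ is an $a$-unexpected sop of total degree $t$ of $\Delta$ if: (i) $\deg\theta_1+\dots+\deg\theta_{d+1}+\deg h_\Delta(x)-d-1=t$; (ii) $L\in I_\Delta+(\theta_1,\dots,\theta_{d+1})$; (iii) $x_i^a\in I_\Delta+(\theta_1,\dots,\theta_{d+1})$ for every $i$; (iv) $\mathrm{HF}(t,R/J)\le \mathrm{HF}(t-1,R/J)$, where $J=I_\Delta+(x_1^a,\dots,x_n^a)$. An unexpected linear sop of $\Delta$ is a linear sop that is $a$-unexpected of total degree $t$ for some integers $a,t>0$. A $d$-dimensional complex $\Delta$ is balanced if there is a coloring $\rho:[n]\to[d+1]$ such that $\rho(u)\ne\rho(v)$ whenever $\{u,v\}\in\Delta$, $u\neq v$. The colored sop of a balanced $\Delta$ with respect to such a coloring $\rho$ is $\theta_i=\sum_{v\in\rho^{-1}(i)}x_v$ for $i\in[d+1]$ (known to be a sop of $I_\Delta$ when $\Delta$ is Cohen-Macaulay, in particular for spheres). *)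

theory Defs
  imports
    "HOL-Library.Poly_Mapping"
    "HOL-Computational_Algebra.Polynomial"
    "HOL-Analysis.Analysis"
    "HOL-Algebra.QuotRing"
    "HOL-Algebra.Embedded_Algebras"
begin

section \<open>The polynomial ring in the variables indexed by 1, ..., n\<close>

text \<open>
  A polynomial is a finitely supported map from exponent vectors to coefficients. The type has
  infinitely many variables; the carrier of \<open>mpoly_ring n\<close> selects the polynomials in which only
  the variables with index in \<open>{1..n}\<close> occur.
\<close>

type_synonym 'k mpoly = "(nat \<Rightarrow>\<^sub>0 nat) \<Rightarrow>\<^sub>0 'k"

definition mpoly_ring :: "nat \<Rightarrow> ('k::field) mpoly ring" where
  "mpoly_ring n =
     \<lparr>carrier = {p. \<forall>m \<in> Poly_Mapping.keys p. Poly_Mapping.keys m \<subseteq> {1..n}},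
      mult = (*), one = 1, zero = 0, add = (+)\<rparr>"

definition mvar :: "nat \<Rightarrow> ('k::field) mpoly" where
  "mvar i = Poly_Mapping.single (Poly_Mapping.single i 1) 1"

definition mconst :: "'k \<Rightarrow> ('k::field) mpoly" where
  "mconst c = Poly_Mapping.single 0 c"

definition mon_degree :: "(nat \<Rightarrow>\<^sub>0 nat) \<Rightarrow> nat" where
  "mon_degree m = (\<Sum>i \<in> Poly_Mapping.keys m. Poly_Mapping.lookup m i)"

text \<open>Convention: the zero polynomial has total degree 0.\<close>

definition total_degree :: "('k::field) mpoly \<Rightarrow> nat" where
  "total_degree p = Max (insert 0 (mon_degree ` Poly_Mapping.keys p))"

text \<open>
  The degree is an integer so that the component in degree -1 is available; components in negative
  degree are zero.
\<close>

definition hom_component :: "nat \<Rightarrow> int \<Rightarrow> ('k::field) mpoly set" where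
  "hom_component n i =
     {p \<in> carrier (mpoly_ring n). \<forall>m \<in> Poly_Mapping.keys p. int (mon_degree m) = i}"

definition homogeneous :: "nat \<Rightarrow> ('k::field) mpoly \<Rightarrow> bool" where
  "homogeneous n p \<longleftrightarrow> (\<exists>i. p \<in> hom_component n i)"

lemma mpoly_ring_cring: "cring (mpoly_ring n :: ('k::field) mpoly ring)"
proof -
  define V :: "'k mpoly set"
    where "V = {p. \<forall>m \<in> Poly_Mapping.keys p. Poly_Mapping.keys m \<subseteq> {1..n}}"
  have R: "mpoly_ring n = \<lparr>carrier = V, mult = (*), one = 1, zero = 0, add = (+)\<rparr>"
    unfolding mpoly_ring_def V_def by (rule refl)
  have add: "p + q \<in> V" if "p \<in> V" "q \<in> V" for p q
    using that Poly_Mapping.keys_add[of p q] unfolding V_def by blast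
  have mult: "p * q \<in> V" if "p \<in> V" "q \<in> V" for p q
    unfolding V_def
  proof (intro CollectI ballI)
    fix m assume "m \<in> Poly_Mapping.keys (p * q)"
    then obtain a b where "m = a + b" "a \<in> Poly_Mapping.keys p" "b \<in> Poly_Mapping.keys q"
      using Poly_Mapping.keys_mult[of p q] by blast
    with that have "m = a + b" "Poly_Mapping.keys a \<subseteq> {1..n}" "Poly_Mapping.keys b \<subseteq> {1..n}"
      unfolding V_def by simp_all
    then show "Poly_Mapping.keys m \<subseteq> {1..n}"
      using Poly_Mapping.keys_add[of a b] by blast
  qed
  have neg: "- p \<in> V" if "p \<in> V" for p
    using that by (simp add: V_def)
  have zero: "0 \<in> V" and one: "1 \<in> V"
    by (simp_all add: V_def)
  show ?thesis
    unfolding R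
  proof (rule cringI)
    show "abelian_group \<lparr>carrier = V, mult = (*), one = 1, zero = 0, add = (+)\<rparr>"
    proof (rule abelian_groupI)
      fix x assume "x \<in> carrier \<lparr>carrier = V, mult = (*), one = 1, zero = 0, add = (+)\<rparr>"
      then show "\<exists>y\<in>carrier \<lparr>carrier = V, mult = (*), one = 1, zero = 0, add = (+)\<rparr>.
          y \<oplus>\<^bsub>\<lparr>carrier = V, mult = (*), one = 1, zero = 0, add = (+)\<rparr>\<^esub> x =
          \<zero>\<^bsub>\<lparr>carrier = V, mult = (*), one = 1, zero = 0, add = (+)\<rparr>\<^esub>"
        by (intro bexI[of _ "- x"]) (simp_all add: neg)
    qed (simp_all add: add zero add_ac)
    show "comm_monoid \<lparr>carrier = V, mult = (*), one = 1, zero = 0, add = (+)\<rparr>"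
      by (rule comm_monoidI) (simp_all add: mult one mult_ac)
  qed (simp add: distrib_right)
qed

section \<open>Graded quotients and Hilbert functions\<close>

text \<open>The image of the field of constants in the quotient by an ideal, acting as its scalars.\<close>

definition quot_consts :: "nat \<Rightarrow> ('k::field) mpoly set \<Rightarrow> 'k mpoly set set" where
  "quot_consts n J = (\<lambda>c. J +>\<^bsub>mpoly_ring n\<^esub> mconst c) ` UNIV"

text \<open>The Hilbert function of the quotient by a homogeneous ideal \<open>J\<close>.\<close>

definition HF :: "nat \<Rightarrow> int \<Rightarrow> ('k::field) mpoly set \<Rightarrow> nat" where
  "HF n i J = ring.dim (mpoly_ring n Quot J) (quot_consts n J)
                ((\<lambda>p. J +>\<^bsub>mpoly_ring n\<^esub> p) ` hom_component n i)"

definition finite_dim_quot :: "nat \<Rightarrow> ('k::field) mpoly set \<Rightarrow> bool" where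
  "finite_dim_quot n J \<longleftrightarrow>
     ring.finite_dimension (mpoly_ring n Quot J) (quot_consts n J) (carrier (mpoly_ring n Quot J))"

section \<open>Simplicial complexes on the vertex set 1, ..., n\<close>

definition complex_on :: "nat \<Rightarrow> nat set set \<Rightarrow> bool" where
  "complex_on n \<Delta> \<longleftrightarrow>
     \<Delta> \<subseteq> Pow {1..n} \<and> {} \<in> \<Delta> \<and> (\<forall>\<sigma> \<in> \<Delta>. \<forall>\<tau> \<subseteq> \<sigma>. \<tau> \<in> \<Delta>) \<and> (\<forall>i \<in> {1..n}. {i} \<in> \<Delta>)"

text \<open>Truncated subtraction affects only the complex \<open>{{}}\<close>, which has no vertices.\<close>

definition complex_dim :: "nat set set \<Rightarrow> nat" where
  "complex_dim \<Delta> = Max (card ` \<Delta>) - 1"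

text \<open>
  Points of the geometric realization in barycentric coordinates; the topology is that of a
  subspace of the product topology, which on the coordinates in \<open>{1..n}\<close> is the Euclidean one.
\<close>

definition realization :: "nat \<Rightarrow> nat set set \<Rightarrow> (nat \<Rightarrow> real) topology" where
  "realization n \<Delta> = subtopology (powertop_real UNIV)
     {x. (\<forall>i. 0 \<le> x i) \<and> {i. x i \<noteq> 0} \<in> \<Delta> \<and> (\<Sum>i \<in> {1..n}. x i) = 1}"

text \<open>\<open>face_number \<Delta> i\<close> counts faces by cardinality, so it is $f_{i-1}$.\<close>

definition face_number :: "nat set set \<Rightarrow> nat \<Rightarrow> nat" where
  "face_number \<Delta> i = card {\<sigma> \<in> \<Delta>. card \<sigma> = i}"

text \<open>
  The polynomial $\sum_{i=0}^{d+1} f_{i-1} (x-1)^{d+1-i}$, whose coefficient of $x^{d+1-i}$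
  is $h_i$.
\<close>

definition shifted_f_poly :: "nat set set \<Rightarrow> int poly" where
  "shifted_f_poly \<Delta> = (\<Sum>i \<le> complex_dim \<Delta> + 1.
     Polynomial.smult (int (face_number \<Delta> i)) ([:-1, 1:] ^ (complex_dim \<Delta> + 1 - i)))"

definition h_poly :: "nat set set \<Rightarrow> int poly" where
  "h_poly \<Delta> = (\<Sum>i \<le> complex_dim \<Delta> + 1.
     Polynomial.monom (Polynomial.coeff (shifted_f_poly \<Delta>) (complex_dim \<Delta> + 1 - i)) i)"

definition SR_ideal :: "nat \<Rightarrow> nat set set \<Rightarrow> ('k::field) mpoly set" where
  "SR_ideal n \<Delta> = Idl\<^bsub>mpoly_ring n\<^esub> {\<Prod>i \<in> \<sigma>. mvar i | \<sigma>. \<sigma> \<subseteq> {1..n} \<and> \<sigma> \<notin> \<Delta>}"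

section \<open>Systems of parameters\<close>

definition SR_ideal_plus :: "nat \<Rightarrow> nat set set \<Rightarrow> ('k::field) mpoly set \<Rightarrow> 'k mpoly set" where
  "SR_ideal_plus n \<Delta> S = SR_ideal n \<Delta> <+>\<^bsub>mpoly_ring n\<^esub> Idl\<^bsub>mpoly_ring n\<^esub> S"

definition is_sop :: "nat \<Rightarrow> nat set set \<Rightarrow> ('k::field) mpoly list \<Rightarrow> bool" where
  "is_sop n \<Delta> \<theta> \<longleftrightarrow>
     length \<theta> = complex_dim \<Delta> + 1 \<and> (\<forall>p \<in> set \<theta>. homogeneous n p) \<and>
     finite_dim_quot n (SR_ideal_plus n \<Delta> (set \<theta>))"

definition is_linear_sop :: "nat \<Rightarrow> nat set set \<Rightarrow> ('k::field) mpoly list \<Rightarrow> bool" where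
  "is_linear_sop n \<Delta> \<theta> \<longleftrightarrow> is_sop n \<Delta> \<theta> \<and> (\<forall>p \<in> set \<theta>. p \<in> hom_component n 1)"

text \<open>
  The degree condition $\sum_i \deg\theta_i + \deg h_\Delta - d - 1 = t$ is stated without
  subtraction.
\<close>

definition unexpected_sop ::
    "nat \<Rightarrow> nat set set \<Rightarrow> nat \<Rightarrow> nat \<Rightarrow> ('k::field) mpoly list \<Rightarrow> bool" where
  "unexpected_sop n \<Delta> a t \<theta> \<longleftrightarrow>
     0 < a \<and> Polynomial.degree (h_poly \<Delta>) \<le> t \<and> is_sop n \<Delta> \<theta> \<and>
     sum_list (map total_degree \<theta>) + Polynomial.degree (h_poly \<Delta>) = t + complex_dim \<Delta> + 1 \<and>
     (\<Sum>i \<in> {1..n}. mvar i) \<in> SR_ideal_plus n \<Delta> (set \<theta>) \<and>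
     (\<forall>i \<in> {1..n}. mvar i ^ a \<in> SR_ideal_plus n \<Delta> (set \<theta>)) \<and>
     (let J = SR_ideal_plus n \<Delta> ((\<lambda>i. (mvar i :: 'k mpoly) ^ a) ` {1..n})
      in HF n (int t) J \<le> HF n (int t - 1) J)"

definition unexpected_linear_sop :: "nat \<Rightarrow> nat set set \<Rightarrow> ('k::field) mpoly list \<Rightarrow> bool" where
  "unexpected_linear_sop n \<Delta> \<theta> \<longleftrightarrow>
     is_linear_sop n \<Delta> \<theta> \<and> (\<exists>a > 0. \<exists>t > 0. unexpected_sop n \<Delta> a t \<theta>)"

section \<open>Balanced complexes\<close>

definition balanced_coloring :: "nat \<Rightarrow> nat set set \<Rightarrow> (nat \<Rightarrow> nat) \<Rightarrow> bool" where
  "balanced_coloring n \<Delta> \<rho> \<longleftrightarrow>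
     \<rho> \<in> {1..n} \<rightarrow> {1..complex_dim \<Delta> + 1} \<and>
     (\<forall>u v. {u, v} \<in> \<Delta> \<and> u \<noteq> v \<longrightarrow> \<rho> u \<noteq> \<rho> v)"

definition balanced :: "nat \<Rightarrow> nat set set \<Rightarrow> bool" where
  "balanced n \<Delta> \<longleftrightarrow> (\<exists>\<rho>. balanced_coloring n \<Delta> \<rho>)"

definition colored_sop :: "nat \<Rightarrow> nat set set \<Rightarrow> (nat \<Rightarrow> nat) \<Rightarrow> ('k::field) mpoly list" where
  "colored_sop n \<Delta> \<rho> =
     map (\<lambda>i. \<Sum>v \<in> {v \<in> {1..n}. \<rho> v = i}. mvar v) [1..<complex_dim \<Delta> + 2]"

end

theory Submission
  imports Defs "HOL-Homology.Simplices"
begin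

text \<open>
  Topology enters once: removing the barycentre of a nonempty face \<open>\<sigma>\<close> from a triangulated sphere
  leaves a contractible space that retracts onto the subcomplex of faces not containing \<open>\<sigma>\<close>, so
  this deletion is contractible, and subdividing singular fillings finely and mapping points to
  dominant vertices shows that its simplicial chain complex is acyclic over the integers. Acyclicity
  of all deletions forces purity, ridges in exactly two facets, a fundamental cycle, strong
  connectivity and the Euler characteristic of a sphere; the latter gives \<open>deg h = d + 1\<close>.

  A linear system has total degree \<open>t \<le> d + 1\<close>. For \<open>a \<ge> 3\<close> every monomial of degree \<open>t - 1\<close> in the
  truncated ring has more multiples in degree \<open>t\<close> than each of these has divisors in degree
  \<open>t - 1\<close>, so the Hilbert function grows; hence all squares of variables lie in the ideal. Let
  \<open>p\<^sub>v\<close> be the vector of coefficients of \<open>x\<^sub>v\<close> in the linear forms. A symmetric matrix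
  supported on faces whose rows are relations between the \<open>p\<^sub>v\<close> is a functional on quadrics
  killing the ideal, so its diagonal vanishes. Such matrices exist on the star of every face of
  codimension two (the weights on the edges of the link cycle are the reciprocals of determinants),
  and their diagonals vanish only if the two vertices completing a ridge to a facet have parallel
  vectors. Membership of \<open>L\<close> makes these vectors equal, and moving across ridges shows that there
  are only \<open>d + 1\<close> distinct vectors, which are the colors.
\<close>

text \<open>Links of faces in a triangulated sphere need not be spheres. Local facts are therefore
  extracted from a global one: a cycle that avoids some face lies in the deletion of that face and
  bounds there, and a suitable choice of cycle makes this impossible or decisive. Integral chains
  give one fundamental cycle for all fields; characteristic zero keeps its nonzero coefficients
  nonzero when they become edge weights of a stress.

  Ideal membership is exploited in one way: a linear functional that kills all monomial multiples of
  the generators kills the ideal. Evaluation at a point supported on a face then shows that the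
  vectors of the vertices of a face are independent, so the determinants under the edge weights do
  not vanish.

  The constant 3 comes from saturated variables: one with the largest exponent a - 1 cannot be
  raised further, but for a \<ge> 3 it has already used two units of degree, which pays for the
  loss. For a = 2 growth fails between ridges and facets, and this failure is what makes the colored
  system unexpected.\<close>

abbreviation "keys \<equiv> Poly_Mapping.keys"
abbreviation "lookup \<equiv> Poly_Mapping.lookup"
abbreviation "single \<equiv> Poly_Mapping.single"

section \<open>Oriented simplicial chains\<close>

text \<open>Only elements strictly below \<open>v\<close> are counted, so the sign is the same for
  \<open>\<tau>\<close>, \<open>insert v \<tau>\<close> and \<open>\<tau> - {v}\<close>; cone and
  boundary can share it.\<close>

definition vertex_sign :: "nat \<Rightarrow> nat set \<Rightarrow> int" where
  "vertex_sign v \<tau> = (-1) ^ card {u \<in> \<tau>. u < v}"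

text \<open>Left exterior multiplication by \<open>v\<close>: a finite set stands for the wedge
  product of its elements in increasing order.\<close>

definition cone :: "nat \<Rightarrow> (nat set \<Rightarrow>\<^sub>0 int) \<Rightarrow> (nat set \<Rightarrow>\<^sub>0 int)" where
  "cone v = frag_extend (\<lambda>\<tau>. if v \<in> \<tau> then 0 else frag_cmul (vertex_sign v \<tau>) (frag_of (insert v \<tau>)))"

text \<open>Contraction in the exterior algebra with the functional that is 1 on every vertex.
  Singletons are sent to the empty set, so the augmentation is built in and homology is
  reduced.\<close>

definition bd :: "(nat set \<Rightarrow>\<^sub>0 int) \<Rightarrow> (nat set \<Rightarrow>\<^sub>0 int)" where
  "bd = frag_extend (\<lambda>\<tau>. \<Sum>v\<in>\<tau>. frag_cmul (vertex_sign v \<tau>) (frag_of (\<tau> - {v})))"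

text \<open>Zero on lists with a repeated entry, so degenerate simplices disappear without a
  separate case.\<close>

definition wedge :: "nat list \<Rightarrow> (nat set \<Rightarrow>\<^sub>0 int)" where
  "wedge vs = foldr cone vs (frag_of {})"

lemma vertex_sign_mult_self [simp]: "vertex_sign v \<tau> * vertex_sign v \<tau> = 1"
  by (simp add: vertex_sign_def flip: power_mult_distrib)

lemma vertex_sign_nonzero [simp]: "vertex_sign v \<tau> \<noteq> 0"
  by (simp add: vertex_sign_def)

lemma vertex_sign_insert:
  assumes "finite \<tau>" "u \<notin> \<tau>"
  shows "vertex_sign v (insert u \<tau>) = (if u < v then - vertex_sign v \<tau> else vertex_sign v \<tau>)"
proof -
  have "{w \<in> insert u \<tau>. w < v} = (if u < v then insert u {w \<in> \<tau>. w < v} else {w \<in> \<tau>. w < v})"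
    by auto
  with assms show ?thesis
    by (simp add: vertex_sign_def)
qed

lemma vertex_sign_Diff_self [simp]: "vertex_sign v (\<tau> - {v}) = vertex_sign v \<tau>"
  unfolding vertex_sign_def by (rule arg_cong[where f = "\<lambda>S. (-1) ^ card S"]) auto

lemma vertex_sign_insert_self [simp]: "vertex_sign v (insert v \<tau>) = vertex_sign v \<tau>"
  unfolding vertex_sign_def by (rule arg_cong[where f = "\<lambda>S. (-1) ^ card S"]) auto

lemma cone_0 [simp]: "cone v 0 = 0" and bd_0 [simp]: "bd 0 = 0"
  by (simp_all add: cone_def bd_def)

lemma cone_add: "cone v (a + b) = cone v a + cone v b"
  and cone_diff: "cone v (a - b) = cone v a - cone v b"
  and cone_cmul: "cone v (frag_cmul k a) = frag_cmul k (cone v a)"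
  by (simp_all add: cone_def frag_extend_add frag_extend_diff frag_extend_cmul)

lemma bd_diff: "bd (a - b) = bd a - bd b"
  and bd_cmul: "bd (frag_cmul k a) = frag_cmul k (bd a)"
  by (simp_all add: bd_def frag_extend_diff frag_extend_cmul)

lemma cone_sum: "cone v (sum f I) = (\<Sum>i\<in>I. cone v (f i))"
  by (induction I rule: infinite_finite_induct) (simp_all add: cone_add)

lemma cone_of: "cone v (frag_of \<tau>) = (if v \<in> \<tau> then 0 else frag_cmul (vertex_sign v \<tau>) (frag_of (insert v \<tau>)))"
  by (simp add: cone_def)

lemma bd_of: "bd (frag_of \<tau>) = (\<Sum>v\<in>\<tau>. frag_cmul (vertex_sign v \<tau>) (frag_of (\<tau> - {v})))"
  by (simp add: bd_def)

text \<open>The Clifford relation makes the boundary an antiderivation for the exterior product; it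
  replaces all sign bookkeeping with permutations.\<close>

lemma bd_cone:
  assumes "keys c \<subseteq> Collect finite"
  shows "bd (cone v c) = c - cone v (bd c)"
  using assms
proof (induction c rule: frag_induction)
  case zero
  then show ?case by simp
next
  case (one \<tau>)
  then have fin: "finite \<tau>" by simp
  show ?case
  proof (cases "v \<in> \<tau>")
    case True
    have "cone v (bd (frag_of \<tau>)) = (\<Sum>u\<in>\<tau>. if u = v then frag_of \<tau> else 0)"
      unfolding bd_of cone_sum cone_cmul
      by (rule sum.cong) (use True in \<open>auto simp: cone_of insert_absorb\<close>)
    also have "\<dots> = frag_of \<tau>"
      using fin True by simp
    finally show ?thesis
      using True by (simp add: cone_of)
  next
    case False
    have 1: "bd (cone v (frag_of \<tau>)) = frag_of \<tau> +
       (\<Sum>u\<in>\<tau>. frag_cmul (vertex_sign v \<tau> * vertex_sign u (insert v \<tau>)) (frag_of (insert v (\<tau> - {u}))))"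
    proof -
      have "insert v \<tau> - {u} = insert v (\<tau> - {u})" if "u \<in> \<tau>" for u
        using that False by auto
      then have "(\<Sum>u\<in>\<tau>. frag_cmul (vertex_sign u (insert v \<tau>)) (frag_of (insert v \<tau> - {u}))) =
          (\<Sum>u\<in>\<tau>. frag_cmul (vertex_sign u (insert v \<tau>)) (frag_of (insert v (\<tau> - {u}))))"
        by (intro sum.cong) auto
      then have "bd (frag_of (insert v \<tau>)) = frag_cmul (vertex_sign v \<tau>) (frag_of \<tau>) +
          (\<Sum>u\<in>\<tau>. frag_cmul (vertex_sign u (insert v \<tau>)) (frag_of (insert v (\<tau> - {u}))))"
        using False fin by (simp add: bd_of)
      moreover have "bd (cone v (frag_of \<tau>)) = frag_cmul (vertex_sign v \<tau>) (bd (frag_of (insert v \<tau>)))"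
        using False by (simp add: cone_of bd_cmul)
      ultimately show ?thesis
        using fin by (simp add: frag_cmul_distrib2 frag_cmul_sum)
    qed
    have 2: "cone v (bd (frag_of \<tau>)) =
       (\<Sum>u\<in>\<tau>. - frag_cmul (vertex_sign v \<tau> * vertex_sign u (insert v \<tau>)) (frag_of (insert v (\<tau> - {u}))))"
      unfolding bd_of cone_sum cone_cmul
    proof (rule sum.cong[OF refl])
      fix u assume u: "u \<in> \<tau>"
      with False have ne: "u \<noteq> v" by auto
      have "vertex_sign v \<tau> = (if u < v then - vertex_sign v (\<tau> - {u}) else vertex_sign v (\<tau> - {u}))"
        using vertex_sign_insert[of "\<tau> - {u}" u v] u fin by (simp add: insert_absorb)
      moreover have "vertex_sign u (insert v \<tau>) = (if v < u then - vertex_sign u \<tau> else vertex_sign u \<tau>)"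
        using vertex_sign_insert[of \<tau> v u] False fin by simp
      ultimately show "frag_cmul (vertex_sign u \<tau>) (cone v (frag_of (\<tau> - {u}))) =
          - frag_cmul (vertex_sign v \<tau> * vertex_sign u (insert v \<tau>)) (frag_of (insert v (\<tau> - {u})))"
        using ne False by (auto simp: cone_of mult.commute)
    qed
    show ?thesis
      unfolding 1 2 by (simp add: sum_negf del: minus_frag_cmul)
  qed
next
  case (diff a b)
  then show ?case by (simp add: bd_diff cone_diff)
qed

lemma wedge_Nil [simp]: "wedge [] = frag_of {}"
  and wedge_Cons: "wedge (v # vs) = cone v (wedge vs)"
  by (simp_all add: wedge_def)

lemma keys_cone: "keys (cone v c) \<subseteq> {insert v \<tau> |\<tau>. \<tau> \<in> keys c \<and> v \<notin> \<tau>}"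
proof
  fix \<rho> assume "\<rho> \<in> keys (cone v c)"
  then obtain \<tau> where "\<tau> \<in> keys c"
      "\<rho> \<in> keys (if v \<in> \<tau> then 0 else frag_cmul (vertex_sign v \<tau>) (frag_of (insert v \<tau>)))"
    unfolding cone_def using subsetD[OF keys_frag_extend] by (smt (verit) UN_iff)
  then show "\<rho> \<in> {insert v \<tau> |\<tau>. \<tau> \<in> keys c \<and> v \<notin> \<tau>}"
    by (auto simp: keys_frag_of split: if_splits)
qed

lemma keys_wedge: "\<tau> \<in> keys (wedge vs) \<Longrightarrow> \<tau> = set vs \<and> distinct vs"
proof (induction vs arbitrary: \<tau>)
  case Nil
  then show ?case by (simp add: keys_frag_of)
next
  case (Cons v vs)
  then obtain \<rho> where "\<tau> = insert v \<rho>" "\<rho> \<in> keys (wedge vs)" "v \<notin> \<rho>"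
    using keys_cone[of v "wedge vs"] by (auto simp: wedge_Cons)
  with Cons.IH[of \<rho>] show ?case by auto
qed

lemma wedge_sorted: "sorted vs \<Longrightarrow> distinct vs \<Longrightarrow> wedge vs = frag_of (set vs)"
proof (induction vs)
  case (Cons v vs)
  then have less: "{u \<in> set vs. u < v} = {}" by auto
  have "vertex_sign v (set vs) = 1"
    unfolding vertex_sign_def less by simp
  with Cons show ?case by (auto simp: wedge_Cons cone_of)
qed simp

text \<open>Unrolls the Clifford relation along the list. Repetitions are allowed, so the formula
  matches the singular boundary face by face even when several corners get the same vertex.\<close>

lemma bd_wedge:
  "bd (wedge vs) = (\<Sum>k<length vs. frag_cmul ((-1) ^ k) (wedge (take k vs @ drop (Suc k) vs)))"
proof (induction vs)
  case Nil
  then show ?case by (simp add: bd_of)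
next
  case (Cons v vs)
  have "keys (wedge vs) \<subseteq> Collect finite"
    using keys_wedge by auto
  then have "bd (wedge (v # vs)) = wedge vs - cone v (bd (wedge vs))"
    by (simp add: wedge_Cons bd_cone)
  also have "\<dots> = wedge vs + (\<Sum>k<length vs. frag_cmul ((-1) ^ Suc k) (wedge (v # take k vs @ drop (Suc k) vs)))"
    unfolding Cons.IH by (simp add: cone_sum cone_cmul wedge_Cons sum_negf flip: minus_frag_cmul)
  also have "\<dots> = (\<Sum>k<length (v # vs). frag_cmul ((-1) ^ k) (wedge (take k (v # vs) @ drop (Suc k) (v # vs))))"
    by (simp add: sum.lessThan_Suc_shift del: sum.lessThan_Suc)
  finally show ?case .
qed

lemma lookup_bd_of:
  assumes "finite \<rho>"
  shows "lookup (bd (frag_of \<rho>)) \<tau> =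
    (\<Sum>v\<in>\<rho>. if \<rho> - {v} = \<tau> then vertex_sign v \<tau> else 0)"
  unfolding bd_of lookup_sum
  by (rule sum.cong[OF refl]) (auto simp: lookup_single)

lemma lookup_frag_extend:
  assumes "finite A" "keys c \<subseteq> A"
  shows "lookup (frag_extend f c) \<tau> =
    (\<Sum>\<rho>\<in>A. lookup c \<rho> * lookup (f \<rho>) \<tau>)"
proof -
  have "lookup (frag_extend f c) \<tau> =
    (\<Sum>\<rho>\<in>keys c. lookup c \<rho> * lookup (f \<rho>) \<tau>)"
    by (simp add: frag_extend_def lookup_sum)
  also have "\<dots> = (\<Sum>\<rho>\<in>A. lookup c \<rho> * lookup (f \<rho>) \<tau>)"
    by (rule sum.mono_neutral_left) (use assms in \<open>auto simp: in_keys_iff\<close>)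
  finally show ?thesis .
qed

text \<open>Groups the boundary by cofaces: a vanishing boundary becomes one linear equation for
  each face \<open>\<tau>\<close>, with a term for each vertex that extends it.\<close>

lemma lookup_bd:
  assumes c: "keys c \<subseteq> Pow V" and V: "finite V" and \<tau>: "\<tau> \<subseteq> V"
  shows "lookup (bd c) \<tau> =
    (\<Sum>v\<in>V - \<tau>. vertex_sign v \<tau> * lookup c (insert v \<tau>))"
proof -
  have "lookup (bd c) \<tau> =
      (\<Sum>\<rho>\<in>Pow V. lookup c \<rho> * (\<Sum>v\<in>\<rho>. if \<rho> - {v} = \<tau> then vertex_sign v \<tau> else 0))"
    unfolding bd_def lookup_frag_extend[OF finite_Pow_iff[THEN iffD2, OF V] c]
    using V by (intro sum.cong refl arg_cong2[where f = "(*)"])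
      (auto simp: lookup_bd_of[unfolded bd_of] dest: finite_subset)
  also have "\<dots> = (\<Sum>\<rho>\<in>Pow V. \<Sum>v\<in>V - \<tau>. if \<rho> = insert v \<tau> then vertex_sign v \<tau> * lookup c \<rho> else 0)"
  proof (rule sum.cong[OF refl])
    fix \<rho> assume \<rho>: "\<rho> \<in> Pow V"
    have "(\<Sum>v\<in>\<rho>. if \<rho> - {v} = \<tau> then vertex_sign v \<tau> else 0) =
        (\<Sum>v\<in>V - \<tau>. if \<rho> = insert v \<tau> then vertex_sign v \<tau> else 0)"
      by (rule sum.mono_neutral_cong)
        (use \<rho> V in \<open>auto simp: finite_subset\<close>)
    then show "lookup c \<rho> * (\<Sum>v\<in>\<rho>. if \<rho> - {v} = \<tau> then vertex_sign v \<tau> else 0) =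
        (\<Sum>v\<in>V - \<tau>. if \<rho> = insert v \<tau> then vertex_sign v \<tau> * lookup c \<rho> else 0)"
      by (auto simp: sum_distrib_left intro!: sum.cong)
  qed
  also have "\<dots> = (\<Sum>v\<in>V - \<tau>. \<Sum>\<rho>\<in>Pow V. if \<rho> = insert v \<tau> then vertex_sign v \<tau> * lookup c \<rho> else 0)"
    by (rule sum.swap)
  also have "\<dots> = (\<Sum>v\<in>V - \<tau>. vertex_sign v \<tau> * lookup c (insert v \<tau>))"
    by (rule sum.cong[OF refl]) (use V \<tau> in auto)
  finally show ?thesis .
qed

lemma keys_bd: "\<tau> \<in> keys (bd c) \<Longrightarrow> \<exists>\<rho>\<in>keys c. \<exists>v\<in>\<rho>. \<tau> = \<rho> - {v}"
proof -
  assume "\<tau> \<in> keys (bd c)"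
  then obtain \<rho> where \<rho>: "\<rho> \<in> keys c"
      "\<tau> \<in> keys (\<Sum>v\<in>\<rho>. frag_cmul (vertex_sign v \<rho>) (frag_of (\<rho> - {v})))"
    unfolding bd_def using subsetD[OF keys_frag_extend] by (smt (verit) UN_iff)
  then obtain v where "v \<in> \<rho>" "\<tau> \<in> keys (frag_cmul (vertex_sign v \<rho>) (frag_of (\<rho> - {v})))"
    using keys_sum[of "\<lambda>v. frag_cmul (vertex_sign v \<rho>) (frag_of (\<rho> - {v}))" \<rho>] by blast
  with \<rho> show ?thesis by (auto simp: keys_frag_of)
qed

lemma bd_bd:
  assumes "keys c \<subseteq> Collect finite"
  shows "bd (bd c) = 0"
  using assms
proof (induction c rule: frag_induction)
  case (one \<tau>)
  have "bd (bd (wedge vs)) = 0" for vs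
  proof (induction vs)
    case Nil
    then show ?case by (simp add: bd_of)
  next
    case (Cons v vs)
    have 1: "keys (wedge vs) \<subseteq> Collect finite"
      using keys_wedge by auto
    then have 2: "keys (bd (wedge vs)) \<subseteq> Collect finite"
      using keys_bd by fastforce
    show ?case
      by (simp add: wedge_Cons bd_cone[OF 1] bd_diff bd_cone[OF 2] Cons)
  qed
  from this[of "sorted_list_of_set \<tau>"] one show ?case
    by (simp add: wedge_sorted)
qed (simp_all add: bd_diff)

section \<open>Acyclicity, contracting homotopies and the Euler characteristic\<close>

definition acyclic_complex :: "nat set set \<Rightarrow> bool" where
  "acyclic_complex \<Gamma> \<longleftrightarrow> (\<forall>q c. keys c \<subseteq> {\<tau> \<in> \<Gamma>. card \<tau> = q} \<and> bd c = 0 \<longrightarrow>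
     (\<exists>b. keys b \<subseteq> {\<tau> \<in> \<Gamma>. card \<tau> = Suc q} \<and> bd b = c))"

lemma acyclic_complexD:
  assumes "acyclic_complex \<Gamma>" "keys c \<subseteq> {\<tau> \<in> \<Gamma>. card \<tau> = q}" "bd c = 0"
  shows "\<exists>b. keys b \<subseteq> {\<tau> \<in> \<Gamma>. card \<tau> = Suc q} \<and> bd b = c"
  using assms unfolding acyclic_complex_def by blast

text \<open>Built by increasing cardinality: once \<open>s\<close> is defined on the faces of the
  boundary of \<open>\<tau>\<close>, the defect
  \<open>frag_of \<tau> - frag_extend s (bd (frag_of \<tau>))\<close> is a cycle, and acyclicity
  fills it.\<close>

lemma acyclic_complex_contraction:
  assumes ac: "acyclic_complex \<Gamma>" and fin: "\<And>\<tau>. \<tau> \<in> \<Gamma> \<Longrightarrow> finite \<tau>"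
    and down: "\<And>\<tau> \<rho>. \<tau> \<in> \<Gamma> \<Longrightarrow> \<rho> \<subseteq> \<tau> \<Longrightarrow> \<rho> \<in> \<Gamma>"
  shows "\<exists>s. \<forall>\<tau>\<in>\<Gamma>. card \<tau> < q \<longrightarrow> keys (s \<tau>) \<subseteq> {\<rho> \<in> \<Gamma>. card \<rho> = Suc (card \<tau>)} \<and>
    bd (s \<tau>) + frag_extend s (bd (frag_of \<tau>)) = frag_of \<tau>"
proof (induction q)
  case (Suc q)
  then obtain s where s: "\<And>\<tau>. \<tau> \<in> \<Gamma> \<Longrightarrow> card \<tau> < q \<Longrightarrow> keys (s \<tau>) \<subseteq> {\<rho> \<in> \<Gamma>. card \<rho> = Suc (card \<tau>)}"
    "\<And>\<tau>. \<tau> \<in> \<Gamma> \<Longrightarrow> card \<tau> < q \<Longrightarrow> bd (s \<tau>) + frag_extend s (bd (frag_of \<tau>)) = frag_of \<tau>"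
    by blast
  have faces: "\<rho> \<in> \<Gamma> \<and> Suc (card \<rho>) = card \<tau>" if \<rho>: "\<tau> \<in> \<Gamma>" "\<rho> \<in> keys (bd (frag_of \<tau>))" for \<tau> \<rho>
  proof -
    obtain v where v: "v \<in> \<tau>" "\<rho> = \<tau> - {v}"
      using keys_bd[OF \<rho>(2)] by (auto simp: keys_frag_of)
    then show ?thesis
      using down[OF \<rho>(1), of \<rho>] fin[OF \<rho>(1)] card_Suc_Diff1[of \<tau> v] by auto
  qed
  have ex: "\<exists>b. keys b \<subseteq> {\<rho> \<in> \<Gamma>. card \<rho> = Suc (card \<tau>)} \<and>
      bd b + frag_extend s (bd (frag_of \<tau>)) = frag_of \<tau>" if \<tau>: "\<tau> \<in> \<Gamma>" "card \<tau> = q" for \<tau>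
  proof -
    define c where "c = frag_of \<tau> - frag_extend s (bd (frag_of \<tau>))"
    have bdS: "bd (frag_extend s x) = x - frag_extend s (bd x)"
      if "keys x \<subseteq> {\<rho> \<in> \<Gamma>. card \<rho> < q}" for x
      using that
    proof (induction x rule: frag_induction)
      case (one \<rho>)
      then show ?case using s(2)[of \<rho>] by (simp add: algebra_simps)
    qed (simp_all add: bd_diff frag_extend_diff)
    have "keys (bd (frag_of \<tau>)) \<subseteq> {\<rho> \<in> \<Gamma>. card \<rho> < q}"
      using faces[OF \<tau>(1)] \<tau>(2) by fastforce
    then have "bd c = 0"
      unfolding c_def bd_diff by (simp add: bdS bd_bd keys_frag_of fin[OF \<tau>(1)])
    moreover have "keys c \<subseteq> {\<rho> \<in> \<Gamma>. card \<rho> = card \<tau>}"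
    proof
      fix \<rho> assume "\<rho> \<in> keys c"
      then have "\<rho> = \<tau> \<or> \<rho> \<in> keys (frag_extend s (bd (frag_of \<tau>)))"
        using keys_diff unfolding c_def by (fastforce simp: keys_frag_of)
      then consider "\<rho> = \<tau>" | \<sigma> where "\<sigma> \<in> keys (bd (frag_of \<tau>))" "\<rho> \<in> keys (s \<sigma>)"
        using subsetD[OF keys_frag_extend, of \<rho> s "bd (frag_of \<tau>)"] by auto
      then show "\<rho> \<in> {\<rho> \<in> \<Gamma>. card \<rho> = card \<tau>}"
      proof cases
        case 2
        with faces[OF \<tau>(1) 2(1)] s(1)[of \<sigma>] \<tau>(2) show ?thesis by auto
      qed (use \<tau> in auto)
    qed
    ultimately have "\<exists>b. keys b \<subseteq> {\<rho> \<in> \<Gamma>. card \<rho> = Suc (card \<tau>)} \<and> bd b = c"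
      by (intro acyclic_complexD[OF ac])
    then show ?thesis
      by (auto simp: c_def)
  qed
  then obtain b where b: "\<And>\<tau>. \<tau> \<in> \<Gamma> \<Longrightarrow> card \<tau> = q \<Longrightarrow> keys (b \<tau>) \<subseteq> {\<rho> \<in> \<Gamma>. card \<rho> = Suc (card \<tau>)} \<and>
      bd (b \<tau>) + frag_extend s (bd (frag_of \<tau>)) = frag_of \<tau>"
    by metis
  define s' where "s' \<tau> = (if card \<tau> = q then b \<tau> else s \<tau>)" for \<tau>
  \<comment> \<open>Redefining \<open>s\<close> in cardinality \<open>q\<close> does not change it
    on these boundaries, whose faces are smaller.\<close>
  have ext: "frag_extend s' (bd (frag_of \<tau>)) = frag_extend s (bd (frag_of \<tau>))"
    if "\<tau> \<in> \<Gamma>" "card \<tau> \<le> q" for \<tau>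
    by (rule frag_extend_eq) (use faces[OF that(1)] that(2) in \<open>fastforce simp: s'_def\<close>)
  show ?case
  proof (intro exI[of _ s'] ballI impI)
    fix \<tau> assume \<tau>: "\<tau> \<in> \<Gamma>" "card \<tau> < Suc q"
    then consider "card \<tau> = q" "s' \<tau> = b \<tau>" | "card \<tau> < q" "s' \<tau> = s \<tau>"
      by (cases "card \<tau> = q") (auto simp: s'_def)
    then show "keys (s' \<tau>) \<subseteq> {\<rho> \<in> \<Gamma>. card \<rho> = Suc (card \<tau>)} \<and>
        bd (s' \<tau>) + frag_extend s' (bd (frag_of \<tau>)) = frag_of \<tau>"
      using b[OF \<tau>(1)] s[OF \<tau>(1)] ext[OF \<tau>(1)] by cases simp_all
  qed
qed simp

text \<open>Trace argument: summing the diagonal coefficients of the identity bd s + s bd = id with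
  signs, the two products contribute opposite amounts, because \<open>bd\<close> shifts the parity
  of the cardinality.\<close>

lemma acyclic_complex_euler:
  assumes ac: "acyclic_complex \<Gamma>" and fin: "finite \<Gamma>" "\<And>\<tau>. \<tau> \<in> \<Gamma> \<Longrightarrow> finite \<tau>"
    and down: "\<And>\<tau> \<rho>. \<tau> \<in> \<Gamma> \<Longrightarrow> \<rho> \<subseteq> \<tau> \<Longrightarrow> \<rho> \<in> \<Gamma>"
  shows "(\<Sum>\<tau>\<in>\<Gamma>. (-1) ^ card \<tau>) = (0::int)"
proof -
  have "\<exists>s. \<forall>\<tau>\<in>\<Gamma>. card \<tau> < Suc (Max (card ` \<Gamma>)) \<longrightarrow>
        keys (s \<tau>) \<subseteq> {\<rho> \<in> \<Gamma>. card \<rho> = Suc (card \<tau>)} \<and>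
        bd (s \<tau>) + frag_extend s (bd (frag_of \<tau>)) = frag_of \<tau>"
    by (rule acyclic_complex_contraction[OF ac]) (use fin down in auto)
  then obtain s where s0: "\<forall>\<tau>\<in>\<Gamma>. card \<tau> < Suc (Max (card ` \<Gamma>)) \<longrightarrow>
        keys (s \<tau>) \<subseteq> {\<rho> \<in> \<Gamma>. card \<rho> = Suc (card \<tau>)} \<and>
        bd (s \<tau>) + frag_extend s (bd (frag_of \<tau>)) = frag_of \<tau>"
    by (elim exE)
  have "card \<tau> < Suc (Max (card ` \<Gamma>))" if "\<tau> \<in> \<Gamma>" for \<tau>
    using that fin(1) by (simp add: le_imp_less_Suc)
  with s0 have s: "keys (s \<tau>) \<subseteq> {\<rho> \<in> \<Gamma>. card \<rho> = Suc (card \<tau>)}"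
    "bd (s \<tau>) + frag_extend s (bd (frag_of \<tau>)) = frag_of \<tau>" if "\<tau> \<in> \<Gamma>" for \<tau>
    using that by simp_all
  define S where "S \<tau> \<rho> = lookup (s \<tau>) \<rho>" for \<tau> \<rho>
  define B where "B \<tau> \<rho> = lookup (bd (frag_of \<tau>)) \<rho>" for \<tau> \<rho>
  have B0: "card \<tau> = Suc (card \<rho>)" if \<tau>: "\<tau> \<in> \<Gamma>" "B \<tau> \<rho> \<noteq> 0" for \<tau> \<rho>
  proof -
    obtain v where "v \<in> \<tau>" "\<rho> = \<tau> - {v}"
      using keys_bd[of \<rho> "frag_of \<tau>"] \<tau>(2) by (auto simp: B_def keys_frag_of simp flip: in_keys_iff)
    then show ?thesis
      using fin(2)[OF \<tau>(1)] card_Suc_Diff1[of \<tau> v] by auto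
  qed
  have "(-1) ^ card \<tau> = (\<Sum>\<rho>\<in>\<Gamma>. (-1) ^ card \<tau> * (S \<tau> \<rho> * B \<rho> \<tau>)) + (\<Sum>\<rho>\<in>\<Gamma>. (-1) ^ card \<tau> * (B \<tau> \<rho> * S \<rho> \<tau>))"
    if \<tau>: "\<tau> \<in> \<Gamma>" for \<tau>
  proof -
    have 1: "lookup (bd (s \<tau>)) \<tau> = (\<Sum>\<rho>\<in>\<Gamma>. S \<tau> \<rho> * B \<rho> \<tau>)"
    proof -
      have "keys (s \<tau>) \<subseteq> \<Gamma>" using s(1)[OF \<tau>] by auto
      then show ?thesis
        unfolding S_def B_def bd_of unfolding bd_def by (rule lookup_frag_extend[OF fin(1)])
    qed
    have "keys (bd (frag_of \<tau>)) \<subseteq> \<Gamma>"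
    proof
      fix \<rho> assume "\<rho> \<in> keys (bd (frag_of \<tau>))"
      then obtain v where "\<rho> = \<tau> - {v}"
        using keys_bd[of \<rho> "frag_of \<tau>"] by (auto simp: keys_frag_of)
      then show "\<rho> \<in> \<Gamma>" using down[OF \<tau>] by blast
    qed
    then have 2: "lookup (frag_extend s (bd (frag_of \<tau>))) \<tau> = (\<Sum>\<rho>\<in>\<Gamma>. B \<tau> \<rho> * S \<rho> \<tau>)"
      unfolding S_def B_def by (rule lookup_frag_extend[OF fin(1)])
    have "1 = lookup (bd (s \<tau>)) \<tau> + lookup (frag_extend s (bd (frag_of \<tau>))) \<tau>"
      by (simp flip: lookup_add add: s(2)[OF \<tau>])
    then show ?thesis
      unfolding 1 2 by (simp flip: sum_distrib_left distrib_left)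
  qed
  then have "(\<Sum>\<tau>\<in>\<Gamma>. (-1) ^ card \<tau>) = (\<Sum>\<tau>\<in>\<Gamma>. \<Sum>\<rho>\<in>\<Gamma>. (-1) ^ card \<tau> * (S \<tau> \<rho> * B \<rho> \<tau>)) +
     (\<Sum>\<tau>\<in>\<Gamma>. \<Sum>\<rho>\<in>\<Gamma>. (-1) ^ card \<tau> * (B \<tau> \<rho> * S \<rho> \<tau>))"
    by (subst sum.distrib[symmetric]) (rule sum.cong[OF refl])
  also have "(\<Sum>\<tau>\<in>\<Gamma>. \<Sum>\<rho>\<in>\<Gamma>. (-1) ^ card \<tau> * (B \<tau> \<rho> * S \<rho> \<tau>)) =
     (\<Sum>\<rho>\<in>\<Gamma>. \<Sum>\<tau>\<in>\<Gamma>. (-1) ^ card \<tau> * (B \<tau> \<rho> * S \<rho> \<tau>))"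
    by (rule sum.swap)
  also have "\<dots> = (\<Sum>\<tau>\<in>\<Gamma>. \<Sum>\<rho>\<in>\<Gamma>. - ((-1) ^ card \<tau> * (S \<tau> \<rho> * B \<rho> \<tau>)))"
  proof (intro sum.cong refl)
    fix \<tau> \<rho> assume "\<tau> \<in> \<Gamma>" "\<rho> \<in> \<Gamma>"
    then show "(-1) ^ card \<rho> * (B \<rho> \<tau> * S \<tau> \<rho>) = - ((-1) ^ card \<tau> * (S \<tau> \<rho> * B \<rho> \<tau>))"
      using B0[of \<rho> \<tau>] by (cases "B \<rho> \<tau> = 0") auto
  qed
  finally show ?thesis
    by (simp add: sum_negf)
qed

section \<open>Contractible realizations have acyclic chain complexes\<close>

lemma frag_extend_const:
  fixes c :: "'b \<Rightarrow>\<^sub>0 int"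
  shows "frag_extend (\<lambda>_. x) c = frag_cmul (\<Sum>k\<in>keys c. lookup c k) x"
proof -
  have "(\<Sum>k\<in>A. frag_cmul (f k) x) = frag_cmul (\<Sum>k\<in>A. f k) x" for A :: "'b set" and f
    by (induction A rule: infinite_finite_induct) (simp_all add: frag_cmul_distrib)
  then show ?thesis by (simp add: frag_extend_def)
qed

lemma contractible_const_boundary:
  assumes "homotopic_with (\<lambda>x. True) X X id (\<lambda>x. a)" "singular_chain p X c" "chain_boundary p c = 0"
  shows "singular_relboundary p X {} (c - chain_map p (\<lambda>x. a) c)"
proof -
  have "homologous_rel p X {} (chain_map p id c) (chain_map p (\<lambda>x. a) c)"
    by (rule homotopic_imp_homologous_rel_chain_maps[where S = X and T = "{}"]) (use assms in \<open>simp_all add: singular_cycle\<close>)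
  then show ?thesis
    using chain_map_ident[OF assms(2)] by (simp add: homologous_rel_def)
qed

text \<open>In degree 0 the constant map does not kill chains: it sends \<open>c\<close> to its
  coefficient sum times one point, which is why the sum must vanish.\<close>

lemma contractible_0_cycle_bounds:
  assumes "contractible_space X" "singular_chain 0 X c" "(\<Sum>k\<in>keys c. lookup c k) = 0"
  shows "\<exists>w. singular_chain 1 X w \<and> chain_boundary 1 w = c"
proof -
  obtain a where a: "homotopic_with (\<lambda>x. True) X X id (\<lambda>x. a)"
    using assms(1) by (auto simp: contractible_space_def)
  have "chain_map 0 (\<lambda>x. a) c = frag_extend (\<lambda>_. frag_of (restrict (\<lambda>x. a) (standard_simplex 0))) c"
    unfolding chain_map_def by (rule frag_extend_eq) (simp add: simplex_map_def o_def)
  then have "chain_map 0 (\<lambda>x. a) c = 0"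
    using assms(3) by (simp add: frag_extend_const)
  then show ?thesis
    using contractible_const_boundary[OF a assms(2)] by (simp add: singular_boundary chain_boundary_def)
qed

text \<open>A constant map factors through a one-point space, where cycles of positive degree
  bound.\<close>

lemma contractible_cycle_bounds:
  assumes "contractible_space X" "singular_chain (Suc p) X c" "chain_boundary (Suc p) c = 0"
  shows "\<exists>w. singular_chain (Suc (Suc p)) X w \<and> chain_boundary (Suc (Suc p)) w = c"
proof (cases "topspace X = {}")
  case True
  then have "c = 0"
    using assms(2) by (simp add: singular_chain_empty)
  then show ?thesis by (intro exI[of _ 0]) simp
next
  case False
  obtain a where a: "homotopic_with (\<lambda>x. True) X X id (\<lambda>x. a)"
    using assms(1) by (auto simp: contractible_space_def)
  have "continuous_map X X (\<lambda>x. a)"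
    using homotopic_with_imp_continuous_maps[OF a] by blast
  then have aX: "a \<in> topspace X" and "continuous_map X (subtopology X {a}) (\<lambda>x. a)"
    using False by (auto simp: continuous_map_in_subtopology continuous_map_def)
  then have c0: "singular_chain (Suc p) (subtopology X {a}) (chain_map (Suc p) (\<lambda>x. a) c)"
    using singular_chain_chain_map[OF assms(2)] by blast
  moreover have "chain_boundary (Suc p) (chain_map (Suc p) (\<lambda>x. a) c) = 0"
    using chain_boundary_chain_map[OF assms(2)] assms(3) by simp
  ultimately have "singular_relcycle (Suc p) (subtopology X {a}) {} (chain_map (Suc p) (\<lambda>x. a) c)"
    by (simp add: singular_cycle)
  then have "singular_relboundary (Suc p) (subtopology X {a}) {} (chain_map (Suc p) (\<lambda>x. a) c)"
    using singular_boundary_eq_cycle_singleton[of "subtopology X {a}" a "Suc p"] aX by simp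
  then have "singular_relboundary (Suc p) X {} (chain_map (Suc p) (\<lambda>x. a) c)"
    using singular_boundary_mono[of "{a}" "topspace X" "Suc p" X] aX by (simp add: subtopology_topspace)
  from singular_relboundary_add[OF this contractible_const_boundary[OF a assms(2,3)]]
  show ?thesis by (simp add: singular_boundary)
qed

section \<open>Comparison of simplicial and singular chains\<close>

abbreviation basis_vec :: "nat \<Rightarrow> nat \<Rightarrow> real" where
  "basis_vec i \<equiv> (\<lambda>j. if j = i then 1 else 0)"

lemma topspace_realization:
  "topspace (realization n \<Gamma>) = {x. (\<forall>i. 0 \<le> x i) \<and> {i. x i \<noteq> 0} \<in> \<Gamma> \<and> (\<Sum>i\<in>{1..n}. x i) = 1}"
  by (simp add: realization_def)

text \<open>Averaging provides such a vertex. The threshold does not depend on \<open>x\<close>: a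
  vertex dominant at one point keeps a positive coordinate at every point whose coordinates differ
  by less than \<open>1 / real n\<close>.\<close>

definition dominant :: "nat \<Rightarrow> (nat \<Rightarrow> real) \<Rightarrow> nat" where
  "dominant n x = (SOME v. v \<in> {1..n} \<and> 1 / real n \<le> x v)"

lemma dominant:
  assumes "(\<Sum>i\<in>{1..n}. x i) = 1"
  shows "dominant n x \<in> {1..n}" "1 / real n \<le> x (dominant n x)" "0 < x (dominant n x)"
proof -
  have n: "n > 0" using assms by (cases n) auto
  have "\<exists>v. v \<in> {1..n} \<and> 1 / real n \<le> x v"
  proof (rule ccontr)
    assume "\<nexists>v. v \<in> {1..n} \<and> 1 / real n \<le> x v"
    then have "x v < 1 / real n" if "v \<in> {1..n}" for v
      using that by force
    then have "(\<Sum>i\<in>{1..n}. x i) < (\<Sum>i\<in>{1..n}. 1 / real n)"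
      using n by (intro sum_strict_mono) (simp_all add: not_le)
    then show False using assms n by simp
  qed
  from someI_ex[OF this] show 1: "dominant n x \<in> {1..n}" "1 / real n \<le> x (dominant n x)"
    by (simp_all add: dominant_def)
  have "0 < 1 / real n" using n by simp
  with 1(2) show "0 < x (dominant n x)" by linarith
qed

definition vertex_list :: "nat \<Rightarrow> nat \<Rightarrow> ((nat \<Rightarrow> real) \<Rightarrow> (nat \<Rightarrow> real)) \<Rightarrow> nat list" where
  "vertex_list n p s = map (\<lambda>i. dominant n (s (basis_vec i))) [0..<Suc p]"

definition vertex_chain :: "nat \<Rightarrow> nat \<Rightarrow> (nat \<Rightarrow> real) chain \<Rightarrow> (nat set \<Rightarrow>\<^sub>0 int)" where
  "vertex_chain n p = frag_extend (\<lambda>s. wedge (vertex_list n p s))"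

lemma vertex_chain_0 [simp]: "vertex_chain n p 0 = 0"
  and vertex_chain_of [simp]: "vertex_chain n p (frag_of s) = wedge (vertex_list n p s)"
  and vertex_chain_diff: "vertex_chain n p (a - b) = vertex_chain n p a - vertex_chain n p b"
  and vertex_chain_add: "vertex_chain n p (a + b) = vertex_chain n p a + vertex_chain n p b"
  and vertex_chain_cmul: "vertex_chain n p (frag_cmul k a) = frag_cmul k (vertex_chain n p a)"
  by (simp_all add: vertex_chain_def frag_extend_diff frag_extend_cmul frag_extend_add)

lemma vertex_chain_sum: "vertex_chain n p (sum f I) = (\<Sum>i\<in>I. vertex_chain n p (f i))"
  by (induction I rule: infinite_finite_induct) (simp_all add: vertex_chain_add)

lemma vertex_list_face:
  assumes "k \<le> Suc p"
  shows "vertex_list n p (singular_face (Suc p) k s) =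
    take k (vertex_list n (Suc p) s) @ drop (Suc k) (vertex_list n (Suc p) s)"
proof (rule nth_equalityI)
  show "length (vertex_list n p (singular_face (Suc p) k s)) =
    length (take k (vertex_list n (Suc p) s) @ drop (Suc k) (vertex_list n (Suc p) s))"
    using assms by (simp add: vertex_list_def)
next
  fix i assume "i < length (vertex_list n p (singular_face (Suc p) k s))"
  then have i: "i \<le> p" by (simp add: vertex_list_def)
  have nth: "vertex_list n q t ! j = dominant n (t (basis_vec j))" if "j \<le> q" for q j t
    using that unfolding vertex_list_def by (subst nth_map) (auto simp del: upt_Suc)
  have len: "length (vertex_list n (Suc p) s) = Suc (Suc p)"
    by (simp add: vertex_list_def)
  have "simplical_face k (basis_vec i) = basis_vec (if i < k then i else Suc i)"
    by (rule ext) (auto simp: simplical_face_def)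
  then have "singular_face (Suc p) k s (basis_vec i) = s (basis_vec (if i < k then i else Suc i))"
    using i by (simp add: singular_face_def)
  moreover have "(take k (vertex_list n (Suc p) s) @ drop (Suc k) (vertex_list n (Suc p) s)) ! i =
      vertex_list n (Suc p) s ! (if i < k then i else Suc i)"
    using assms i len by (auto simp: nth_append min_def)
  ultimately show "vertex_list n p (singular_face (Suc p) k s) ! i =
    (take k (vertex_list n (Suc p) s) @ drop (Suc k) (vertex_list n (Suc p) s)) ! i"
    using i by (simp add: nth)
qed

text \<open>Both sides depend only on the values at the corners, so this is \<open>bd_wedge\<close>
  for the list of dominant vertices.\<close>

lemma bd_vertex_chain: "bd (vertex_chain n (Suc p) w) = vertex_chain n p (chain_boundary (Suc p) w)"
proof (rule frag_induction[of w UNIV])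
  fix s
  have "length (vertex_list n (Suc p) s) = Suc (Suc p)"
    by (simp add: vertex_list_def)
  then show "bd (vertex_chain n (Suc p) (frag_of s)) = vertex_chain n p (chain_boundary (Suc p) (frag_of s))"
    unfolding vertex_chain_of bd_wedge chain_boundary_of
    by (auto simp: vertex_chain_sum vertex_chain_cmul vertex_list_face lessThan_Suc_atMost
        simp del: sum.lessThan_Suc sum.atMost_Suc intro!: sum.cong)
qed (simp_all add: vertex_chain_diff bd_diff chain_boundary_diff)

text \<open>Corners in increasing order, in agreement with reading a set as a sorted wedge.\<close>

definition affine_simplex :: "nat \<Rightarrow> nat set \<Rightarrow> (nat \<Rightarrow> real) \<Rightarrow> (nat \<Rightarrow> real)" where
  "affine_simplex p \<tau> = oriented_simplex p (\<lambda>j. basis_vec (sorted_list_of_set \<tau> ! j))"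

definition affine_chain :: "nat \<Rightarrow> (nat set \<Rightarrow>\<^sub>0 int) \<Rightarrow> (nat \<Rightarrow> real) chain" where
  "affine_chain p = frag_extend (\<lambda>\<tau>. frag_of (affine_simplex p \<tau>))"

lemma affine_chain_0 [simp]: "affine_chain p 0 = 0"
  and affine_chain_of [simp]: "affine_chain p (frag_of \<tau>) = frag_of (affine_simplex p \<tau>)"
  and affine_chain_diff: "affine_chain p (a - b) = affine_chain p a - affine_chain p b"
  and affine_chain_add: "affine_chain p (a + b) = affine_chain p a + affine_chain p b"
  and affine_chain_cmul: "affine_chain p (frag_cmul k a) = frag_cmul k (affine_chain p a)"
  by (simp_all add: affine_chain_def frag_extend_diff frag_extend_cmul frag_extend_add)

lemma affine_chain_sum: "affine_chain p (sum f I) = (\<Sum>i\<in>I. affine_chain p (f i))"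
  by (induction I rule: infinite_finite_induct) (simp_all add: affine_chain_add)

text \<open>Stated from dimension 1 on: on points the singular boundary is zero while
  \<open>bd\<close> is the augmentation.\<close>

lemma chain_boundary_affine_chain:
  assumes "keys c \<subseteq> {\<tau>. finite \<tau> \<and> card \<tau> = Suc (Suc p)}"
  shows "chain_boundary (Suc p) (affine_chain (Suc p) c) = affine_chain p (bd c)"
  using assms
proof (induction c rule: frag_induction)
  case (one \<tau>)
  define l where "l = sorted_list_of_set \<tau>"
  have l: "set l = \<tau>" "length l = Suc (Suc p)" "sorted l" "distinct l"
    using one by (simp_all add: l_def)
  define r where "r k = take k l @ drop (Suc k) l" for k
  have r: "wedge (r k) = frag_of (set (r k))" "sorted_list_of_set (set (r k)) = r k" "length (r k) = Suc p"
    if "k \<le> Suc p" for k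
  proof -
    have l': "sorted (take k l @ drop k l)" "distinct (take k l @ drop k l)"
      using l by simp_all
    have "drop (Suc k) l = tl (drop k l)" by (simp add: drop_Suc drop_tl)
    with l' have "sorted (r k)" "distinct (r k)"
      unfolding r_def by (cases "drop k l"; simp add: sorted_append)+
    then show "wedge (r k) = frag_of (set (r k))" "sorted_list_of_set (set (r k)) = r k"
      by (simp_all add: wedge_sorted sorted_list_of_set.idem_if_sorted_distinct)
    show "length (r k) = Suc p"
      using that l by (simp add: r_def)
  qed
  have "affine_chain p (bd (frag_of \<tau>)) = affine_chain p (bd (wedge l))"
    using l by (simp add: wedge_sorted)
  also have "\<dots> = (\<Sum>k\<le>Suc p. frag_cmul ((-1) ^ k) (affine_chain p (wedge (r k))))"
    by (simp add: bd_wedge l affine_chain_sum affine_chain_cmul r_def lessThan_Suc_atMost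
        del: sum.lessThan_Suc sum.atMost_Suc)
  also have "\<dots> = (\<Sum>k\<le>Suc p. frag_cmul ((-1) ^ k) (frag_of (singular_face (Suc p) k (affine_simplex (Suc p) \<tau>))))"
  proof (rule sum.cong[OF refl])
    fix k assume "k \<in> {..Suc p}"
    then have k: "k \<le> Suc p" by simp
    have "singular_face (Suc p) k (affine_simplex (Suc p) \<tau>) =
       oriented_simplex p (\<lambda>j. if j < k then basis_vec (l ! j) else basis_vec (l ! Suc j))"
      unfolding affine_simplex_def l_def using singular_face_oriented_simplex[of "Suc p" k] k by simp
    also have "\<dots> = oriented_simplex p (\<lambda>j. basis_vec (r k ! j))"
      unfolding oriented_simplex_eq using k l by (auto simp: r_def nth_append min_def)
    also have "\<dots> = affine_simplex p (set (r k))"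
      using r[OF k] by (simp add: affine_simplex_def)
    finally show "frag_cmul ((-1) ^ k) (affine_chain p (wedge (r k))) =
      frag_cmul ((-1) ^ k) (frag_of (singular_face (Suc p) k (affine_simplex (Suc p) \<tau>)))"
      using r[OF k] by simp
  qed
  finally show ?case
    by (simp add: chain_boundary_of del: sum.atMost_Suc)
qed (simp_all add: affine_chain_diff bd_diff chain_boundary_diff)

lemma singular_chain_affine_chain:
  assumes c: "keys c \<subseteq> {\<tau> \<in> \<Gamma>. card \<tau> = Suc p}" and \<Gamma>: "\<Gamma> \<subseteq> Pow {1..n}"
    and down: "\<And>\<tau> \<rho>. \<tau> \<in> \<Gamma> \<Longrightarrow> \<rho> \<subseteq> \<tau> \<Longrightarrow> \<rho> \<in> \<Gamma>"
  shows "singular_chain p (realization n \<Gamma>) (affine_chain p c)"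
  unfolding affine_chain_def
proof (rule singular_chain_extend)
  fix \<tau> assume "\<tau> \<in> keys c"
  with c \<Gamma> have \<tau>: "\<tau> \<in> \<Gamma>" "card \<tau> = Suc p" "\<tau> \<subseteq> {1..n}" by auto
  define l where "l = sorted_list_of_set \<tau>"
  have l: "set l = \<tau>" "length l = Suc p" "distinct l"
    using \<tau> finite_subset[OF \<tau>(3)] by (simp_all add: l_def)
  let ?S = "{x. (\<forall>i. 0 \<le> x i) \<and> {i. x i \<noteq> 0} \<in> \<Gamma> \<and> (\<Sum>i\<in>{1..n}. x i) = (1::real)}"
  have "(\<lambda>x i. \<Sum>j\<le>p. basis_vec (l ! j) i * x j) ` standard_simplex p \<subseteq> ?S"
  proof
    fix y assume "y \<in> (\<lambda>x i. \<Sum>j\<le>p. basis_vec (l ! j) i * x j) ` standard_simplex p"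
    then obtain x where x: "x \<in> standard_simplex p" and y: "y = (\<lambda>i. \<Sum>j\<le>p. basis_vec (l ! j) i * x j)"
      by blast
    have nn: "\<forall>i. 0 \<le> y i"
      using x by (auto simp: y standard_simplex_def intro!: sum_nonneg)
    have "{i. y i \<noteq> 0} \<subseteq> \<tau>"
    proof
      fix i assume "i \<in> {i. y i \<noteq> 0}"
      then have "\<not> (\<forall>j\<in>{..p}. basis_vec (l ! j) i * x j = 0)"
        unfolding y using sum.neutral[of "{..p}" "\<lambda>j. basis_vec (l ! j) i * x j"] by blast
      then obtain j where "j \<le> p" "i = l ! j"
        by (auto split: if_splits)
      then show "i \<in> \<tau>" using l by (auto split: if_splits)
    qed
    with down[OF \<tau>(1)] have sup: "{i. y i \<noteq> 0} \<in> \<Gamma>" by blast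
    have "(\<Sum>i\<in>{1..n}. y i) = (\<Sum>j\<le>p. \<Sum>i\<in>{1..n}. basis_vec (l ! j) i * x j)"
      unfolding y by (rule sum.swap)
    also have "\<dots> = (\<Sum>j\<le>p. x j)"
    proof (rule sum.cong[OF refl])
      fix j assume "j \<in> {..p}"
      then have "l ! j \<in> {1..n}" using l \<tau>(3) nth_mem[of j l] by auto
      then show "(\<Sum>i\<in>{1..n}. basis_vec (l ! j) i * x j) = x j"
        by (simp flip: sum_distrib_right)
    qed
    also have "\<dots> = 1" using x by (simp add: standard_simplex_def)
    finally show "y \<in> ?S" using nn sup by simp
  qed
  then have "simplicial_simplex p ?S (affine_simplex p \<tau>)"
    unfolding affine_simplex_def l_def simplicial_simplex_oriented_simplex by simp
  then show "singular_chain p (realization n \<Gamma>) (frag_of (affine_simplex p \<tau>))"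
    by (simp add: simplicial_simplex_def realization_def singular_chain_of)
qed

lemma singular_chain_iterated_subdivision:
  "singular_chain p X c \<Longrightarrow> singular_chain p X ((singular_subdivision p ^^ N) c)"
  by (induction N) (simp_all add: singular_chain_singular_subdivision)

lemma chain_boundary_iterated_subdivision:
  "singular_chain p X c \<Longrightarrow> chain_boundary p ((singular_subdivision p ^^ N) c) =
     (singular_subdivision (p - 1) ^^ N) (chain_boundary p c)"
proof (induction N)
  case (Suc N)
  then show ?case
    using chain_boundary_singular_subdivision[OF singular_chain_iterated_subdivision[OF Suc.prems]] by simp
qed simp

lemma iterated_subdivision_zero:
  "singular_chain 0 X c \<Longrightarrow> (singular_subdivision 0 ^^ N) c = c"
  by (induction N) (simp_all add: singular_subdivision_zero)

lemma keys_vertex_chain: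
  assumes "\<rho> \<in> keys (vertex_chain n p d)"
  obtains s where "s \<in> keys d" "\<rho> = (\<lambda>i. dominant n (s (basis_vec i))) ` {..p}" "card \<rho> = Suc p"
proof -
  obtain s where s: "s \<in> keys d" "\<rho> \<in> keys (wedge (vertex_list n p s))"
    using subsetD[OF keys_frag_extend assms[unfolded vertex_chain_def]] by blast
  then have \<rho>: "\<rho> = set (vertex_list n p s)" "distinct (vertex_list n p s)"
    using keys_wedge by blast+
  then have "card \<rho> = Suc p"
    by (simp add: distinct_card) (simp add: vertex_list_def)
  moreover have "\<rho> = (\<lambda>i. dominant n (s (basis_vec i))) ` {..p}"
    unfolding \<rho>(1) vertex_list_def by (simp add: atLeast0_lessThan_Suc_eq_insert_0 lessThan_Suc_atMost atLeast0LessThan del: upt_Suc)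
  ultimately show ?thesis using s that by blast
qed

lemma singular_simplex_vertex:
  assumes "singular_chain p X d" "s \<in> keys d" "i \<le> p"
  shows "s (basis_vec i) \<in> topspace X"
proof -
  have "continuous_map (subtopology (powertop_real UNIV) (standard_simplex p)) X s"
    using assms by (auto simp: singular_chain_def singular_simplex_def)
  then show ?thesis
    using assms(3) by (auto simp: continuous_map_def Pi_iff)
qed

text \<open>The composite of realisation, iterated subdivision and vertex map is carried by faces;
  a chain map carrying each face to itself is the identity on oriented chains.\<close>

lemma vertex_chain_subdivided_simplex:
  assumes "\<tau> \<subseteq> {1..n}" "card \<tau> = Suc p"
  shows "vertex_chain n p ((singular_subdivision p ^^ N) (affine_chain p (frag_of \<tau>))) = frag_of \<tau>"
  using assms
proof (induction p arbitrary: \<tau>)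
  case 0
  then obtain v where v: "\<tau> = {v}" "v \<in> {1..n}"
    by (auto simp: card_1_singleton_iff)
  have "singular_chain 0 (realization n (Pow \<tau>)) (affine_chain 0 (frag_of \<tau>))"
    by (rule singular_chain_affine_chain) (use 0 in \<open>auto simp: keys_frag_of\<close>)
  then have 1: "(singular_subdivision 0 ^^ N) (affine_chain 0 (frag_of \<tau>)) = frag_of (affine_simplex 0 \<tau>)"
    by (simp add: iterated_subdivision_zero)
  have "affine_simplex 0 \<tau> (basis_vec 0) = basis_vec v"
    by (simp add: affine_simplex_def oriented_simplex_def v)
  moreover have "dominant n (basis_vec v) = v"
    using dominant(3)[of "basis_vec v" n] v(2) by (auto split: if_splits)
  ultimately show ?case
    unfolding 1 by (simp add: vertex_list_def wedge_Cons cone_of v vertex_sign_def)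
next
  case (Suc p)
  let ?T = "\<lambda>p c. vertex_chain n p ((singular_subdivision p ^^ N) (affine_chain p c))"
  have fin: "finite \<tau>" using Suc.prems finite_subset by blast
  have sc: "singular_chain (Suc p) (realization n (Pow \<tau>)) (affine_chain (Suc p) (frag_of \<tau>))"
    by (rule singular_chain_affine_chain) (use Suc.prems in \<open>auto simp: keys_frag_of\<close>)
  then have sc': "singular_chain (Suc p) (realization n (Pow \<tau>)) ((singular_subdivision (Suc p) ^^ N) (affine_chain (Suc p) (frag_of \<tau>)))"
    by (rule singular_chain_iterated_subdivision)
  \<comment> \<open>All points of the subdivision lie in the closed simplex on
    \<open>\<tau>\<close>, so the dominant vertices belong to \<open>\<tau>\<close> and the image
    can only be a multiple of it.\<close>
  have "keys (?T (Suc p) (frag_of \<tau>)) \<subseteq> {\<tau>}"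
  proof
    fix \<rho> assume "\<rho> \<in> keys (?T (Suc p) (frag_of \<tau>))"
    then obtain s where s: "s \<in> keys ((singular_subdivision (Suc p) ^^ N) (affine_chain (Suc p) (frag_of \<tau>)))"
       and \<rho>: "\<rho> = (\<lambda>i. dominant n (s (basis_vec i))) ` {..Suc p}" "card \<rho> = Suc (Suc p)"
      by (rule keys_vertex_chain)
    have "dominant n (s (basis_vec i)) \<in> \<tau>" if "i \<le> Suc p" for i
    proof -
      have "s (basis_vec i) \<in> topspace (realization n (Pow \<tau>))"
        by (rule singular_simplex_vertex[OF sc' s that])
      then have "{j. s (basis_vec i) j \<noteq> 0} \<subseteq> \<tau>" "(\<Sum>j\<in>{1..n}. s (basis_vec i) j) = 1"
        by (simp_all add: topspace_realization)
      with dominant(3)[OF this(2)] show ?thesis by auto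
    qed
    then have "\<rho> \<subseteq> \<tau>" using \<rho>(1) by auto
    then show "\<rho> \<in> {\<tau>}"
      using \<rho>(2) Suc.prems(2) fin by (simp add: card_subset_eq)
  qed
  then obtain k where k: "?T (Suc p) (frag_of \<tau>) = frag_cmul k (frag_of \<tau>)"
  proof -
    assume keys: "keys (?T (Suc p) (frag_of \<tau>)) \<subseteq> {\<tau>}"
      and that: "\<And>k. ?T (Suc p) (frag_of \<tau>) = frag_cmul k (frag_of \<tau>) \<Longrightarrow> thesis"
    have "?T (Suc p) (frag_of \<tau>) = frag_cmul (lookup (?T (Suc p) (frag_of \<tau>)) \<tau>) (frag_of \<tau>)"
      by (rule poly_mapping_eqI) (use keys in \<open>auto simp: lookup_single when_def in_keys_iff\<close>)
    then show thesis by (rule that)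
  qed
  have T: "?T p c = c" if "keys c \<subseteq> {\<rho>. \<rho> \<subseteq> {1..n} \<and> card \<rho> = Suc p}" for c
    using that
  proof (induction c rule: frag_induction)
    case (one \<rho>)
    then show ?case using Suc.IH[of \<rho>] by blast
  qed (simp_all add: affine_chain_diff singular_subdivision_power_diff vertex_chain_diff)
  have kb: "keys (bd (frag_of \<tau>)) \<subseteq> {\<rho>. \<rho> \<subseteq> {1..n} \<and> card \<rho> = Suc p}"
  proof
    fix \<rho> assume "\<rho> \<in> keys (bd (frag_of \<tau>))"
    then obtain v where "v \<in> \<tau>" "\<rho> = \<tau> - {v}"
      using keys_bd by (fastforce simp: keys_frag_of)
    then show "\<rho> \<in> {\<rho>. \<rho> \<subseteq> {1..n} \<and> card \<rho> = Suc p}"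
      using Suc.prems fin by auto
  qed
  \<comment> \<open>The induction hypothesis on the boundary determines the multiple: the boundary
    of \<open>\<tau>\<close> has a nonzero coefficient, which forces \<open>k = 1\<close>.\<close>
  have "frag_cmul k (bd (frag_of \<tau>)) = bd (?T (Suc p) (frag_of \<tau>))"
    unfolding k bd_cmul ..
  also have "\<dots> = vertex_chain n p ((singular_subdivision p ^^ N) (chain_boundary (Suc p) (affine_chain (Suc p) (frag_of \<tau>))))"
    using chain_boundary_iterated_subdivision[OF sc] by (simp add: bd_vertex_chain)
  also have "chain_boundary (Suc p) (affine_chain (Suc p) (frag_of \<tau>)) = affine_chain p (bd (frag_of \<tau>))"
    by (rule chain_boundary_affine_chain) (use Suc.prems fin in \<open>auto simp: keys_frag_of\<close>)
  also have "vertex_chain n p ((singular_subdivision p ^^ N) (affine_chain p (bd (frag_of \<tau>)))) = bd (frag_of \<tau>)"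
    by (rule T[OF kb])
  finally have eq: "frag_cmul k (bd (frag_of \<tau>)) = bd (frag_of \<tau>)" .
  obtain v where v: "v \<in> \<tau>" using Suc.prems(2) by fastforce
  have "lookup (bd (frag_of \<tau>)) (\<tau> - {v}) = vertex_sign v \<tau>"
  proof -
    have "(\<Sum>u\<in>\<tau>. if \<tau> - {u} = \<tau> - {v} then vertex_sign u (\<tau> - {v}) else 0) =
      (\<Sum>u\<in>\<tau>. if u = v then vertex_sign v \<tau> else 0)"
      by (rule sum.cong[OF refl]) (use v in auto)
    then show ?thesis using fin v by (simp add: lookup_bd_of)
  qed
  then have "k * vertex_sign v \<tau> = vertex_sign v \<tau>"
    using arg_cong[OF eq, of "\<lambda>c. lookup c (\<tau> - {v})"] by simp
  then show ?case using k by simp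
qed

lemma vertex_chain_subdivided_chain:
  assumes "keys c \<subseteq> {\<rho>. \<rho> \<subseteq> {1..n} \<and> card \<rho> = Suc p}"
  shows "vertex_chain n p ((singular_subdivision p ^^ N) (affine_chain p c)) = c"
  using assms
proof (induction c rule: frag_induction)
  case (one \<rho>)
  then show ?case using vertex_chain_subdivided_simplex[of \<rho> n p] by blast
qed (simp_all add: affine_chain_diff singular_subdivision_power_diff vertex_chain_diff)

text \<open>Quantitative form of the open star covering: coordinates on a small simplex vary by less
  than \<open>1 / real n\<close>, so every dominant vertex of a corner lies in the support of the
  first corner, which is a face.\<close>

lemma small_simplices_span_faces:
  assumes \<Gamma>: "\<Gamma> \<subseteq> Pow {1..n}" and down: "\<And>\<tau> \<rho>. \<tau> \<in> \<Gamma> \<Longrightarrow> \<rho> \<subseteq> \<tau> \<Longrightarrow> \<rho> \<in> \<Gamma>"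
    and w: "singular_chain p (realization n \<Gamma>) w"
  obtains N where "keys (vertex_chain n p ((singular_subdivision p ^^ N) w)) \<subseteq> {\<tau> \<in> \<Gamma>. card \<tau> = Suc p}"
proof -
  let ?X = "realization n \<Gamma>"
  \<comment> \<open>Coordinates of two points of one \<open>U y\<close> differ by less than
    \<open>2 * e\<close>, which is below \<open>1 / real n\<close>; the shift in the denominator
    keeps \<open>e\<close> positive for \<open>n = 0\<close>.\<close>
  define e where "e = 1 / real (2 * n + 2)"
  define U where "U y = {x \<in> topspace ?X. \<forall>v\<in>{1..n}. x v \<in> {y v - e<..<y v + e}}" for y :: "nat \<Rightarrow> real"
  have e: "0 < e" by (simp add: e_def)
  have cont: "continuous_map ?X euclideanreal (\<lambda>x. x v)" for v
    unfolding realization_def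
    by (intro continuous_map_from_subtopology continuous_map_product_projection) simp
  have op: "openin ?X (U y)" for y
  proof -
    have "U y = topspace ?X \<inter> (\<Inter>v\<in>{1..n}. {x \<in> topspace ?X. x v \<in> {y v - e<..<y v + e}})"
      by (auto simp: U_def)
    also have "openin ?X \<dots>"
    proof (rule openin_Int_Inter)
      fix S assume "S \<in> (\<lambda>v. {x \<in> topspace ?X. x v \<in> {y v - e<..<y v + e}}) ` {1..n}"
      then obtain v where "S = {x \<in> topspace ?X. x v \<in> {y v - e<..<y v + e}}" by blast
      then show "openin ?X S"
        by (simp only: openin_continuous_map_preimage[OF cont] open_openin[symmetric] open_greaterThanLessThan)
    qed auto
    finally show ?thesis .
  qed
  have "x \<in> U x" if "x \<in> topspace ?X" for x
    using e that by (simp add: U_def)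
  then have cov: "topspace ?X \<subseteq> \<Union>(range U)"
    by blast
  have op': "openin ?X V" if "V \<in> range U" for V
    using that op by blast
  obtain N where N: "\<And>m f. N \<le> m \<Longrightarrow> f \<in> keys ((singular_subdivision p ^^ m) w) \<Longrightarrow>
      \<exists>V\<in>range U. f \<in> standard_simplex p \<rightarrow> V"
    by (rule sufficient_iterated_singular_subdivision_exists[OF op' cov w]) (assumption | rule that)+
  show ?thesis
  proof (rule that[of N], rule subsetI)
    fix \<rho> assume "\<rho> \<in> keys (vertex_chain n p ((singular_subdivision p ^^ N) w))"
    then obtain s where s: "s \<in> keys ((singular_subdivision p ^^ N) w)"
       and \<rho>: "\<rho> = (\<lambda>i. dominant n (s (basis_vec i))) ` {..p}" "card \<rho> = Suc p"
      by (rule keys_vertex_chain)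
    obtain y where y: "s \<in> standard_simplex p \<rightarrow> U y"
      using N[OF order_refl s] by blast
    have sU: "s (basis_vec i) \<in> U y" if "i \<le> p" for i
      using y that by auto
    have "s (basis_vec 0) (dominant n (s (basis_vec i))) \<noteq> 0" if i: "i \<le> p" for i
    proof -
      let ?v = "dominant n (s (basis_vec i))"
      have "(\<Sum>j\<in>{1..n}. s (basis_vec i) j) = 1"
        using sU[OF i] by (simp add: U_def topspace_realization)
      note v = dominant[OF this]
      have n: "n > 0" using v(1) by auto
      have "s (basis_vec i) ?v < y ?v + e" "y ?v - e < s (basis_vec 0) ?v"
        using sU[OF i] sU[of 0] v(1) by (auto simp: U_def)
      then have "s (basis_vec 0) ?v > 1 / real n - 2 * e"
        using v(2) by linarith
      moreover have "1 / real n - 2 * e > 0"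
        using n by (simp add: e_def field_simps add_pos_nonneg)
      ultimately show ?thesis by linarith
    qed
    then have "\<rho> \<subseteq> {j. s (basis_vec 0) j \<noteq> 0}"
      using \<rho>(1) by auto
    moreover have "{j. s (basis_vec 0) j \<noteq> 0} \<in> \<Gamma>"
      using sU[of 0] by (simp add: U_def topspace_realization)
    ultimately show "\<rho> \<in> {\<tau> \<in> \<Gamma>. card \<tau> = Suc p}"
      using down \<rho>(2) by blast
  qed
qed

text \<open>The vertex \<open>v\<close> excludes the complex with only the empty face: its
  realization is empty, hence contractible, but the empty face does not bound.\<close>

theorem contractible_imp_acyclic_complex:
  assumes \<Gamma>: "\<Gamma> \<subseteq> Pow {1..n}" and down: "\<And>\<tau> \<rho>. \<tau> \<in> \<Gamma> \<Longrightarrow> \<rho> \<subseteq> \<tau> \<Longrightarrow> \<rho> \<in> \<Gamma>"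
    and v: "{v} \<in> \<Gamma>" and contr: "contractible_space (realization n \<Gamma>)"
  shows "acyclic_complex \<Gamma>"
  unfolding acyclic_complex_def
proof (intro allI impI, elim conjE)
  fix q c assume c: "keys c \<subseteq> {\<tau> \<in> \<Gamma>. card \<tau> = q}" and bd: "bd c = 0"
  let ?X = "realization n \<Gamma>"
  show "\<exists>b. keys b \<subseteq> {\<tau> \<in> \<Gamma>. card \<tau> = Suc q} \<and> bd b = c"
  proof (cases q)
    case 0
    have fin: "finite \<tau>" if "\<tau> \<in> \<Gamma>" for \<tau>
      using that \<Gamma> finite_subset by blast
    have "keys c \<subseteq> {{}}"
      using c 0 fin by auto
    then have "c = frag_cmul (lookup c {}) (frag_of {})"
      by (intro poly_mapping_eqI) (auto simp: lookup_single when_def in_keys_iff)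
    moreover have "bd (frag_of {v}) = frag_of {}"
      by (simp add: bd_of) (simp add: vertex_sign_def)
    ultimately have "bd (frag_cmul (lookup c {}) (frag_of {v})) = c"
      by (metis bd_cmul)
    moreover have "keys (frag_cmul (lookup c {}) (frag_of {v})) \<subseteq> {\<tau> \<in> \<Gamma>. card \<tau> = Suc q}"
      using v 0 by (auto simp: keys_frag_of)
    ultimately show ?thesis by blast
  next
    case (Suc p)
    have sc: "singular_chain p ?X (affine_chain p c)"
      using singular_chain_affine_chain[OF c[unfolded Suc] \<Gamma> down] .
    have "\<exists>w. singular_chain (Suc p) ?X w \<and> chain_boundary (Suc p) w = affine_chain p c"
    proof (cases p)
      case 0
      \<comment> \<open>In degree 0 the augmentation inside \<open>bd\<close> says that the
        coefficients of \<open>c\<close> sum to zero.\<close>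
      have "0 = bd c" using bd by simp
      also have "\<dots> = frag_extend (\<lambda>_. frag_of {}) c"
        unfolding bd_def
      proof (rule frag_extend_eq)
        fix \<tau> assume "\<tau> \<in> keys c"
        with c Suc 0 obtain u where "\<tau> = {u}" by (auto simp: card_1_singleton_iff)
        then show "(\<Sum>v\<in>\<tau>. frag_cmul (vertex_sign v \<tau>) (frag_of (\<tau> - {v}))) = frag_of {}"
          by simp (simp add: vertex_sign_def)
      qed
      finally have z: "(\<Sum>k\<in>keys c. lookup c k) = 0"
        by (simp add: frag_extend_const)
      have "frag_extend (\<lambda>_. frag_of {}) (affine_chain 0 c) = frag_extend (\<lambda>_. frag_of ({} :: nat set)) c"
      proof (rule frag_induction[of c UNIV])
      qed (simp_all add: affine_chain_diff frag_extend_diff)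
      then have "(\<Sum>k\<in>keys (affine_chain 0 c). lookup (affine_chain 0 c) k) = 0"
        using z by (simp add: frag_extend_const)
      then show ?thesis
        using contractible_0_cycle_bounds[OF contr] sc 0 by simp
    next
      case (Suc p')
      have "chain_boundary p (affine_chain p c) = affine_chain p' (bd c)"
        unfolding Suc by (rule chain_boundary_affine_chain)
          (use c \<open>q = Suc p\<close> Suc \<Gamma> in \<open>auto intro: finite_subset\<close>)
      then show ?thesis
        using contractible_cycle_bounds[OF contr] sc bd Suc by simp
    qed
    then obtain w where w: "singular_chain (Suc p) ?X w" "chain_boundary (Suc p) w = affine_chain p c"
      by blast
    \<comment> \<open>Subdividing the filling also subdivides its boundary, but the vertex map sends
      the subdivided cycle back to \<open>c\<close>.\<close>
    obtain N where N: "keys (vertex_chain n (Suc p) ((singular_subdivision (Suc p) ^^ N) w)) \<subseteq> {\<tau> \<in> \<Gamma>. card \<tau> = Suc (Suc p)}"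
      by (rule small_simplices_span_faces[OF \<Gamma> down w(1)])
    have "bd (vertex_chain n (Suc p) ((singular_subdivision (Suc p) ^^ N) w)) =
        vertex_chain n p ((singular_subdivision p ^^ N) (affine_chain p c))"
      using chain_boundary_iterated_subdivision[OF w(1)] w(2) by (simp add: bd_vertex_chain)
    also have "\<dots> = c"
      by (rule vertex_chain_subdivided_chain) (use c \<Gamma> Suc in auto)
    finally show ?thesis using N Suc by blast
  qed
qed

section \<open>Punctured spheres and deletions\<close>

text \<open>Normalised straight-line homotopy to the antipode of \<open>a\<close>. The segment from
  \<open>x\<close> to the antipode avoids the nonnegative multiples of \<open>a\<close>, hence the
  origin and, after normalisation, the puncture.\<close>

lemma contractible_nsphere_minus_point:
  assumes a: "a \<in> topspace (nsphere d)"
  shows "contractible_space (subtopology (nsphere d) (- {a}))"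
proof -
  let ?X = "subtopology (nsphere d) (- {a})"
  let ?I = "top_of_set {0..1::real}"
  have top: "topspace ?X = {x. (\<Sum>i\<le>d. x i ^ 2) = 1 \<and> (\<forall>i>d. x i = 0) \<and> x \<noteq> a}"
    by (auto simp: nsphere)
  have a2: "(\<Sum>i\<le>d. a i ^ 2) = 1" and a0: "\<forall>i>d. a i = 0"
    using a by (simp_all add: nsphere)
  define h where "h = (\<lambda>(t::real, x :: nat \<Rightarrow> real) i. (1 - t) * x i - t * a i)"
  define N where "N z = sqrt (\<Sum>i\<le>d. h z i ^ 2)" for z
  define H where "H z = (\<lambda>i. h z i / N z)" for z
  have pos: "(\<Sum>i\<le>d. h (t, x) i ^ 2) > 0"
    and Hne: "H (t, x) \<noteq> a" and Hsum: "(\<Sum>i\<le>d. H (t, x) i ^ 2) = 1" and H0: "\<forall>i>d. H (t, x) i = 0"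
    if t: "0 \<le> t" "t \<le> 1" and x: "x \<in> topspace ?X" for t x
  proof -
    have x2: "(\<Sum>i\<le>d. x i ^ 2) = 1" and x0: "\<forall>i>d. x i = 0" and xa: "x \<noteq> a"
      using x unfolding top by auto
    \<comment> \<open>\<open>r = 0\<close> rules out the origin and \<open>r = N (t, x)\<close> the
      puncture. Comparing norms gives \<open>1 - t = r + t\<close>, hence
      \<open>x = a\<close>.\<close>
    have key: False if r: "0 \<le> r" "\<forall>i\<le>d. (1 - t) * x i - t * a i = r * a i" for r
    proof -
      have eq: "(1 - t) * x i = (r + t) * a i" if "i \<le> d" for i
        using r(2) that by (auto simp: algebra_simps)
      have "(1 - t)^2 = (\<Sum>i\<le>d. ((1 - t) * x i)^2)"
        by (simp add: power_mult_distrib x2 flip: sum_distrib_left)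
      also have "\<dots> = (\<Sum>i\<le>d. ((r + t) * a i)^2)"
        using eq by (intro sum.cong) auto
      also have "\<dots> = (r + t)^2"
        by (simp add: power_mult_distrib a2 flip: sum_distrib_left)
      finally have rt: "1 - t = r + t"
        using t r(1) by (simp add: power2_eq_iff_nonneg)
      have "r + t \<noteq> 0" using rt t r(1) by linarith
      then have "x i = a i" for i
        using eq[of i] rt x0 a0 by (cases "i \<le> d") auto
      then show False using xa by auto
    qed
    show pos: "(\<Sum>i\<le>d. h (t, x) i ^ 2) > 0"
    proof (rule ccontr)
      assume "\<not> (\<Sum>i\<le>d. h (t, x) i ^ 2) > 0"
      then have "(\<Sum>i\<le>d. h (t, x) i ^ 2) = 0"
        using sum_nonneg[of "{..d}" "\<lambda>i. h (t, x) i ^ 2"] by simp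
      then have "\<forall>i\<le>d. h (t, x) i = 0"
        by (simp add: sum_nonneg_eq_0_iff)
      then show False
        using key[of 0] by (simp add: h_def)
    qed
    then have N: "N (t, x) > 0" by (simp add: N_def)
    show "H (t, x) \<noteq> a"
    proof
      assume "H (t, x) = a"
      then have "h (t, x) i = N (t, x) * a i" for i
        using N by (auto simp: H_def field_simps)
      then show False
        using key[of "N (t, x)"] N by (simp add: h_def)
    qed
    have "N (t, x) ^ 2 = (\<Sum>i\<le>d. h (t, x) i ^ 2)"
      using pos by (simp add: N_def)
    then show "(\<Sum>i\<le>d. H (t, x) i ^ 2) = 1"
      using pos by (simp add: H_def power_divide flip: sum_divide_distrib)
    show "\<forall>i>d. H (t, x) i = 0"
      using x0 a0 by (simp add: H_def h_def)
  qed
  have cx: "continuous_map (prod_topology ?I ?X) euclideanreal (\<lambda>z. snd z i)" for i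
  proof -
    have "continuous_map ?X euclideanreal (\<lambda>x. x i)"
      by (intro continuous_map_from_subtopology continuous_map_nsphere_projection)
    then show ?thesis
      using continuous_map_compose[OF continuous_map_snd] by (fastforce simp: o_def)
  qed
  have ct: "continuous_map (prod_topology ?I ?X) euclideanreal fst"
    using continuous_map_compose[OF continuous_map_fst, of ?I euclideanreal id] 
    by (simp add: continuous_map_fst continuous_map_into_fulltopology)
  have ch: "continuous_map (prod_topology ?I ?X) euclideanreal (\<lambda>z. h z i)" for i
  proof -
    have "continuous_map (prod_topology ?I ?X) euclideanreal (\<lambda>z. (1 - fst z) * snd z i - fst z * a i)"
      by (intro continuous_intros ct cx)
    then show ?thesis by (simp add: h_def case_prod_unfold)
  qed
  have cN: "continuous_map (prod_topology ?I ?X) euclideanreal N"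
    unfolding N_def by (intro continuous_intros ch) auto
  have cH: "continuous_map (prod_topology ?I ?X) euclideanreal (\<lambda>z. H z i)" for i
    unfolding H_def
  proof (intro continuous_map_real_divide ch cN)
    fix z assume "z \<in> topspace (prod_topology ?I ?X)"
    then have "0 \<le> fst z" "fst z \<le> 1" "snd z \<in> topspace ?X" by (auto simp del: topspace_subtopology simp: topspace_prod_topology)
    from pos[OF this] show "N z \<noteq> 0" by (simp add: N_def)
  qed
  have "continuous_map (prod_topology ?I ?X) (powertop_real UNIV) H"
    using cH by (simp add: continuous_map_componentwise_UNIV)
  moreover have "H z \<in> {x. (\<Sum>i\<le>d. x i ^ 2) = 1 \<and> (\<forall>i>d. x i = 0)} \<inter> - {a}"
    if "z \<in> topspace (prod_topology ?I ?X)" for z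
  proof -
    from that have "0 \<le> fst z" "fst z \<le> 1" "snd z \<in> topspace ?X" by (auto simp del: topspace_subtopology simp: topspace_prod_topology)
    from Hne[OF this] Hsum[OF this] H0[OF this] show ?thesis by simp
  qed
  ultimately have "continuous_map (prod_topology ?I ?X) ?X H"
    unfolding nsphere subtopology_subtopology continuous_map_in_subtopology
    by (auto simp: nsphere subtopology_subtopology)
  moreover have "H (0, x) = x" if "x \<in> topspace ?X" for x
  proof -
    have "(\<Sum>i\<le>d. x i ^ 2) = 1" using that unfolding top by auto
    then show ?thesis by (simp add: H_def N_def h_def)
  qed
  moreover have "H (1, x) = (\<lambda>i. - a i)" for x
    by (simp add: H_def N_def h_def a2)
  ultimately show ?thesis
    unfolding contractible_space_def homotopic_with[of _ "\<lambda>x. True", simplified]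
    by (intro exI[of _ "\<lambda>i. - a i"] exI[of _ H]) auto
qed

definition deletion :: "'a set set \<Rightarrow> 'a set \<Rightarrow> 'a set set" where
  "deletion \<Delta> \<sigma> = {\<tau> \<in> \<Delta>. \<not> \<sigma> \<subseteq> \<tau>}"

text \<open>The retraction pushes a point away from the barycentre of \<open>\<sigma>\<close> until a coordinate in \<open>\<sigma>\<close> vanishes.\<close>

lemma contractible_deletion:
  assumes \<Delta>: "\<Delta> \<subseteq> Pow {1..n}" and down: "\<And>\<tau> \<rho>. \<tau> \<in> \<Delta> \<Longrightarrow> \<rho> \<subseteq> \<tau> \<Longrightarrow> \<rho> \<in> \<Delta>"
    and \<sigma>: "\<sigma> \<in> \<Delta>" "\<sigma> \<noteq> {}"
    and sph: "realization n \<Delta> homeomorphic_space nsphere d"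
  shows "contractible_space (realization n (deletion \<Delta> \<sigma>))"
proof -
  let ?X = "realization n \<Delta>"
  define s where "s = real (card \<sigma>)"
  have \<sigma>n: "\<sigma> \<subseteq> {1..n}"
    using \<sigma> \<Delta> by blast
  then have fin: "finite \<sigma>"
    by (rule finite_subset) simp
  have s: "s > 0" using \<sigma> fin by (simp add: s_def card_gt_0_iff)
  define b where "b i = (if i \<in> \<sigma> then 1 / s else 0)" for i
  have "{i. b i \<noteq> 0} = \<sigma>"
    using s by (auto simp: b_def)
  moreover have sumb: "(\<Sum>i\<in>{1..n}. b i) = 1"
  proof -
    have "(\<Sum>i\<in>{1..n}. b i) = (\<Sum>i\<in>\<sigma>. 1 / s)"
      unfolding b_def using \<sigma>n by (simp add: sum.If_cases Int_absorb1)
    then show ?thesis using s by (simp add: s_def)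
  qed
  ultimately have bX: "b \<in> topspace ?X"
    using \<sigma> s by (simp add: topspace_realization b_def)
  let ?Y = "subtopology ?X (- {b})"
  have contr: "contractible_space ?Y"
  proof -
    obtain f g where fg: "homeomorphic_maps ?X (nsphere d) f g"
      using sph by (auto simp: homeomorphic_space_def)
    then have fb: "f b \<in> topspace (nsphere d)"
      using bX by (auto simp: homeomorphic_maps_def continuous_map_def)
    have "homeomorphic_map ?X (nsphere d) f"
      using fg homeomorphic_map_maps by blast
    then have "homeomorphic_map ?Y (subtopology (nsphere d) (- {f b})) f"
      using bX by (intro homeomorphic_map_subtopologies_alt)
        (auto simp: homeomorphic_eq_everything_map inj_on_def)
    then have "?Y homeomorphic_space subtopology (nsphere d) (- {f b})"
      using homeomorphic_map_imp_homeomorphic_space by metis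
    then show ?thesis
      using contractible_nsphere_minus_point[OF fb] homeomorphic_space_contractibility by blast
  qed
  \<comment> \<open>\<open>m y\<close> is the largest multiple of the barycentre that can be
    subtracted from \<open>y\<close> with nonnegative coordinates; \<open>r\<close> rescales the
    rest to sum 1.\<close>
  define m where "m y = s * Min (y ` \<sigma>)" for y :: "nat \<Rightarrow> real"
  define r where "r y = (\<lambda>i. (y i - m y * b i) / (1 - m y))" for y
  have mle: "m y * b i \<le> y i" if "\<forall>i. 0 \<le> y i" for y i
  proof (cases "i \<in> \<sigma>")
    case True
    then show ?thesis using fin s by (simp add: m_def b_def)
  qed (use that in \<open>simp add: b_def\<close>)
  have m0: "0 \<le> m y" if "\<forall>i. 0 \<le> y i" for y
    using that s fin \<sigma>(2) by (simp add: m_def)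
  \<comment> \<open>If \<open>m y \<ge> 1\<close>, then \<open>y\<close> dominates \<open>b\<close>
    coordinatewise; as both sum to 1, \<open>y\<close> would be the removed point.\<close>
  have m1: "m y < 1" if y: "y \<in> topspace ?Y" for y
  proof (rule ccontr)
    assume ge: "\<not> m y < 1"
    have y': "\<forall>i. 0 \<le> y i" "(\<Sum>i\<in>{1..n}. y i) = 1" "y \<noteq> b" "{i. y i \<noteq> 0} \<in> \<Delta>"
      using y by (auto simp: topspace_realization)
    have le: "b i \<le> y i" for i
    proof -
      have "b i \<le> m y * b i" using ge s mult_right_mono[of 1 "m y" "b i"] by (simp add: b_def)
      then show ?thesis using mle[OF y'(1), of i] by linarith
    qed
    have "(\<Sum>i\<in>{1..n}. y i - b i) = 0"
      using y'(2) sumb by (simp add: sum_subtractf)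
    then have "\<forall>i\<in>{1..n}. y i = b i"
      using le by (simp add: sum_nonneg_eq_0_iff)
    moreover have "y i = b i" if "i \<notin> {1..n}" for i
    proof -
      have "i \<notin> {i. y i \<noteq> 0}" "i \<notin> \<sigma>" using that y'(4) \<Delta> \<sigma>n by blast+
      then show ?thesis by (simp add: b_def)
    qed
    ultimately show False using y'(3) by blast
  qed
  have cY: "continuous_map ?Y euclideanreal (\<lambda>y. y i)" for i
    unfolding realization_def
    by (intro continuous_map_from_subtopology continuous_map_product_projection) simp
  have cm: "continuous_map ?Y euclideanreal m"
  proof -
    have "continuous_map ?Y euclideanreal (\<lambda>y. Min (y ` S))" if "finite S" "S \<noteq> {}" for S
      using that
    proof (induction S rule: finite_ne_induct)
      case (insert x F)
      then have "(\<lambda>y. Min (y ` insert x F)) = (\<lambda>y :: nat \<Rightarrow> real. min (y x) (Min (y ` F)))"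
        by auto
      then show ?case
        using continuous_map_real_min[OF cY[of x] insert.IH] by simp
    qed (simp add: cY)
    then show ?thesis
      unfolding m_def using fin \<sigma>(2) by (intro continuous_intros) auto
  qed
  have cr: "continuous_map ?Y euclideanreal (\<lambda>y. r y i)" for i
    unfolding r_def using m1
    by (intro continuous_map_real_divide continuous_map_diff continuous_map_real_mult cY cm continuous_map_canonical_const) force
  have r: "r y \<in> topspace (realization n (deletion \<Delta> \<sigma>))" if y: "y \<in> topspace ?Y" for y
  proof -
    have y': "\<forall>i. 0 \<le> y i" "(\<Sum>i\<in>{1..n}. y i) = 1" "{i. y i \<noteq> 0} \<in> \<Delta>"
      using y by (auto simp: topspace_realization)
    have nn: "\<forall>i. 0 \<le> r y i"
      using mle[OF y'(1)] m1[OF y] by (simp add: r_def)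
    have "(\<Sum>i\<in>{1..n}. r y i) = ((\<Sum>i\<in>{1..n}. y i) - m y * (\<Sum>i\<in>{1..n}. b i)) / (1 - m y)"
      by (simp add: r_def sum_subtractf sum_distrib_left flip: sum_divide_distrib)
    then have sum: "(\<Sum>i\<in>{1..n}. r y i) = 1"
      using y'(2) sumb m1[OF y] by simp
    have "r y i = 0" if "y i = 0" for i
    proof (cases "i \<in> \<sigma>")
      case True
      then have "Min (y ` \<sigma>) \<le> 0" using fin that by (metis Min_le finite_imageI imageI)
      then have "m y = 0" using m0[OF y'(1)] s by (simp add: m_def zero_le_mult_iff)
      then show ?thesis using that by (simp add: r_def)
    qed (use that in \<open>simp add: r_def b_def\<close>)
    then have "{i. r y i \<noteq> 0} \<subseteq> {i. y i \<noteq> 0}" by auto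
    then have "{i. r y i \<noteq> 0} \<in> \<Delta>" using down y'(3) by blast
    moreover have "\<not> \<sigma> \<subseteq> {i. r y i \<noteq> 0}"
    proof -
      have "Min (y ` \<sigma>) \<in> y ` \<sigma>" using fin \<sigma>(2) by simp
      then obtain i where i: "i \<in> \<sigma>" "y i = Min (y ` \<sigma>)" by auto
      then have "r y i = 0" using s by (simp add: r_def m_def b_def)
      with i show ?thesis by auto
    qed
    ultimately show ?thesis
      using nn sum by (simp add: topspace_realization deletion_def)
  qed
  have sub: "x \<in> topspace ?Y \<and> r x = x" if x: "x \<in> topspace (realization n (deletion \<Delta> \<sigma>))" for x
  proof -
    have x': "\<forall>i. 0 \<le> x i" "(\<Sum>i\<in>{1..n}. x i) = 1" "{i. x i \<noteq> 0} \<in> \<Delta>" "\<not> \<sigma> \<subseteq> {i. x i \<noteq> 0}"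
      using x by (auto simp: topspace_realization deletion_def)
    then obtain j where j: "j \<in> \<sigma>" "x j = 0" by auto
    then have "Min (x ` \<sigma>) \<le> 0" using fin by (metis Min_le finite_imageI imageI)
    then have "m x = 0" using m0[OF x'(1)] s by (simp add: m_def zero_le_mult_iff)
    moreover have "x \<noteq> b" using j s by (auto simp: b_def)
    ultimately show ?thesis
      using x' by (auto simp: topspace_realization r_def)
  qed
  have "continuous_map ?Y (powertop_real UNIV) r"
    using cr by (simp add: continuous_map_componentwise_UNIV)
  then have c1: "continuous_map ?Y (realization n (deletion \<Delta> \<sigma>)) r"
    using r unfolding realization_def continuous_map_in_subtopology by auto
  have "continuous_map (realization n (deletion \<Delta> \<sigma>)) (powertop_real UNIV) id"
    unfolding realization_def by (intro continuous_map_from_subtopology) simp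
  then have "continuous_map (realization n (deletion \<Delta> \<sigma>)) ?Y id"
    using sub unfolding realization_def subtopology_subtopology continuous_map_in_subtopology
    by (auto simp: topspace_realization)
  with c1 sub have "retraction_map ?Y (realization n (deletion \<Delta> \<sigma>)) r"
    unfolding retraction_map_def retraction_maps_def by (intro exI[of _ id]) simp
  then show ?thesis
    using contractible_space_retraction_map_image contr by blast
qed

text \<open>Positive dimension enters through this: a complex without edges has finitely many
  points. The witness is an arc of a great circle, injective because its angle stays below
  \<open>pi\<close>.\<close>

lemma realization_nsphere_infinite:
  assumes d: "0 < d" and sph: "realization n \<Delta> homeomorphic_space nsphere d"
  shows "infinite (topspace (realization n \<Delta>))"
proof
  assume "finite (topspace (realization n \<Delta>))"
  moreover obtain f g where fg: "homeomorphic_maps (realization n \<Delta>) (nsphere d) f g"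
    using sph by (auto simp: homeomorphic_space_def)
  then have "topspace (nsphere d) = f ` topspace (realization n \<Delta>)"
    using homeomorphic_imp_surjective_map homeomorphic_map_maps by metis
  ultimately have "finite (topspace (nsphere d))" by simp
  moreover have inj: "inj_on (\<lambda>t::real. (\<lambda>i::nat. if i = 0 then cos t else if i = 1 then sin t else 0)) {0..1}"
  proof (rule inj_onI)
    fix t u :: real
    assume tu: "t \<in> {0..1}" "u \<in> {0..1}" and
      eq: "(\<lambda>i::nat. if i = 0 then cos t else if i = 1 then sin t else 0) = (\<lambda>i. if i = 0 then cos u else if i = 1 then sin u else 0)"
    have "cos t = cos u" using fun_cong[OF eq, of 0] by simp
    moreover have "t \<le> pi" "u \<le> pi" using pi_gt3 tu by auto
    ultimately show "t = u" using tu cos_inj_pi by simp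
  qed
  moreover have "(\<lambda>t::real. (\<lambda>i::nat. if i = 0 then cos t else if i = 1 then sin t else 0)) ` {0..1} \<subseteq> topspace (nsphere d)"
  proof
    fix x assume "x \<in> (\<lambda>t::real. (\<lambda>i::nat. if i = 0 then cos t else if i = 1 then sin t else 0)) ` {0..1}"
    then obtain t where x: "x = (\<lambda>i::nat. if i = 0 then cos t else if i = 1 then sin t else 0)" by blast
    have "(\<Sum>i\<le>d. x i ^ 2) = (\<Sum>i\<in>{0, 1}. x i ^ 2)"
      by (rule sum.mono_neutral_right) (use d in \<open>auto simp: x\<close>)
    then show "x \<in> topspace (nsphere d)"
      using d by (simp add: nsphere x)
  qed
  ultimately have "finite {0..1::real}"
    using finite_imageD[OF finite_subset inj] by blast
  then show False using infinite_Icc[of 0 "1::real"] by simp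
qed

section \<open>Complexes with acyclic deletions\<close>

text \<open>All that is kept of the sphere. The last assumption is the trace of positive dimension;
  it gives \<open>2 \<le> D\<close>.\<close>

locale punctured_acyclic =
  fixes n :: nat and \<Delta> :: "nat set set"
  assumes faces: "\<Delta> \<subseteq> Pow {1..n}"
    and down: "\<And>\<tau> \<rho>. \<tau> \<in> \<Delta> \<Longrightarrow> \<rho> \<subseteq> \<tau> \<Longrightarrow> \<rho> \<in> \<Delta>"
    and acyclic_deletion: "\<And>\<sigma>. \<sigma> \<in> \<Delta> \<Longrightarrow> \<sigma> \<noteq> {} \<Longrightarrow> acyclic_complex (deletion \<Delta> \<sigma>)"
    and edge: "\<exists>\<sigma>\<in>\<Delta>. 2 \<le> card \<sigma>"
begin

definition D :: nat where "D = complex_dim \<Delta> + 1"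

lemma finite_face: "\<tau> \<in> \<Delta> \<Longrightarrow> finite \<tau>"
  using faces finite_subset by blast

lemma finite_complex: "finite \<Delta>"
  using faces finite_subset by blast

lemma D_eq: "D = Max (card ` \<Delta>)" and D_ge: "2 \<le> D"
proof -
  obtain \<sigma> where "\<sigma> \<in> \<Delta>" "2 \<le> card \<sigma>" using edge by blast
  then have "2 \<le> Max (card ` \<Delta>)"
    using finite_complex by (metis Max_ge finite_imageI imageI order_trans)
  then show "D = Max (card ` \<Delta>)" "2 \<le> D"
    by (simp_all add: D_def complex_dim_def)
qed

lemma card_le_D: "\<tau> \<in> \<Delta> \<Longrightarrow> card \<tau> \<le> D"
  unfolding D_eq using finite_complex by simp

lemma ex_facet: "\<exists>\<sigma>\<in>\<Delta>. card \<sigma> = D"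
proof -
  have "Max (card ` \<Delta>) \<in> card ` \<Delta>"
    using finite_complex edge by (intro Max_in) auto
  then show ?thesis by (auto simp: D_eq)
qed

lemma facet_maximal: "\<sigma> \<in> \<Delta> \<Longrightarrow> card \<sigma> = D \<Longrightarrow> \<tau> \<in> \<Delta> \<Longrightarrow> \<sigma> \<subseteq> \<tau> \<Longrightarrow> \<tau> = \<sigma>"
  using card_le_D[of \<tau>] finite_face[of \<tau>] by (metis card_seteq)

text \<open>The boundary of \<open>\<sigma>\<close> lies in the deletion of \<open>\<sigma>\<close>
  and bounds there; subtracting that filling from \<open>\<sigma>\<close> leaves a cycle whose
  coefficient at \<open>\<sigma>\<close> is still 1.\<close>

lemma maximal_face_cycle:
  assumes \<sigma>: "\<sigma> \<in> \<Delta>" "\<sigma> \<noteq> {}"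
  shows "\<exists>z. keys z \<subseteq> {\<tau> \<in> \<Delta>. card \<tau> = card \<sigma>} \<and> bd z = 0 \<and> lookup z \<sigma> = 1"
proof -
  have keys: "keys (bd (frag_of \<sigma>)) \<subseteq> {\<tau> \<in> deletion \<Delta> \<sigma>. card \<tau> = card \<sigma> - 1}"
  proof
    fix \<rho> assume "\<rho> \<in> keys (bd (frag_of \<sigma>))"
    then obtain v where "v \<in> \<sigma>" "\<rho> = \<sigma> - {v}"
      using keys_bd[of \<rho> "frag_of \<sigma>"] by (auto simp: keys_frag_of)
    then show "\<rho> \<in> {\<tau> \<in> deletion \<Delta> \<sigma>. card \<tau> = card \<sigma> - 1}"
      using down[OF \<sigma>(1), of \<rho>] finite_face[OF \<sigma>(1)] by (auto simp: deletion_def)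
  qed
  have "bd (bd (frag_of \<sigma>)) = 0"
    by (rule bd_bd) (simp add: keys_frag_of finite_face[OF \<sigma>(1)])
  from acyclic_complexD[OF acyclic_deletion[OF \<sigma>] keys this]
  obtain b where b: "keys b \<subseteq> {\<tau> \<in> deletion \<Delta> \<sigma>. card \<tau> = Suc (card \<sigma> - 1)}"
      "bd b = bd (frag_of \<sigma>)"
    by (elim exE conjE)
  have c: "Suc (card \<sigma> - 1) = card \<sigma>"
    using \<sigma> finite_face[OF \<sigma>(1)] by (simp add: card_gt_0_iff)
  have "\<sigma> \<notin> keys b"
    using b(1) by (auto simp: deletion_def)
  then have "lookup b \<sigma> = 0"
    by (simp add: in_keys_iff)
  moreover have "keys (frag_of \<sigma> - b) \<subseteq> {\<tau> \<in> \<Delta>. card \<tau> = card \<sigma>}"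
    using keys_diff[of "frag_of \<sigma>" b] b(1) \<sigma>(1) c by (auto simp: keys_frag_of deletion_def)
  ultimately show ?thesis
    using b(2) by (intro exI[of _ "frag_of \<sigma> - b"]) (simp add: bd_diff lookup_minus)
qed

text \<open>The cycle through \<open>\<sigma>\<close> has the wrong cardinality to involve
  \<open>\<tau>\<close>, the only face above \<open>\<tau>\<close>, so it lives in the deletion of
  \<open>\<tau>\<close> and bounds. Some face of the filling would then properly contain
  \<open>\<sigma>\<close>.\<close>

lemma maximal_face_card:
  assumes \<sigma>: "\<sigma> \<in> \<Delta>" "\<sigma> \<noteq> {}" "\<And>\<rho>. \<rho> \<in> \<Delta> \<Longrightarrow> \<sigma> \<subseteq> \<rho> \<Longrightarrow> \<rho> = \<sigma>"
    and \<tau>: "\<tau> \<in> \<Delta>" "\<tau> \<noteq> {}" "\<And>\<rho>. \<rho> \<in> \<Delta> \<Longrightarrow> \<tau> \<subseteq> \<rho> \<Longrightarrow> \<rho> = \<tau>"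
  shows "card \<sigma> = card \<tau>"
proof (rule ccontr)
  assume ne: "card \<sigma> \<noteq> card \<tau>"
  from maximal_face_cycle[OF \<sigma>(1,2)]
  obtain z where z: "keys z \<subseteq> {\<rho> \<in> \<Delta>. card \<rho> = card \<sigma>}" "bd z = 0" "lookup z \<sigma> = 1"
    by (elim exE conjE)
  have "keys z \<subseteq> {\<rho> \<in> deletion \<Delta> \<tau>. card \<rho> = card \<sigma>}"
  proof
    fix \<rho> assume "\<rho> \<in> keys z"
    then have "\<rho> \<in> \<Delta>" "card \<rho> = card \<sigma>" using z(1) by auto
    then show "\<rho> \<in> {\<rho> \<in> deletion \<Delta> \<tau>. card \<rho> = card \<sigma>}"
      using \<tau>(3)[of \<rho>] ne by (auto simp: deletion_def)
  qed
  from acyclic_complexD[OF acyclic_deletion[OF \<tau>(1,2)] this z(2)]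
  obtain b where b: "keys b \<subseteq> {\<rho> \<in> deletion \<Delta> \<tau>. card \<rho> = Suc (card \<sigma>)}" "bd b = z"
    by (elim exE conjE)
  have "\<sigma> \<in> keys (bd b)"
    using z(3) b(2) by (simp add: in_keys_iff)
  then obtain \<rho> v where "\<rho> \<in> keys b" "v \<in> \<rho>" "\<sigma> = \<rho> - {v}"
    using keys_bd by blast
  then show False
    using b(1) \<sigma>(3)[of \<rho>] by (auto simp: deletion_def)
qed

lemma face_in_facet:
  assumes \<tau>: "\<tau> \<in> \<Delta>"
  shows "\<exists>\<sigma>\<in>\<Delta>. \<tau> \<subseteq> \<sigma> \<and> card \<sigma> = D"
proof -
  define S where "S = {\<rho> \<in> \<Delta>. \<tau> \<subseteq> \<rho>}"
  have S: "finite S" "S \<noteq> {}"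
    using finite_complex \<tau> by (auto simp: S_def)
  obtain \<sigma> where \<sigma>: "\<sigma> \<in> S" "\<And>\<rho>. \<rho> \<in> S \<Longrightarrow> \<sigma> \<subseteq> \<rho> \<Longrightarrow> \<rho> = \<sigma>"
    using finite_has_maximal[OF S] by metis
  then have \<sigma>': "\<sigma> \<in> \<Delta>" "\<tau> \<subseteq> \<sigma>" "\<And>\<rho>. \<rho> \<in> \<Delta> \<Longrightarrow> \<sigma> \<subseteq> \<rho> \<Longrightarrow> \<rho> = \<sigma>"
    by (auto simp: S_def)
  obtain \<phi> where \<phi>: "\<phi> \<in> \<Delta>" "card \<phi> = D" using ex_facet by blast
  have "\<phi> \<noteq> {}" using \<phi> D_ge by auto
  moreover have "\<sigma> \<noteq> {}"
    using \<sigma>'(3)[OF \<phi>(1)] \<open>\<phi> \<noteq> {}\<close> by auto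
  ultimately have "card \<sigma> = card \<phi>"
    by (intro maximal_face_card \<sigma>'(1) \<sigma>'(3) \<phi>(1) facet_maximal[OF \<phi>])
  then show ?thesis using \<sigma>' \<phi> by auto
qed

text \<open>A top cycle that misses one facet lies in the deletion of that facet and bounds there,
  but no face has cardinality \<open>Suc D\<close>. Nonvanishing of the fundamental cycle, the two
  facets at a ridge and strong connectivity all reduce to this.\<close>

lemma top_cycle_eq_0:
  assumes z: "keys z \<subseteq> {\<tau> \<in> \<Delta>. card \<tau> = D}" "bd z = 0"
    and \<sigma>: "\<sigma> \<in> \<Delta>" "card \<sigma> = D" "lookup z \<sigma> = 0"
  shows "z = 0"
proof -
  have "\<sigma> \<noteq> {}" using \<sigma>(2) D_ge by auto
  have "\<not> \<sigma> \<subseteq> \<rho>" if \<rho>: "\<rho> \<in> keys z" for \<rho>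
  proof
    assume "\<sigma> \<subseteq> \<rho>"
    then have "\<rho> = \<sigma>" using facet_maximal[OF \<sigma>(1,2)] \<rho> z(1) by blast
    then show False using \<rho> \<sigma>(3) by (simp add: in_keys_iff)
  qed
  then have "keys z \<subseteq> {\<rho> \<in> deletion \<Delta> \<sigma>. card \<rho> = D}"
    using z(1) by (auto simp: deletion_def)
  from acyclic_complexD[OF acyclic_deletion[OF \<sigma>(1) \<open>\<sigma> \<noteq> {}\<close>] this z(2)]
  obtain b where b: "keys b \<subseteq> {\<rho> \<in> deletion \<Delta> \<sigma>. card \<rho> = Suc D}" "bd b = z"
    by (elim exE conjE)
  have "keys b = {}"
  proof (rule equals0I)
    fix \<rho> assume "\<rho> \<in> keys b"
    then have "\<rho> \<in> \<Delta>" "card \<rho> = Suc D" using b(1) by (auto simp: deletion_def)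
    then show False using card_le_D[of \<rho>] by simp
  qed
  then show "z = 0" using b(2) by simp
qed

lemma fundamental_cycle:
  "\<exists>z. keys z \<subseteq> {\<tau> \<in> \<Delta>. card \<tau> = D} \<and> bd z = 0 \<and>
    (\<forall>\<sigma>\<in>\<Delta>. card \<sigma> = D \<longrightarrow> lookup z \<sigma> \<noteq> 0)"
proof -
  obtain \<phi> where \<phi>: "\<phi> \<in> \<Delta>" "card \<phi> = D" using ex_facet by blast
  then have "\<phi> \<noteq> {}" using D_ge by auto
  from maximal_face_cycle[OF \<phi>(1) this] obtain z where z: "keys z \<subseteq> {\<tau> \<in> \<Delta>. card \<tau> = D}"
    "bd z = 0" "lookup z \<phi> = 1"
    unfolding \<phi>(2) by (elim exE conjE)
  have "lookup z \<sigma> \<noteq> 0" if "\<sigma> \<in> \<Delta>" "card \<sigma> = D" for \<sigma>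
  proof
    assume "lookup z \<sigma> = 0"
    then have "z = 0" by (rule top_cycle_eq_0[OF z(1,2) that])
    then show False using z(3) by simp
  qed
  with z show ?thesis by blast
qed

text \<open>With one facet at \<open>F\<close>, the boundary of the fundamental cycle would have a
  single nonzero term at \<open>F\<close>. With three, a top cycle can be built that is nonzero on
  the first and zero on the third.\<close>

lemma ridge_in_two_facets:
  assumes F: "F \<in> \<Delta>" "Suc (card F) = D"
  shows "\<exists>u v. u \<noteq> v \<and> {x. x \<notin> F \<and> insert x F \<in> \<Delta>} = {u, v}"
proof -
  define C where "C = {x. x \<notin> F \<and> insert x F \<in> \<Delta>}"
  have CV: "C \<subseteq> {1..n} - F" using faces by (auto simp: C_def)
  have Fn: "F \<subseteq> {1..n}" using F faces by blast
  have fin: "finite F" by (rule finite_face[OF F(1)])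
  have card: "card (insert x F) = D" if "x \<in> C" for x
    using that F(2) fin by (simp add: C_def)
  obtain \<sigma> where \<sigma>: "\<sigma> \<in> \<Delta>" "F \<subseteq> \<sigma>" "card \<sigma> = D"
    using face_in_facet[OF F(1)] by blast
  have "F \<noteq> \<sigma>" using \<sigma> F by auto
  then obtain u where u: "u \<in> \<sigma>" "u \<notin> F" using \<sigma> by auto
  have uC: "u \<in> C"
    using down[OF \<sigma>(1), of "insert u F"] u \<sigma> by (auto simp: C_def)
  have "\<exists>v\<in>C. v \<noteq> u"
  proof (rule ccontr)
    assume "\<not> (\<exists>v\<in>C. v \<noteq> u)"
    then have only: "C = {u}" using uC by blast
    from fundamental_cycle
    obtain z where z: "keys z \<subseteq> {\<tau> \<in> \<Delta>. card \<tau> = D}" "bd z = 0"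
      "\<forall>\<sigma>\<in>\<Delta>. card \<sigma> = D \<longrightarrow> lookup z \<sigma> \<noteq> 0"
      by (elim exE conjE)
    have "0 = lookup (bd z) F" using z(2) by simp
    also have "\<dots> = (\<Sum>v\<in>{1..n} - F. vertex_sign v F * lookup z (insert v F))"
      by (rule lookup_bd) (use z(1) faces Fn in auto)
    also have "\<dots> = (\<Sum>v\<in>{u}. vertex_sign v F * lookup z (insert v F))"
    proof (rule sum.mono_neutral_right)
      show "\<forall>i\<in>{1..n} - F - {u}. vertex_sign i F * lookup z (insert i F) = 0"
      proof
        fix i assume i: "i \<in> {1..n} - F - {u}"
        then have "i \<notin> C" "i \<notin> F" using only by auto
        then have "insert i F \<notin> \<Delta>" by (simp add: C_def)
        then have "insert i F \<notin> keys z"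
          using z(1) by blast
        then show "vertex_sign i F * lookup z (insert i F) = 0"
          by (simp add: in_keys_iff)
      qed
    qed (use CV uC in auto)
    finally show False
      using z(3) uC card[OF uC] by (auto simp: C_def)
  qed
  then obtain v where v: "v \<in> C" "v \<noteq> u" by blast
  have "C = {u, v}"
  proof (rule ccontr)
    assume "C \<noteq> {u, v}"
    then obtain w where w: "w \<in> C" "w \<noteq> u" "w \<noteq> v" using uC v by auto
    \<comment> \<open>The signs cancel \<open>F\<close> from the boundary, so \<open>bd c\<close>
      lies in the deletion of \<open>F\<close> and has a filling \<open>b\<close> there. No face of
      \<open>b\<close> contains \<open>F\<close>, so \<open>c - b\<close> keeps the coefficients of
      \<open>c\<close> on the facets through \<open>F\<close>.\<close>
    define c where "c = frag_cmul (vertex_sign v F) (frag_of (insert u F)) - frag_cmul (vertex_sign u F) (frag_of (insert v F))"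
    have kc: "keys c \<subseteq> {insert u F, insert v F}"
      unfolding c_def using keys_diff[of "frag_cmul (vertex_sign v F) (frag_of (insert u F))"
        "frag_cmul (vertex_sign u F) (frag_of (insert v F))"] by (auto simp: keys_frag_of)
    have lc: "lookup c (insert x F) = (if x = u then vertex_sign v F else if x = v then - vertex_sign u F else 0)"
      if "x \<notin> F" for x
    proof -
      have "insert x F = insert u F \<longleftrightarrow> x = u" "insert x F = insert v F \<longleftrightarrow> x = v"
        using that uC v(1) unfolding C_def by blast+
      then show ?thesis
        using v(2) by (simp add: c_def lookup_minus)
    qed
    have "lookup (bd c) F = (\<Sum>x\<in>{1..n} - F. vertex_sign x F * lookup c (insert x F))"
      by (rule lookup_bd) (use kc uC v(1) Fn faces in \<open>auto simp: C_def\<close>)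
    also have "\<dots> = (\<Sum>x\<in>{u, v}. vertex_sign x F * lookup c (insert x F))"
      by (rule sum.mono_neutral_right) (use CV uC v lc in auto)
    also have "\<dots> = 0"
      using lc uC v by (simp add: C_def)
    finally have l0: "lookup (bd c) F = 0" .
    have kbd: "keys (bd c) \<subseteq> {\<rho> \<in> deletion \<Delta> F. card \<rho> = D - 1}"
    proof
      fix \<rho> assume \<rho>: "\<rho> \<in> keys (bd c)"
      then obtain x y where xy: "x \<in> C" "y \<in> insert x F" "\<rho> = insert x F - {y}"
      proof -
        obtain \<pi> y where y: "\<pi> \<in> keys c" "y \<in> \<pi>" "\<rho> = \<pi> - {y}"
          using keys_bd[OF \<rho>] by (elim bexE)
        with kc have "\<pi> = insert u F \<or> \<pi> = insert v F" by auto
        then show ?thesis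
          using that[of u y] that[of v y] y uC v(1) by (elim disjE) simp_all
      qed
      then have 1: "\<rho> \<in> \<Delta>" "card \<rho> = D - 1"
        using down[of "insert x F" \<rho>] card[OF xy(1)] fin by (auto simp: C_def)
      have "\<not> F \<subseteq> \<rho>"
      proof
        assume "F \<subseteq> \<rho>"
        then have "F = \<rho>" using 1 F(2) finite_face[OF 1(1)] by (intro card_subset_eq) auto
        then show False using \<rho> l0 by (simp add: in_keys_iff)
      qed
      with 1 show "\<rho> \<in> {\<rho> \<in> deletion \<Delta> F. card \<rho> = D - 1}" by (simp add: deletion_def)
    qed
    have bb: "bd (bd c) = 0"
      by (rule bd_bd) (use kc fin in auto)
    have "F \<noteq> {}" using F(2) D_ge by auto
    from acyclic_complexD[OF acyclic_deletion[OF F(1) this] kbd bb]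
    obtain b where b: "keys b \<subseteq> {\<rho> \<in> deletion \<Delta> F. card \<rho> = Suc (D - 1)}" "bd b = bd c"
      by (elim exE conjE)
    have bx: "lookup b (insert x F) = 0" for x
    proof -
      have "insert x F \<notin> keys b" using b(1) by (auto simp: deletion_def)
      then show ?thesis by (simp add: in_keys_iff)
    qed
    have "c - b = 0"
    proof (rule top_cycle_eq_0)
      show "keys (c - b) \<subseteq> {\<tau> \<in> \<Delta>. card \<tau> = D}"
        using keys_diff[of c b] kc b(1) uC v(1) card D_ge by (auto simp: C_def deletion_def)
      show "bd (c - b) = 0" using b(2) by (simp add: bd_diff)
      show "insert w F \<in> \<Delta>" "card (insert w F) = D" using w card by (auto simp: C_def)
      show "lookup (c - b) (insert w F) = 0"
        using lc w bx by (simp add: lookup_minus C_def)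
    qed
    then have "lookup (c - b) (insert u F) = 0" by simp
    then show False
      using lc[of u] uC bx by (simp add: lookup_minus C_def)
  qed
  then show ?thesis using v(2) unfolding C_def by blast
qed

text \<open>Strong connectivity as an induction rule. If \<open>P\<close> is preserved across
  ridges, the part of the fundamental cycle on facets with \<open>P\<close> is again a cycle; were
  \<open>P \<tau>\<close> false, it would miss \<open>\<tau>\<close> and vanish, against
  \<open>P \<sigma>\<close>.\<close>

lemma facet_induct [consumes 4, case_names step]:
  assumes \<sigma>: "\<sigma> \<in> \<Delta>" "card \<sigma> = D" and \<tau>: "\<tau> \<in> \<Delta>" "card \<tau> = D" and "P \<sigma>"
    and step: "\<And>F u v. F \<in> \<Delta> \<Longrightarrow> Suc (card F) = D \<Longrightarrow> u \<noteq> v \<Longrightarrow> u \<notin> F \<Longrightarrow> v \<notin> F \<Longrightarrow> insert u F \<in> \<Delta> \<Longrightarrow> insert v F \<in> \<Delta> \<Longrightarrow>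
      P (insert u F) \<Longrightarrow> P (insert v F)"
  shows "P \<tau>"
proof (rule ccontr)
  assume nP: "\<not> P \<tau>"
  from fundamental_cycle
  obtain z where z: "keys z \<subseteq> {\<tau> \<in> \<Delta>. card \<tau> = D}" "bd z = 0"
    "\<forall>\<sigma>\<in>\<Delta>. card \<sigma> = D \<longrightarrow> lookup z \<sigma> \<noteq> 0"
    by (elim exE conjE)
  define z' where "z' = frag_extend (\<lambda>\<rho>. if P \<rho> then frag_of \<rho> else 0) z"
  have lz: "lookup z' \<rho> = (if P \<rho> then lookup z \<rho> else 0)" for \<rho>
  proof -
    have "lookup z' \<rho> = (\<Sum>\<pi>\<in>keys z. if \<pi> = \<rho> then (if P \<rho> then lookup z \<rho> else 0) else 0)"
      unfolding z'_def lookup_frag_extend[OF finite_keys order_refl]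
      by (rule sum.cong) (auto simp: lookup_single)
    also have "\<dots> = (if P \<rho> then lookup z \<rho> else 0)"
      by (simp add: in_keys_iff)
    finally show ?thesis .
  qed
  have kP: "\<rho> \<in> keys z \<and> P \<rho>" if "\<rho> \<in> keys z'" for \<rho>
    using that unfolding in_keys_iff lz by (simp split: if_splits)
  then have kz': "keys z' \<subseteq> {\<tau> \<in> \<Delta>. card \<tau> = D}"
    using z(1) by blast
  have "bd z' = 0"
  proof (rule poly_mapping_eqI)
    fix F
    show "lookup (bd z') F = lookup 0 F"
    proof (cases "F \<in> keys (bd z')")
      case True
      then obtain \<rho> y where \<rho>: "\<rho> \<in> keys z'" "y \<in> \<rho>" "F = \<rho> - {y}"
        using keys_bd by blast
      then have Fn: "F \<subseteq> {1..n}" using kz' faces by auto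
      have \<rho>': "\<rho> \<in> \<Delta>" "card \<rho> = D" "P \<rho>"
        using kz' kP \<rho>(1) by auto
      have F: "F \<in> \<Delta>" "Suc (card F) = D" "insert y F = \<rho>" "y \<notin> F"
        using \<rho> \<rho>' down[OF \<rho>'(1), of F] finite_face[OF \<rho>'(1)] card_Suc_Diff1[of \<rho> y] by auto
      have "lookup (bd z') F = (\<Sum>v\<in>{1..n} - F. vertex_sign v F * lookup z' (insert v F))"
        by (rule lookup_bd) (use kz' faces Fn in auto)
      also have "\<dots> = (\<Sum>v\<in>{1..n} - F. vertex_sign v F * lookup z (insert v F))"
      proof (rule sum.cong[OF refl])
        fix v assume v: "v \<in> {1..n} - F"
        have "lookup z' (insert v F) = lookup z (insert v F)"
        proof (cases "insert v F \<in> \<Delta>")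
          case True
          have "P (insert v F)"
          proof (cases "v = y")
            case False
            then show ?thesis
              using step[OF F(1,2), of y v] F(3,4) \<rho>'(1,3) v True by blast
          qed (use F(3) \<rho>'(3) in simp)
          then show ?thesis by (simp add: lz)
        next
          case False
          then have "insert v F \<notin> keys z" using z(1) by auto
          then show ?thesis by (simp add: lz in_keys_iff)
        qed
        then show "vertex_sign v F * lookup z' (insert v F) =
          vertex_sign v F * lookup z (insert v F)" by simp
      qed
      also have "\<dots> = lookup (bd z) F"
        by (rule lookup_bd[symmetric]) (use z(1) faces Fn in auto)
      finally show ?thesis using z(2) by simp
    qed (simp add: in_keys_iff)
  qed
  then have "z' = 0"
    using top_cycle_eq_0[OF kz' _ \<tau>] nP by (simp add: lz)
  then show False
    using lz[of \<sigma>] \<open>P \<sigma>\<close> z(3) \<sigma> by simp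
qed

text \<open>Deleting a facet removes only that facet, and the acyclic rest contributes zero.\<close>

lemma euler_sum: "(\<Sum>\<tau>\<in>\<Delta>. (-1) ^ card \<tau>) = ((-1) ^ D :: int)"
proof -
  obtain \<phi> where \<phi>: "\<phi> \<in> \<Delta>" "card \<phi> = D" using ex_facet by blast
  then have "\<phi> \<noteq> {}" using D_ge by auto
  have "\<Delta> = insert \<phi> (deletion \<Delta> \<phi>)"
    using \<phi> facet_maximal[OF \<phi>] by (auto simp: deletion_def)
  moreover have "\<phi> \<notin> deletion \<Delta> \<phi>" "finite (deletion \<Delta> \<phi>)"
    using finite_complex by (auto simp: deletion_def)
  moreover have "(\<Sum>\<tau>\<in>deletion \<Delta> \<phi>. (-1) ^ card \<tau>) = (0::int)"
    by (rule acyclic_complex_euler[OF acyclic_deletion[OF \<phi>(1) \<open>\<phi> \<noteq> {}\<close>]])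
      (use finite_complex finite_face down in \<open>auto simp: deletion_def\<close>)
  ultimately show ?thesis
    using \<phi>(2) by (metis (no_types, lifting) add.right_neutral sum.insert)
qed

text \<open>The coefficient of the h-polynomial in degree \<open>D\<close> is the value of
  \<open>shifted_f_poly\<close> at 0, which the Euler relation makes 1.\<close>

lemma degree_h_poly: "Polynomial.degree (h_poly \<Delta>) = D"
proof (rule antisym)
  have D: "complex_dim \<Delta> + 1 = D" by (simp add: D_def)
  show "Polynomial.degree (h_poly \<Delta>) \<le> D"
    unfolding h_poly_def D by (intro degree_sum_le) (auto intro: order_trans[OF degree_monom_le])
  have "Polynomial.coeff (h_poly \<Delta>) D = (\<Sum>i\<le>D. if i = D then Polynomial.coeff (shifted_f_poly \<Delta>) 0 else 0)"
    unfolding h_poly_def D coeff_sum by (rule sum.cong) auto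
  also have "\<dots> = poly (shifted_f_poly \<Delta>) 0"
    by (simp add: poly_0_coeff_0)
  also have "\<dots> = (\<Sum>i\<le>D. int (face_number \<Delta> i) * (-1) ^ (D - i))"
    by (simp add: shifted_f_poly_def D[simplified] poly_sum)
  also have "\<dots> = (\<Sum>i\<le>D. (-1) ^ D * (int (face_number \<Delta> i) * (-1) ^ i))"
  proof (rule sum.cong[OF refl])
    fix i assume "i \<in> {..D}"
    then have "D = (D - i) + i" by simp
    then have "(-1 :: int) ^ D = (-1) ^ (D - i) * (-1) ^ i" by (metis power_add)
    moreover have "(-1 :: int) ^ i * (-1) ^ i = 1" by (simp flip: power_mult_distrib)
    ultimately show "int (face_number \<Delta> i) * (-1) ^ (D - i) = (-1) ^ D * (int (face_number \<Delta> i) * (-1) ^ i)"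
      by (simp add: mult.assoc mult.left_commute)
  qed
  also have "\<dots> = (-1) ^ D * (\<Sum>i\<le>D. \<Sum>\<tau>\<in>{\<tau> \<in> \<Delta>. card \<tau> = i}. (-1) ^ card \<tau>)"
    by (simp add: sum_distrib_left face_number_def)
  also have "(\<Sum>i\<le>D. \<Sum>\<tau>\<in>{\<tau> \<in> \<Delta>. card \<tau> = i}. (-1) ^ card \<tau>) = (\<Sum>\<tau>\<in>\<Delta>. (-1 :: int) ^ card \<tau>)"
    by (rule sum.group) (use finite_complex card_le_D in auto)
  also have "(-1) ^ D * \<dots> = (1::int)"
    unfolding euler_sum by (simp flip: power_mult_distrib)
  finally show "D \<le> Polynomial.degree (h_poly \<Delta>)"
    by (intro le_degree) simp
qed

text \<open>A facet above \<open>\<tau>\<close> gives \<open>D - card \<tau>\<close> link vertices;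
  the neighbouring facet across a ridge containing \<open>\<tau>\<close> gives one more.\<close>

lemma card_link:
  assumes \<tau>: "\<tau> \<in> \<Delta>" "card \<tau> < D"
  shows "D + 1 - card \<tau> \<le> card {v. v \<notin> \<tau> \<and> insert v \<tau> \<in> \<Delta>}"
proof -
  obtain \<sigma> where \<sigma>: "\<sigma> \<in> \<Delta>" "\<tau> \<subseteq> \<sigma>" "card \<sigma> = D"
    using face_in_facet[OF \<tau>(1)] by blast
  then obtain w where w: "w \<in> \<sigma>" "w \<notin> \<tau>" using \<tau>(2) by (metis less_irrefl subset_antisym subsetI)
  have F: "\<sigma> - {w} \<in> \<Delta>" "Suc (card (\<sigma> - {w})) = D"
    using down[OF \<sigma>(1), of "\<sigma> - {w}"] \<sigma>(3) w(1) card_Suc_Diff1[OF finite_face[OF \<sigma>(1)] w(1)] by auto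
  obtain a b where ab: "a \<noteq> b" "{x. x \<notin> \<sigma> - {w} \<and> insert x (\<sigma> - {w}) \<in> \<Delta>} = {a, b}"
    using ridge_in_two_facets[OF F] by blast
  have "w \<in> {a, b}" unfolding ab(2)[symmetric] using \<sigma>(1) w(1) by (simp add: insert_absorb)
  then obtain x where "x \<in> {a, b}" "x \<noteq> w" using ab(1) by blast
  then have x: "x \<noteq> w" "x \<notin> \<sigma>" "insert x (\<sigma> - {w}) \<in> \<Delta>"
    unfolding ab(2)[symmetric] by auto
  have "insert x (\<sigma> - \<tau>) \<subseteq> {v. v \<notin> \<tau> \<and> insert v \<tau> \<in> \<Delta>}"
  proof
    fix v assume "v \<in> insert x (\<sigma> - \<tau>)"
    then show "v \<in> {v. v \<notin> \<tau> \<and> insert v \<tau> \<in> \<Delta>}"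
      using down[OF x(3), of "insert v \<tau>"] down[OF \<sigma>(1), of "insert v \<tau>"] x w \<sigma>(2) by auto
  qed
  moreover have "{v. v \<notin> \<tau> \<and> insert v \<tau> \<in> \<Delta>} \<subseteq> {1..n}" using faces by auto
  then have "finite {v. v \<notin> \<tau> \<and> insert v \<tau> \<in> \<Delta>}" by (rule finite_subset) simp
  ultimately have "card (insert x (\<sigma> - \<tau>)) \<le> card {v. v \<notin> \<tau> \<and> insert v \<tau> \<in> \<Delta>}"
    by (intro card_mono)
  moreover have "card (insert x (\<sigma> - \<tau>)) = D + 1 - card \<tau>"
    using x(2) \<sigma> \<tau>(2) finite_face[OF \<sigma>(1)] finite_face[OF \<tau>(1)] by (simp add: card_Diff_subset)
  ultimately show ?thesis by simp
qed

text \<open>Counting incidences: each facet has \<open>D \<ge> 2\<close> ridges and each ridge lies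
  in 2 facets. This becomes condition (iv) for \<open>a = 2\<close> and
  \<open>t = D\<close>.\<close>

lemma card_facets_le_ridges: "card {\<sigma> \<in> \<Delta>. card \<sigma> = D} \<le> card {F \<in> \<Delta>. Suc (card F) = D}"
proof -
  let ?S = "{\<sigma> \<in> \<Delta>. card \<sigma> = D}" and ?R = "{F \<in> \<Delta>. Suc (card F) = D}"
  have fin: "finite ?S" "finite ?R" using finite_complex by auto
  have 1: "card {F \<in> ?R. F \<subseteq> \<sigma>} = D" if \<sigma>: "\<sigma> \<in> ?S" for \<sigma>
  proof -
    have f: "finite \<sigma>" using \<sigma> finite_face by blast
    have "{F \<in> ?R. F \<subseteq> \<sigma>} = (\<lambda>v. \<sigma> - {v}) ` \<sigma>"
    proof (intro equalityI subsetI)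
      fix F assume "F \<in> {F \<in> ?R. F \<subseteq> \<sigma>}"
      then have F: "Suc (card F) = card \<sigma>" "F \<subseteq> \<sigma>" using \<sigma> by auto
      then have "card (\<sigma> - F) = 1" using f by (simp add: card_Diff_subset finite_subset)
      then obtain v where "\<sigma> - F = {v}" by (auto simp: card_1_singleton_iff)
      then show "F \<in> (\<lambda>v. \<sigma> - {v}) ` \<sigma>" using F(2) by blast
    next
      fix F assume "F \<in> (\<lambda>v. \<sigma> - {v}) ` \<sigma>"
      then show "F \<in> {F \<in> ?R. F \<subseteq> \<sigma>}"
        using \<sigma> down[of \<sigma> F] f by (auto simp: card_Suc_Diff1 simp del: card_Diff_insert)
    qed
    moreover have "inj_on (\<lambda>v. \<sigma> - {v}) \<sigma>" by (auto simp: inj_on_def)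
    ultimately show ?thesis using \<sigma> by (simp add: card_image)
  qed
  have 2: "card {\<sigma> \<in> ?S. F \<subseteq> \<sigma>} = 2" if F: "F \<in> ?R" for F
  proof -
    have f: "finite F" using F finite_face by blast
    obtain a b where ab: "a \<noteq> b" "{x. x \<notin> F \<and> insert x F \<in> \<Delta>} = {a, b}"
      using ridge_in_two_facets[of F] F by blast
    have "{\<sigma> \<in> ?S. F \<subseteq> \<sigma>} = (\<lambda>x. insert x F) ` {a, b}"
      unfolding ab(2)[symmetric]
    proof (intro equalityI subsetI)
      fix \<sigma> assume "\<sigma> \<in> {\<sigma> \<in> ?S. F \<subseteq> \<sigma>}"
      then have \<sigma>: "\<sigma> \<in> \<Delta>" "card \<sigma> = Suc (card F)" "F \<subseteq> \<sigma>" using F by auto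
      then have "card (\<sigma> - F) = 1" using f by (simp add: card_Diff_subset)
      then obtain v where "\<sigma> - F = {v}" by (auto simp: card_1_singleton_iff)
      then have "\<sigma> = insert v F" "v \<notin> F" using \<sigma>(3) by blast+
      then show "\<sigma> \<in> (\<lambda>x. insert x F) ` {x. x \<notin> F \<and> insert x F \<in> \<Delta>}" using \<sigma>(1) by blast
    next
      fix \<sigma> assume "\<sigma> \<in> (\<lambda>x. insert x F) ` {x. x \<notin> F \<and> insert x F \<in> \<Delta>}"
      then show "\<sigma> \<in> {\<sigma> \<in> ?S. F \<subseteq> \<sigma>}" using F f by auto
    qed
    moreover have "inj_on (\<lambda>x. insert x F) {a, b}"
      unfolding ab(2)[symmetric] by (auto simp: inj_on_def)
    ultimately show ?thesis using ab(1) by (simp add: card_image)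
  qed
  have "D * card ?S = (\<Sum>\<sigma>\<in>?S. card {F \<in> ?R. F \<subseteq> \<sigma>})"
    using 1 by simp
  also have "\<dots> = (\<Sum>F\<in>?R. card {\<sigma> \<in> ?S. F \<subseteq> \<sigma>})"
    using sum_multicount_gen[OF fin, of "\<lambda>\<sigma> F. F \<subseteq> \<sigma>" "\<lambda>F. card {\<sigma> \<in> ?S. F \<subseteq> \<sigma>}"] by simp
  also have "\<dots> = 2 * card ?R"
    using 2 by simp
  finally have "2 * card ?S \<le> 2 * card ?R"
    using mult_le_mono1[OF D_ge, of "card ?S"] by simp
  then show ?thesis by simp
qed

end

lemma punctured_acyclic_sphere:
  assumes d: "0 < d" and \<Delta>: "complex_on n \<Delta>"
    and sph: "realization n \<Delta> homeomorphic_space nsphere d"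
  shows "punctured_acyclic n \<Delta>"
proof
  show faces: "\<Delta> \<subseteq> Pow {1..n}" using \<Delta> by (simp add: complex_on_def)
  show down: "\<rho> \<in> \<Delta>" if "\<tau> \<in> \<Delta>" "\<rho> \<subseteq> \<tau>" for \<tau> \<rho>
    using \<Delta> that unfolding complex_on_def by blast
  have inf: "infinite (topspace (realization n \<Delta>))"
    by (rule realization_nsphere_infinite[OF d sph])
  show edge: "\<exists>\<sigma>\<in>\<Delta>. 2 \<le> card \<sigma>"
  proof (rule ccontr)
    assume small: "\<not> (\<exists>\<sigma>\<in>\<Delta>. 2 \<le> card \<sigma>)"
    have "topspace (realization n \<Delta>) \<subseteq> basis_vec ` {1..n}"
    proof
      fix x assume "x \<in> topspace (realization n \<Delta>)"
      then have x: "{i. x i \<noteq> 0} \<in> \<Delta>" "(\<Sum>i\<in>{1..n}. x i) = 1"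
        by (auto simp: topspace_realization)
      note v = dominant[OF x(2)]
      let ?v = "dominant n x"
      have "card {i. x i \<noteq> 0} \<le> 1" using small x(1) by force
      moreover have "finite {i. x i \<noteq> 0}" using x(1) faces finite_subset by blast
      moreover have "?v \<in> {i. x i \<noteq> 0}" using v(3) by simp
      ultimately have z: "x i = 0" if "i \<noteq> ?v" for i
        using that by (metis (mono_tags, lifting) card_le_Suc0_iff_eq mem_Collect_eq One_nat_def)
      have "(\<Sum>i\<in>{1..n}. x i) = (\<Sum>i\<in>{?v}. x i)"
        by (rule sum.mono_neutral_right) (use v(1) z in auto)
      then have "x = basis_vec ?v" using x(2) z by auto
      then show "x \<in> basis_vec ` {1..n}" using v(1) by blast
    qed
    then show False using inf finite_subset by blast
  qed
  show "acyclic_complex (deletion \<Delta> \<sigma>)" if \<sigma>: "\<sigma> \<in> \<Delta>" "\<sigma> \<noteq> {}" for \<sigma>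
  proof -
    \<comment> \<open>The deletion has no vertex only if \<open>\<sigma>\<close> is a single vertex
      and the complex has no other, which \<open>edge\<close> excludes.\<close>
    have "\<exists>v. {v} \<in> deletion \<Delta> \<sigma>"
    proof (rule ccontr)
      assume none: "\<nexists>v. {v} \<in> deletion \<Delta> \<sigma>"
      have sing: "{v} \<in> \<Delta>" if "v \<in> \<tau>" "\<tau> \<in> \<Delta>" for v \<tau>
        using down[OF that(2), of "{v}"] that(1) by simp
      obtain w where w: "w \<in> \<sigma>" using \<sigma>(2) by blast
      have *: "v \<in> \<sigma> \<and> \<sigma> = {v}" if "v \<in> \<tau>" "\<tau> \<in> \<Delta>" for v \<tau>
        using none sing[OF that] \<sigma>(2) by (auto simp: deletion_def)
      obtain \<tau> where \<tau>: "\<tau> \<in> \<Delta>" "2 \<le> card \<tau>" using edge by blast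
      have "\<tau> \<subseteq> {w}" using *[OF _ \<tau>(1)] w by blast
      then have "card \<tau> \<le> 1" using card_mono[of "{w}" \<tau>] by simp
      then show False using \<tau>(2) by simp
    qed
    then obtain v where v: "{v} \<in> deletion \<Delta> \<sigma>" by blast
    show ?thesis
      by (rule contractible_imp_acyclic_complex[OF _ _ v contractible_deletion[OF faces down \<sigma> sph]])
        (use faces down in \<open>auto simp: deletion_def\<close>)
  qed
qed

section \<open>The polynomial ring\<close>

lemma carrier_mpoly_ring: "p \<in> carrier (mpoly_ring n) \<longleftrightarrow> (\<forall>m\<in>keys p. keys m \<subseteq> {1..n})"
  by (simp add: mpoly_ring_def)

lemma mpoly_ring_simps [simp]:
  "x \<otimes>\<^bsub>mpoly_ring n\<^esub> y = x * y" "x \<oplus>\<^bsub>mpoly_ring n\<^esub> y = x + y" "\<zero>\<^bsub>mpoly_ring n\<^esub> = 0" "\<one>\<^bsub>mpoly_ring n\<^esub> = 1"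
  by (simp_all add: mpoly_ring_def)

lemma mpoly_ring_ring: "ring (mpoly_ring n :: ('k::field) mpoly ring)"
  using mpoly_ring_cring cring.axioms(1) by blast

lemma mpoly_carrier_closed:
  assumes "p \<in> carrier (mpoly_ring n :: ('k::field) mpoly ring)" "q \<in> carrier (mpoly_ring n)"
  shows "p + q \<in> carrier (mpoly_ring n)" "p * q \<in> carrier (mpoly_ring n)"
  using ring.ring_simprules(1,5)[OF mpoly_ring_ring[of n]] assms by simp_all

lemma mpoly_carrier_simps [simp]:
  "0 \<in> carrier (mpoly_ring n :: ('k::field) mpoly ring)" "1 \<in> carrier (mpoly_ring n :: ('k::field) mpoly ring)"
  by (simp_all add: carrier_mpoly_ring)

lemma single_carrier:
  "keys m \<subseteq> {1..n} \<Longrightarrow> single m c \<in> carrier (mpoly_ring n)"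
  by (auto simp: carrier_mpoly_ring split: if_splits)

lemma mvar_carrier: "v \<in> {1..n} \<Longrightarrow> mvar v \<in> carrier (mpoly_ring n)"
  unfolding mvar_def by (rule single_carrier) simp

lemma mpoly_carrier_sum:
  "(\<And>i. i \<in> A \<Longrightarrow> f i \<in> carrier (mpoly_ring n)) \<Longrightarrow> sum f A \<in> carrier (mpoly_ring n :: ('k::field) mpoly ring)"
  by (induction A rule: infinite_finite_induct) (auto intro: mpoly_carrier_closed)

lemma mpoly_ideal_closed:
  assumes "ideal J (mpoly_ring n :: ('k::field) mpoly ring)"
  shows "p \<in> J \<Longrightarrow> q \<in> J \<Longrightarrow> p + q \<in> J" "p \<in> J \<Longrightarrow> q \<in> carrier (mpoly_ring n) \<Longrightarrow> q * p \<in> J" "0 \<in> J"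
  using additive_subgroup.a_closed[OF ideal.axioms(1)[OF assms]] ideal.I_l_closed[OF assms]
    additive_subgroup.zero_closed[OF ideal.axioms(1)[OF assms]] by simp_all

lemma mpoly_ideal_sum:
  assumes "ideal J (mpoly_ring n :: ('k::field) mpoly ring)"
  shows "(\<And>i. i \<in> A \<Longrightarrow> f i \<in> J) \<Longrightarrow> sum f A \<in> J"
  by (induction A rule: infinite_finite_induct) (auto intro: mpoly_ideal_closed[OF assms])

lemma mpoly_expand: "p = (\<Sum>m\<in>keys p. single m (lookup p m))"
  by (rule poly_mapping_eqI) (simp add: lookup_sum lookup_single when_def in_keys_iff)

lemma mpoly_expand_superset:
  assumes "finite A" "keys p \<subseteq> A"
  shows "p = (\<Sum>m\<in>A. single m (lookup p m))"
proof -
  have "p = (\<Sum>m\<in>keys p. single m (lookup p m))"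
    by (rule mpoly_expand)
  also have "\<dots> = (\<Sum>m\<in>A. single m (lookup p m))"
    by (rule sum.mono_neutral_left) (use assms in \<open>auto simp: in_keys_iff\<close>)
  finally show ?thesis .
qed

subsection \<open>Linear functionals and membership in ideals\<close>

definition functional :: "((nat \<Rightarrow>\<^sub>0 nat) \<Rightarrow> 'k) \<Rightarrow> ('k::field) mpoly \<Rightarrow> 'k" where
  "functional w p = (\<Sum>m\<in>keys p. lookup p m * w m)"

lemma functional_superset:
  assumes "finite A" "keys p \<subseteq> A"
  shows "functional w p = (\<Sum>m\<in>A. lookup p m * w m)"
  unfolding functional_def by (rule sum.mono_neutral_left) (use assms in \<open>auto simp: in_keys_iff\<close>)

lemma functional_0 [simp]: "functional w 0 = 0"
  by (simp add: functional_def)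

lemma functional_single [simp]: "functional w (single m c) = c * w m"
  by (simp add: functional_def)

lemma functional_add: "functional w (p + q) = functional w p + functional w q"
proof -
  let ?A = "keys p \<union> keys q"
  have "functional w (p + q) = (\<Sum>m\<in>?A. lookup (p + q) m * w m)"
    by (rule functional_superset) (use Poly_Mapping.keys_add[of p q] in auto)
  also have "\<dots> = (\<Sum>m\<in>?A. lookup p m * w m) + (\<Sum>m\<in>?A. lookup q m * w m)"
    by (simp add: lookup_add distrib_right sum.distrib)
  also have "\<dots> = functional w p + functional w q"
    by (simp flip: functional_superset)
  finally show ?thesis .
qed

lemma functional_sum: "functional w (sum f A) = (\<Sum>i\<in>A. functional w (f i))"
  by (induction A rule: infinite_finite_induct) (simp_all add: functional_add)

text \<open>The largest ideal inside the kernel of a linear functional is found by testing against monomials.\<close>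

lemma functional_ideal:
  fixes w :: "(nat \<Rightarrow>\<^sub>0 nat) \<Rightarrow> 'k::field"
  assumes G: "G \<subseteq> carrier (mpoly_ring n)"
    and zero: "\<And>g m c. g \<in> G \<Longrightarrow> functional w (single m c * g) = 0"
    and p: "p \<in> Idl\<^bsub>mpoly_ring n\<^esub> G"
  shows "functional w p = 0"
proof -
  interpret cring "mpoly_ring n :: 'k mpoly ring" by (rule mpoly_ring_cring)
  define I where "I = {p \<in> carrier (mpoly_ring n). \<forall>q. functional w (q * p) = 0}"
  have "ideal I (mpoly_ring n)"
  proof (rule idealI[OF ring_axioms])
    show "subgroup I (add_monoid (mpoly_ring n))"
    proof (rule add.subgroupI)
      show "I \<subseteq> carrier (mpoly_ring n)" by (auto simp: I_def)
      have "0 \<in> I" by (simp add: I_def)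
      then show "I \<noteq> {}" by blast
      fix a assume a: "a \<in> I"
      have "\<ominus>\<^bsub>mpoly_ring n\<^esub> a = - a"
        by (rule minus_equality) (use a in \<open>auto simp: I_def carrier_mpoly_ring\<close>)
      moreover have "- a \<in> I"
      proof -
        have "functional w (q * (- a)) = 0" for q
        proof -
          have "functional w (q * (- a)) + functional w (q * a) = 0"
            by (simp flip: functional_add)
          then show ?thesis using a by (simp add: I_def)
        qed
        then show ?thesis using a by (auto simp: I_def carrier_mpoly_ring)
      qed
      ultimately show "\<ominus>\<^bsub>mpoly_ring n\<^esub> a \<in> I" by simp
      fix b assume "b \<in> I"
      with a show "a \<oplus>\<^bsub>mpoly_ring n\<^esub> b \<in> I"
        by (auto simp: I_def distrib_left functional_add intro: mpoly_carrier_closed)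
    qed
    fix a x assume a: "a \<in> I" and x: "x \<in> carrier (mpoly_ring n :: 'k mpoly ring)"
    then show "x \<otimes>\<^bsub>mpoly_ring n\<^esub> a \<in> I"
      by (auto simp: I_def mult.assoc[symmetric] intro: mpoly_carrier_closed)
    then show "a \<otimes>\<^bsub>mpoly_ring n\<^esub> x \<in> I"
      by (simp add: mult.commute)
  qed
  moreover have "G \<subseteq> I"
  proof
    fix g assume g: "g \<in> G"
    have "functional w (q * g) = 0" for q
    proof -
      have "q * g = (\<Sum>m\<in>keys q. single m (lookup q m) * g)"
        by (subst mpoly_expand[of q]) (simp add: sum_distrib_right)
      then show ?thesis by (simp add: functional_sum zero[OF g])
    qed
    then show "g \<in> I" using g G by (auto simp: I_def)
  qed
  ultimately have "Idl\<^bsub>mpoly_ring n\<^esub> G \<subseteq> I" by (rule genideal_minimal)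
  then have "functional w (1 * p) = 0" using p by (auto simp: I_def simp del: mult_1)
  then show ?thesis by simp
qed

subsection \<open>Monomials and generators\<close>

abbreviation expo :: "nat \<Rightarrow> nat \<Rightarrow>\<^sub>0 nat" where "expo v \<equiv> single v 1"

definition face_expo :: "nat set \<Rightarrow> nat \<Rightarrow>\<^sub>0 nat" where "face_expo \<sigma> = (\<Sum>i\<in>\<sigma>. expo i)"

lemma lookup_face_expo: "finite \<sigma> \<Longrightarrow> lookup (face_expo \<sigma>) j = (if j \<in> \<sigma> then 1 else 0)"
  by (simp add: face_expo_def lookup_sum lookup_single when_def)

lemma keys_face_expo: "finite \<sigma> \<Longrightarrow> keys (face_expo \<sigma>) = \<sigma>"
  unfolding set_eq_iff in_keys_iff by (simp add: lookup_face_expo)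

lemma prod_mvar: "finite \<sigma> \<Longrightarrow> (\<Prod>i\<in>\<sigma>. mvar i) = single (face_expo \<sigma>) (1 :: 'k::field)"
  by (induction \<sigma> rule: finite_induct) (simp_all add: face_expo_def mvar_def mult_single)

lemma mvar_power: "mvar i ^ a = single (single i a) (1 :: 'k::field)"
  by (induction a) (simp_all add: mvar_def mult_single flip: single_add)

lemma keys_add_nat: "keys (a + b :: nat \<Rightarrow>\<^sub>0 nat) = keys a \<union> keys b"
  by (auto simp: in_keys_iff lookup_add)

lemma mon_degree_superset:
  assumes "finite A" "keys m \<subseteq> A"
  shows "mon_degree m = (\<Sum>i\<in>A. lookup m i)"
  unfolding mon_degree_def by (rule sum.mono_neutral_left) (use assms in \<open>auto simp: in_keys_iff\<close>)

lemma mon_degree_add: "mon_degree (a + b) = mon_degree a + mon_degree b"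
proof -
  let ?A = "keys a \<union> keys b"
  have "mon_degree (a + b) = (\<Sum>i\<in>?A. lookup (a + b) i)"
    by (rule mon_degree_superset) (simp_all add: keys_add_nat)
  also have "\<dots> = mon_degree a + mon_degree b"
    using mon_degree_superset[of ?A a] mon_degree_superset[of ?A b] by (simp add: lookup_add sum.distrib)
  finally show ?thesis .
qed

lemma mon_degree_single [simp]: "mon_degree (single v k) = k"
  by (cases "k = 0") (simp_all add: mon_degree_def)

lemma mon_degree_face_expo: "finite \<sigma> \<Longrightarrow> mon_degree (face_expo \<sigma>) = card \<sigma>"
  by (simp add: mon_degree_def keys_face_expo lookup_face_expo)

lemma mon_degree_1: "mon_degree m = 1 \<Longrightarrow> \<exists>v. m = expo v"
proof -
  assume d: "mon_degree m = 1"
  then have "keys m \<noteq> {}" by (auto simp: mon_degree_def)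
  then obtain v where v: "v \<in> keys m" by blast
  have "(\<Sum>i\<in>keys m. lookup m i) =
      lookup m v + (\<Sum>i\<in>keys m - {v}. lookup m i)"
    using v by (simp add: sum.remove)
  moreover have "lookup m v \<noteq> 0" using v by (simp add: in_keys_iff)
  ultimately have 1: "lookup m v = 1" "(\<Sum>i\<in>keys m - {v}. lookup m i) = 0"
    using d unfolding mon_degree_def by linarith+
  then have "\<forall>i\<in>keys m - {v}. lookup m i = 0"
    by (simp add: sum_eq_0_iff)
  then have "lookup m i = (if i = v then 1 else 0)" for i
  proof (cases "i \<in> keys m - {v}")
    case True
    with \<open>\<forall>i\<in>keys m - {v}. lookup m i = 0\<close> show ?thesis by auto
  next
    case False
    then show ?thesis using 1(1) by (cases "i = v") (simp_all add: in_keys_iff)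
  qed
  then have "m = expo v"
    by (intro poly_mapping_eqI) (auto simp: lookup_single when_def)
  then show ?thesis by blast
qed

definition SR_gens :: "nat \<Rightarrow> nat set set \<Rightarrow> ('k::field) mpoly set" where
  "SR_gens n \<Delta> = {single (face_expo \<sigma>) 1 | \<sigma>. \<sigma> \<subseteq> {1..n} \<and> \<sigma> \<notin> \<Delta>}"

lemma SR_gens_carrier: "(SR_gens n \<Delta> :: ('k::field) mpoly set) \<subseteq> carrier (mpoly_ring n)"
proof
  fix p :: "'k mpoly" assume "p \<in> SR_gens n \<Delta>"
  then obtain \<sigma> where \<sigma>: "p = single (face_expo \<sigma>) 1" "\<sigma> \<subseteq> {1..n}"
    by (auto simp: SR_gens_def)
  then have "keys (face_expo \<sigma>) \<subseteq> {1..n}"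
    using keys_face_expo[OF finite_subset[OF \<sigma>(2)]] by simp
  then show "p \<in> carrier (mpoly_ring n)"
    unfolding \<sigma>(1) by (rule single_carrier)
qed

text \<open>One generating set for the sum of the two ideals, so that membership can be tested on
  generators.\<close>

lemma SR_ideal_plus_eq:
  fixes S :: "('k::field) mpoly set"
  assumes S: "S \<subseteq> carrier (mpoly_ring n)"
  shows "SR_ideal_plus n \<Delta> S = Idl\<^bsub>mpoly_ring n\<^esub> (SR_gens n \<Delta> \<union> S)"
proof -
  interpret cring "mpoly_ring n :: 'k mpoly ring" by (rule mpoly_ring_cring)
  note G = SR_gens_carrier[of n \<Delta>, where 'k = 'k]
  have "{\<Prod>i\<in>\<sigma>. mvar i |\<sigma>. \<sigma> \<subseteq> {1..n} \<and> \<sigma> \<notin> \<Delta>} = (SR_gens n \<Delta> :: 'k mpoly set)"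
    unfolding SR_gens_def by (metis (no_types, lifting) prod_mvar finite_atLeastAtMost finite_subset)
  then have "SR_ideal n \<Delta> = (Idl\<^bsub>mpoly_ring n\<^esub> (SR_gens n \<Delta>) :: 'k mpoly set)"
    by (simp add: SR_ideal_def)
  then have "SR_ideal_plus n \<Delta> S = Idl\<^bsub>mpoly_ring n\<^esub> (Idl\<^bsub>mpoly_ring n\<^esub> (SR_gens n \<Delta>) \<union> Idl\<^bsub>mpoly_ring n\<^esub> S)"
    unfolding SR_ideal_plus_def using union_genideal[OF genideal_ideal[OF G] genideal_ideal[OF S]] by simp
  also have "\<dots> = Idl\<^bsub>mpoly_ring n\<^esub> (SR_gens n \<Delta> \<union> S)"
  proof (rule antisym)
    have U: "ideal (Idl\<^bsub>mpoly_ring n\<^esub> (SR_gens n \<Delta> \<union> S)) (mpoly_ring n)"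
      using G S by (intro genideal_ideal) auto
    have sub: "SR_gens n \<Delta> \<union> S \<subseteq> Idl\<^bsub>mpoly_ring n\<^esub> (SR_gens n \<Delta> \<union> S)"
      using G S by (intro genideal_self) auto
    show "Idl\<^bsub>mpoly_ring n\<^esub> (Idl\<^bsub>mpoly_ring n\<^esub> (SR_gens n \<Delta>) \<union> Idl\<^bsub>mpoly_ring n\<^esub> S) \<subseteq> Idl\<^bsub>mpoly_ring n\<^esub> (SR_gens n \<Delta> \<union> S)"
      using sub by (intro genideal_minimal[OF U] Un_least) auto
    have C: "Idl\<^bsub>mpoly_ring n\<^esub> (SR_gens n \<Delta>) \<union> Idl\<^bsub>mpoly_ring n\<^esub> S \<subseteq> carrier (mpoly_ring n)"
      using ideal.Icarr[OF genideal_ideal[OF G]] ideal.Icarr[OF genideal_ideal[OF S]] by blast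
    show "Idl\<^bsub>mpoly_ring n\<^esub> (SR_gens n \<Delta> \<union> S) \<subseteq> Idl\<^bsub>mpoly_ring n\<^esub> (Idl\<^bsub>mpoly_ring n\<^esub> (SR_gens n \<Delta>) \<union> Idl\<^bsub>mpoly_ring n\<^esub> S)"
      using genideal_self[OF G] genideal_self[OF S] genideal_self[OF C]
      by (intro genideal_minimal[OF genideal_ideal[OF C]]) blast
  qed
  finally show ?thesis .
qed

lemma SR_ideal_plus_ideal:
  fixes S :: "('k::field) mpoly set"
  assumes S: "S \<subseteq> carrier (mpoly_ring n)"
  shows "ideal (SR_ideal_plus n \<Delta> S) (mpoly_ring n)" "S \<subseteq> SR_ideal_plus n \<Delta> S" "SR_gens n \<Delta> \<subseteq> SR_ideal_plus n \<Delta> S"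
proof -
  interpret cring "mpoly_ring n :: 'k mpoly ring" by (rule mpoly_ring_cring)
  have U: "SR_gens n \<Delta> \<union> S \<subseteq> carrier (mpoly_ring n)"
    using SR_gens_carrier S by blast
  show "ideal (SR_ideal_plus n \<Delta> S) (mpoly_ring n)"
    unfolding SR_ideal_plus_eq[OF S] by (rule genideal_ideal[OF U])
  show "S \<subseteq> SR_ideal_plus n \<Delta> S" "SR_gens n \<Delta> \<subseteq> SR_ideal_plus n \<Delta> S"
    unfolding SR_ideal_plus_eq[OF S] using genideal_self[OF U] by auto
qed

lemma SR_ideal_plus_subset:
  fixes S :: "('k::field) mpoly set"
  assumes S: "S \<subseteq> carrier (mpoly_ring n)" and T: "T \<subseteq> carrier (mpoly_ring n)"
    and sub: "S \<subseteq> SR_ideal_plus n \<Delta> T"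
  shows "SR_ideal_plus n \<Delta> S \<subseteq> SR_ideal_plus n \<Delta> T"
proof -
  interpret cring "mpoly_ring n :: 'k mpoly ring" by (rule mpoly_ring_cring)
  show ?thesis
    unfolding SR_ideal_plus_eq[OF S] using SR_ideal_plus_ideal[OF T] sub
    by (intro genideal_minimal) auto
qed

text \<open>The nonface generators are monomials, so killing them means that \<open>w\<close>
  vanishes on every exponent vector above a nonface. It is applied to coefficient extraction, to
  evaluation at a point, and to functionals supported in degree 1 or 2.\<close>

lemma SR_functional:
  fixes w :: "(nat \<Rightarrow>\<^sub>0 nat) \<Rightarrow> 'k::field"
  assumes S: "S \<subseteq> carrier (mpoly_ring n)"
    and nonface: "\<And>\<sigma> m. \<sigma> \<subseteq> {1..n} \<Longrightarrow> \<sigma> \<notin> \<Delta> \<Longrightarrow> w (m + face_expo \<sigma>) = 0"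
    and zero: "\<And>g m c. g \<in> S \<Longrightarrow> functional w (single m c * g) = 0"
    and p: "p \<in> SR_ideal_plus n \<Delta> S"
  shows "functional w p = 0"
proof (rule functional_ideal[OF _ _ p[unfolded SR_ideal_plus_eq[OF S]]])
  show "SR_gens n \<Delta> \<union> S \<subseteq> carrier (mpoly_ring n)"
    using SR_gens_carrier S by blast
  fix g m c assume "g \<in> SR_gens n \<Delta> \<union> S"
  then show "functional w (single m c * g) = 0"
    using zero nonface by (auto simp: SR_gens_def mult_single)
qed

lemma single_mem_ideal:
  assumes J: "ideal J (mpoly_ring n :: ('k::field) mpoly ring)"
    and "single g 1 \<in> J" "keys m \<subseteq> {1..n}" "\<And>i. lookup g i \<le> lookup m i"
  shows "single m c \<in> J"
proof -
  have m: "m = (m - g) + g"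
    by (rule poly_mapping_eqI) (simp add: lookup_add lookup_minus assms(4))
  then have "keys (m - g) \<subseteq> {1..n}"
    using assms(3) keys_add_nat[of "m - g" g] by simp
  then have "single (m - g) c * single g 1 \<in> J"
    by (intro mpoly_ideal_closed(2)[OF J] assms(2) single_carrier)
  then show ?thesis using m by (simp add: mult_single)
qed

lemma nonface_mem_ideal:
  assumes J: "ideal J (mpoly_ring n :: ('k::field) mpoly ring)" and "SR_gens n \<Delta> \<subseteq> J"
    and m: "keys m \<subseteq> {1..n}" "keys m \<notin> \<Delta>"
  shows "single m c \<in> J"
proof (rule single_mem_ideal[OF J _ m(1)])
  show "single (face_expo (keys m)) 1 \<in> J"
    using assms(2) m by (auto simp: SR_gens_def)
  show "lookup (face_expo (keys m)) i \<le> lookup m i" for i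
    by (auto simp: lookup_face_expo in_keys_iff)
qed

lemma zip_sum_carrier:
  assumes "\<And>m. m \<in> set ms \<Longrightarrow> keys m \<subseteq> {1..n}"
  shows "(\<Sum>(c, m)\<leftarrow>zip cs ms. single m c) \<in> carrier (mpoly_ring n :: ('k::field) mpoly ring)"
  using assms
proof (induction cs ms rule: list_induct2')
  case (4 c cs m ms)
  have "single m c \<in> carrier (mpoly_ring n)"
    using 4(2)[of m] by (intro single_carrier) simp
  moreover have "(\<Sum>(c, m)\<leftarrow>zip cs ms. single m c) \<in> carrier (mpoly_ring n)"
    using 4(2) by (intro 4(1)) auto
  ultimately show ?case by (simp add: mpoly_carrier_closed)
qed simp_all

subsection \<open>Dimensions of quotients spanned by monomials\<close>

lemma constants_subfield: "subfield (range mconst) (mpoly_ring n :: ('k::field) mpoly ring)"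
proof -
  interpret cring "mpoly_ring n :: 'k mpoly ring" by (rule mpoly_ring_cring)
  let ?C = "range mconst :: 'k mpoly set"
  have car: "?C \<subseteq> carrier (mpoly_ring n)"
    by (auto simp: mconst_def intro!: single_carrier)
  have mult: "mconst a * mconst b = mconst (a * b)" and add: "mconst a + mconst b = mconst (a + b)"
    and one: "mconst 1 = 1" and zero: "mconst 0 = 0" for a b :: 'k
    by (simp_all add: mconst_def mult_single single_add)
  have inj: "mconst a = mconst b \<longleftrightarrow> a = b" for a b :: 'k
    by (metis mconst_def lookup_single_eq)
  have neg: "\<ominus>\<^bsub>mpoly_ring n\<^esub> mconst a = mconst (- a)" for a :: 'k
    by (rule minus_equality) (use car in \<open>auto simp: add zero\<close>)
  show ?thesis
  proof (rule subfieldI)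
    have "subring ?C (mpoly_ring n)"
    proof (rule subringI)
      show "\<one>\<^bsub>mpoly_ring n\<^esub> \<in> ?C" using one by (metis mpoly_ring_simps(4) rangeI)
    qed (use car in \<open>auto simp: mult add neg\<close>)
    then show "subcring ?C (mpoly_ring n)"
      by (rule subcringI) (simp add: mult.commute)
    show "Units (mpoly_ring n\<lparr>carrier := ?C\<rparr>) = ?C - {\<zero>\<^bsub>mpoly_ring n\<^esub>}"
    proof (intro equalityI subsetI)
      fix x assume "x \<in> Units (mpoly_ring n\<lparr>carrier := ?C\<rparr>)"
      then obtain y where "x \<in> ?C" "y * x = 1" by (auto simp: Units_def)
      then show "x \<in> ?C - {\<zero>\<^bsub>mpoly_ring n\<^esub>}" by auto
    next
      fix x assume "x \<in> ?C - {\<zero>\<^bsub>mpoly_ring n\<^esub>}"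
      then obtain a where a: "x = mconst a" "a \<noteq> 0" using zero by auto
      then have "mconst (inverse a) * x = 1" "x * mconst (inverse a) = 1"
        by (simp_all add: mult one)
      then show "x \<in> Units (mpoly_ring n\<lparr>carrier := ?C\<rparr>)"
        using a(1) by (auto simp: Units_def)
    qed
  qed
qed

context
  fixes n :: nat and J :: "('k::field) mpoly set"
  assumes J: "ideal J (mpoly_ring n)" and proper: "1 \<notin> J"
begin

private abbreviation "R \<equiv> mpoly_ring n :: 'k mpoly ring"
private abbreviation "coset p \<equiv> J +>\<^bsub>R\<^esub> p"

lemma quot_hom: "ring_hom_ring R (R Quot J) (\<lambda>p. coset p)"
  using ideal.rcos_ring_hom_ring[OF J] .

lemma coset_zero_iff: "p \<in> carrier R \<Longrightarrow> coset p = \<zero>\<^bsub>R Quot J\<^esub> \<longleftrightarrow> p \<in> J"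
proof -
  assume p: "p \<in> carrier R"
  interpret ring R by (rule mpoly_ring_ring)
  have z: "\<zero>\<^bsub>R Quot J\<^esub> = J" by (simp add: FactRing_def)
  have as: "abelian_subgroup J R"
    using abelian_subgroupI3[OF ideal.axioms(1)[OF J] is_abelian_group] .
  show ?thesis
    unfolding z using a_rcos_zero[OF J] abelian_subgroup.a_rcos_self[OF as p] by blast
qed

lemma coset_add_ideal: "p \<in> carrier R \<Longrightarrow> r \<in> J \<Longrightarrow> coset (r + p) = coset p"
proof -
  assume p: "p \<in> carrier R" and r: "r \<in> J"
  interpret h: ring_hom_ring R "R Quot J" "\<lambda>p. coset p" by (rule quot_hom)
  have rc: "r \<in> carrier R" using ideal.Icarr[OF J r] .
  have "coset (r + p) = coset r \<oplus>\<^bsub>R Quot J\<^esub> coset p"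
    using h.hom_add[OF rc p] by simp
  also have "coset r = \<zero>\<^bsub>R Quot J\<^esub>" using coset_zero_iff[OF rc] r by simp
  finally show ?thesis using h.hom_closed[OF p] by simp
qed

text \<open>Properness enters here: the constants stay a field in the quotient only if 1 and 0
  differ there.\<close>

lemma quot_consts_subfield: "subfield (quot_consts n J) (R Quot J)"
proof -
  interpret h: ring_hom_ring R "R Quot J" "\<lambda>p. coset p" by (rule quot_hom)
  have "\<one>\<^bsub>R Quot J\<^esub> \<noteq> \<zero>\<^bsub>R Quot J\<^esub>"
    using coset_zero_iff[of 1] proper h.hom_one by simp
  from h.img_is_subfield(2)[OF constants_subfield this]
  show ?thesis by (simp add: quot_consts_def image_image)
qed

lemma combine_monomials:
  assumes "\<And>m. m \<in> set ms \<Longrightarrow> keys m \<subseteq> {1..n}"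
  shows "ring.combine (R Quot J) (map (\<lambda>c. coset (mconst c)) cs) (map (\<lambda>m. coset (single m 1)) ms) =
    coset (\<Sum>(c, m)\<leftarrow>zip cs ms. single m c)"
  using assms
proof (induction cs ms rule: list_induct2')
  case (4 c cs m ms)
  interpret h: ring_hom_ring R "R Quot J" "\<lambda>p. coset p" by (rule quot_hom)
  have m: "keys m \<subseteq> {1..n}" using 4 by simp
  have car: "(\<Sum>(c, m)\<leftarrow>zip cs ms. single m c) \<in> carrier R"
    using 4(2) by (intro zip_sum_carrier) auto
  have 1: "mconst c \<in> carrier R" "single m 1 \<in> carrier R" "single m c \<in> carrier R"
    using m by (auto simp: mconst_def intro!: single_carrier)
  have "coset (mconst c) \<otimes>\<^bsub>R Quot J\<^esub> coset (single m 1) = coset (single m c)"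
    using h.hom_mult[OF 1(1,2)] by (simp add: mconst_def mult_single)
  then show ?case
    using 4 h.hom_add[OF 1(3) car] by (simp add: h.S.combine.simps)
qed (use ring_hom_ring.homh[OF quot_hom] in \<open>simp_all add: ring.combine.simps[OF ring_hom_ring.axioms(2)[OF quot_hom]]
    ring_hom_zero[OF ring_hom_ring.homh[OF quot_hom] ring_hom_ring.axioms(1)[OF quot_hom] ring_hom_ring.axioms(2)[OF quot_hom], simplified]\<close>)


lemma quot_consts_list:
  assumes "set Ks \<subseteq> quot_consts n J"
  obtains cs where "Ks = map (\<lambda>c. coset (mconst c)) cs"
proof -
  have "\<forall>k\<in>set Ks. \<exists>c. k = coset (mconst c)"
    using assms by (auto simp: quot_consts_def)
  then show ?thesis using that unfolding ex_map_conv[symmetric] by blast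
qed

text \<open>Phrased for a set \<open>H\<close> of polynomials to serve both a graded piece and the
  whole ring; terms outside \<open>ms\<close> vanish modulo \<open>J\<close> one by one.\<close>

lemma coset_image_eq_Span:
  assumes ms: "\<And>m. m \<in> set ms \<Longrightarrow> keys m \<subseteq> {1..n}" "distinct ms"
    and H: "H \<subseteq> carrier R" "\<And>cs. (\<Sum>(c, m)\<leftarrow>zip cs ms. single m c) \<in> H"
    and rest: "\<And>p m. p \<in> H \<Longrightarrow> m \<in> keys p \<Longrightarrow> m \<notin> set ms \<Longrightarrow> single m (lookup p m) \<in> J"
  shows "(\<lambda>p. coset p) ` H = ring.Span (R Quot J) (quot_consts n J) (map (\<lambda>m. coset (single m 1)) ms)"
proof -
  interpret h: ring_hom_ring R "R Quot J" "\<lambda>p. coset p" by (rule quot_hom)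
  let ?Us = "map (\<lambda>m. coset (single m 1)) ms"
  have Us: "set ?Us \<subseteq> carrier (R Quot J)"
    unfolding set_map image_subset_iff by (intro ballI h.hom_closed single_carrier ms(1))
  note mem = h.S.Span_mem_iff_length_version[OF quot_consts_subfield Us]
  show ?thesis
  proof (intro equalityI subsetI)
    fix x assume "x \<in> (\<lambda>p. coset p) ` H"
    then obtain p where p: "p \<in> H" "x = coset p" by blast
    let ?q = "\<Sum>m\<in>set ms. single m (lookup p m)"
    let ?r = "\<Sum>m\<in>keys p - set ms. single m (lookup p m)"
    have "p = (\<Sum>m\<in>(keys p - set ms) \<union> set ms. single m (lookup p m))"
      by (rule mpoly_expand_superset) auto
    also have "\<dots> = ?r + ?q" by (rule sum.union_disjoint) auto
    finally have "p = ?r + ?q" .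
    moreover have "?r \<in> J" using rest[OF p(1)] by (intro mpoly_ideal_sum[OF J]) auto
    moreover have "?q \<in> carrier R" using ms(1) by (intro mpoly_carrier_sum single_carrier) auto
    ultimately have "x = coset ?q" using coset_add_ideal p(2) by metis
    also have "?q = (\<Sum>(c, m)\<leftarrow>zip (map (lookup p) ms) ms. single m c)"
      using ms(2) by (simp add: sum_list_distinct_conv_sum_set[symmetric] zip_map1 zip_same_conv_map o_def)
    also have "coset \<dots> = h.S.combine (map (\<lambda>c. coset (mconst c)) (map (lookup p) ms)) ?Us"
      by (rule combine_monomials[symmetric]) (use ms(1) in auto)
    finally show "x \<in> h.S.Span (quot_consts n J) ?Us"
      unfolding mem by (intro exI[of _ "map (\<lambda>c. coset (mconst c)) (map (lookup p) ms)"])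
        (auto simp: quot_consts_def)
  next
    fix x assume "x \<in> h.S.Span (quot_consts n J) ?Us"
    then obtain Ks where Ks: "set Ks \<subseteq> quot_consts n J" "x = h.S.combine Ks ?Us"
      unfolding mem by blast
    obtain cs where cs: "Ks = map (\<lambda>c. coset (mconst c)) cs"
      using quot_consts_list[OF Ks(1)] .
    have "x = coset (\<Sum>(c, m)\<leftarrow>zip cs ms. single m c)"
      unfolding Ks(2) cs using ms(1) by (rule combine_monomials)
    then show "x \<in> (\<lambda>p. coset p) ` H" using H(2) by blast
  qed
qed

text \<open>No element of \<open>J\<close> involves a monomial of \<open>ms\<close>, so the
  coefficients of a vanishing combination are read off directly.\<close>

lemma independent_monomials:
  assumes ms: "\<And>m. m \<in> set ms \<Longrightarrow> keys m \<subseteq> {1..n}" "distinct ms"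
    and indep: "\<And>p m. p \<in> J \<Longrightarrow> m \<in> set ms \<Longrightarrow> lookup p m = 0"
  shows "ring.independent (R Quot J) (quot_consts n J) (map (\<lambda>m. coset (single m 1)) ms)"
proof -
  interpret h: ring_hom_ring R "R Quot J" "\<lambda>p. coset p" by (rule quot_hom)
  let ?Us = "map (\<lambda>m. coset (single m 1)) ms"
  have Us: "set ?Us \<subseteq> carrier (R Quot J)"
    unfolding set_map image_subset_iff by (intro ballI h.hom_closed single_carrier ms(1))
  show ?thesis
  proof (rule h.S.trivial_combine_imp_independent[OF quot_consts_subfield Us])
    fix Ks assume Ks: "set Ks \<subseteq> quot_consts n J" "h.S.combine Ks ?Us = \<zero>\<^bsub>R Quot J\<^esub>"
    obtain cs where cs: "Ks = map (\<lambda>c. coset (mconst c)) cs"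
      using quot_consts_list[OF Ks(1)] .
    define q where "q = (\<Sum>(c, m)\<leftarrow>zip cs ms. single m c)"
    have "coset q = \<zero>\<^bsub>R Quot J\<^esub>"
      unfolding q_def Ks(2)[symmetric] cs using ms(1) by (rule combine_monomials[symmetric])
    moreover have "q \<in> carrier R"
      unfolding q_def using ms(1) by (rule zip_sum_carrier)
    ultimately have qJ: "q \<in> J" using coset_zero_iff by blast
    show "set (take (length ?Us) Ks) \<subseteq> {\<zero>\<^bsub>R Quot J\<^esub>}"
    proof
      fix k assume "k \<in> set (take (length ?Us) Ks)"
      then obtain j where j: "j < length ms" "j < length cs" "k = coset (mconst (cs ! j))"
        by (auto simp: cs in_set_conv_nth)
      have "lookup q (ms ! j) = (\<Sum>i = 0..<min (length cs) (length ms). if i = j then cs ! j else 0)"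
        unfolding q_def sum_list_sum_nth lookup_sum
      proof (intro sum.cong)
        fix i assume "i \<in> {0..<min (length cs) (length ms)}"
        then show "lookup (map (\<lambda>(c, m). single m c) (zip cs ms) ! i) (ms ! j) =
            (if i = j then cs ! j else 0)"
          using j ms(2) by (simp add: lookup_single when_def nth_eq_iff_index_eq)
      qed simp
      also have "\<dots> = cs ! j" using j by simp
      finally have "cs ! j = 0" using indep[OF qJ] j(1) by simp
      then show "k \<in> {\<zero>\<^bsub>R Quot J\<^esub>}"
        using j(3) coset_zero_iff[of 0] mpoly_ideal_closed(3)[OF J] by (simp add: mconst_def)
    qed
  qed
qed

lemma HF_eq_card:
  assumes M: "finite M" "\<And>m. m \<in> M \<Longrightarrow> keys m \<subseteq> {1..n}" "\<And>m. m \<in> M \<Longrightarrow> mon_degree m = t"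
    and rest: "\<And>m c. keys m \<subseteq> {1..n} \<Longrightarrow> mon_degree m = t \<Longrightarrow> m \<notin> M \<Longrightarrow> single m c \<in> J"
    and indep: "\<And>p m. p \<in> J \<Longrightarrow> m \<in> M \<Longrightarrow> lookup p m = 0"
  shows "HF n (int t) J = card M"
proof -
  interpret h: ring_hom_ring R "R Quot J" "\<lambda>p. coset p" by (rule quot_hom)
  obtain ms where ms: "set ms = M" "distinct ms"
    using finite_distinct_list[OF M(1)] by blast
  let ?Us = "map (\<lambda>m. coset (single m 1)) ms"
  have "(\<lambda>p. coset p) ` hom_component n (int t) = h.S.Span (quot_consts n J) ?Us"
  proof (rule coset_image_eq_Span)
    fix cs :: "'k list"
    show "(\<Sum>(c, m)\<leftarrow>zip cs ms. single m c) \<in> hom_component n (int t)"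
    proof -
      have "(\<Sum>(c, m)\<leftarrow>zip cs ms. single m c) \<in> carrier R"
        using M(2) ms(1) by (intro zip_sum_carrier) auto
      moreover have "keys (\<Sum>(c, m)\<leftarrow>zip cs ms'. single m c) \<subseteq> set ms'" for ms'
      proof (induction cs ms' rule: list_induct2')
        case (4 c cs m ms')
        then show ?case
          using Poly_Mapping.keys_add[of "single m c" "\<Sum>(c, m)\<leftarrow>zip cs ms'. single m c"]
          by (auto split: if_splits)
      qed simp_all
      ultimately show ?thesis
        using M(3) ms(1) by (fastforce simp: hom_component_def)
    qed
  next
    fix p :: "'k mpoly" and m assume "p \<in> hom_component n (int t)" "m \<in> keys p" "m \<notin> set ms"
    then show "single m (lookup p m) \<in> J"
      using ms(1) by (intro rest) (auto simp: hom_component_def carrier_mpoly_ring)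
  qed (use ms M(2) in \<open>auto simp: hom_component_def\<close>)
  moreover have "h.S.independent (quot_consts n J) ?Us"
    by (rule independent_monomials) (use ms M(2) indep in auto)
  then have "h.S.dimension (length ?Us) (quot_consts n J) (h.S.Span (quot_consts n J) ?Us)"
    by (rule h.S.dimension_independent)
  then have "h.S.dim (quot_consts n J) (h.S.Span (quot_consts n J) ?Us) = length ?Us"
    using h.S.dimI[OF quot_consts_subfield] by (simp add: over_def)
  ultimately show ?thesis
    using ms distinct_card by (fastforce simp: HF_def)
qed

lemma finite_dim_quot_monomials:
  assumes M: "finite M" "\<And>m. m \<in> M \<Longrightarrow> keys m \<subseteq> {1..n}"
    and rest: "\<And>m c. keys m \<subseteq> {1..n} \<Longrightarrow> m \<notin> M \<Longrightarrow> single m c \<in> J"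
  shows "finite_dim_quot n J"
proof -
  interpret h: ring_hom_ring R "R Quot J" "\<lambda>p. coset p" by (rule quot_hom)
  obtain ms where ms: "set ms = M" "distinct ms"
    using finite_distinct_list[OF M(1)] by blast
  let ?Us = "map (\<lambda>m. coset (single m 1)) ms"
  have "(\<lambda>p. coset p) ` carrier R = h.S.Span (quot_consts n J) ?Us"
  proof (rule coset_image_eq_Span)
    fix cs :: "'k list"
    show "(\<Sum>(c, m)\<leftarrow>zip cs ms. single m c) \<in> carrier R"
      using M(2) ms(1) by (intro zip_sum_carrier) auto
  next
    fix p :: "'k mpoly" and m assume "p \<in> carrier R" "m \<in> keys p" "m \<notin> set ms"
    then show "single m (lookup p m) \<in> J"
      using ms(1) by (intro rest) (auto simp: carrier_mpoly_ring)
  qed (use ms M(2) in auto)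
  moreover have "carrier (R Quot J) = (\<lambda>p. coset p) ` carrier R"
    by (auto simp: FactRing_def A_RCOSETS_def')
  moreover have "set ?Us \<subseteq> carrier (R Quot J)"
    unfolding set_map image_subset_iff ms(1) by (intro ballI h.hom_closed single_carrier M(2))
  ultimately show ?thesis
    unfolding finite_dim_quot_def using h.S.Span_finite_dimension[OF quot_consts_subfield] by simp
qed

end

subsection \<open>Truncations of the Stanley-Reisner ring\<close>

text \<open>Standard monomials of degree \<open>t\<close> for the ideal in condition (iv).\<close>

definition truncated_monomials :: "nat set set \<Rightarrow> nat \<Rightarrow> nat \<Rightarrow> (nat \<Rightarrow>\<^sub>0 nat) set" where
  "truncated_monomials \<Delta> a t = {m. keys m \<in> \<Delta> \<and> (\<forall>i. lookup m i < a) \<and> mon_degree m = t}"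

lemma finite_truncated:
  fixes \<Delta> :: "nat set set"
  assumes "\<Delta> \<subseteq> Pow {1..n}"
  shows "finite {m. keys m \<in> \<Delta> \<and> (\<forall>i. lookup m i < (a::nat))}"
proof -
  let ?M = "{m. keys m \<in> \<Delta> \<and> (\<forall>i. lookup m i < a)}"
  let ?F = "{f. \<forall>i. (i \<in> {1..n} \<longrightarrow> f i \<in> {..<a}) \<and> (i \<notin> {1..n} \<longrightarrow> f i = 0)}"
  have "lookup ` ?M \<subseteq> ?F"
  proof
    fix f assume "f \<in> lookup ` ?M"
    then obtain m where m: "f = lookup m" "keys m \<in> \<Delta>" "\<forall>i. lookup m i < a"
      by blast
    have "f i = 0" if "i \<notin> {1..n}" for i
    proof -
      have "i \<notin> keys m" using that m(2) assms by blast
      then show ?thesis by (simp add: m(1) in_keys_iff)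
    qed
    then show "f \<in> ?F" using m by simp
  qed
  moreover have "finite ?F" by (rule finite_set_of_finite_funs) auto
  ultimately have "finite (lookup ` ?M)" by (rule finite_subset)
  then show ?thesis by (rule finite_imageD) (simp add: inj_on_def)
qed

lemma finite_truncated_monomials:
  "\<Delta> \<subseteq> Pow {1..n} \<Longrightarrow> finite (truncated_monomials \<Delta> a t)"
  by (rule finite_subset[OF _ finite_truncated]) (auto simp: truncated_monomials_def)

text \<open>The ideal is generated by monomials, so extracting the coefficient of a monomial outside
  it is a functional that kills it.\<close>

lemma HF_truncated:
  assumes \<Delta>: "\<Delta> \<subseteq> Pow {1..n}" "{} \<in> \<Delta>" and down: "\<And>\<tau> \<rho>. \<tau> \<in> \<Delta> \<Longrightarrow> \<rho> \<subseteq> \<tau> \<Longrightarrow> \<rho> \<in> \<Delta>" and a: "0 < a"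
  shows "HF n (int t) (SR_ideal_plus n \<Delta> ((\<lambda>i. (mvar i :: ('k::field) mpoly) ^ a) ` {1..n})) = card (truncated_monomials \<Delta> a t)"
proof -
  let ?S = "(\<lambda>i. (mvar i :: 'k mpoly) ^ a) ` {1..n}"
  have S: "?S \<subseteq> carrier (mpoly_ring n)"
    unfolding image_subset_iff mvar_power by (intro ballI single_carrier) (simp split: if_splits)
  note I = SR_ideal_plus_ideal[OF S, of \<Delta>]
  have indep: "lookup p m0 = 0"
    if p: "p \<in> SR_ideal_plus n \<Delta> ?S" and m0: "keys m0 \<in> \<Delta>" "\<And>i. lookup m0 i < a" for p m0
  proof -
    define w where "w m = (if m = m0 then 1 else 0 :: 'k)" for m
    have "functional w p = 0"
    proof (rule SR_functional[OF S _ _ p])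
      fix \<sigma> m assume \<sigma>: "\<sigma> \<subseteq> {1..n}" "\<sigma> \<notin> \<Delta>"
      have "\<sigma> \<subseteq> keys (m + face_expo \<sigma>)"
        using keys_face_expo[OF finite_subset[OF \<sigma>(1)]] by (simp add: keys_add_nat)
      then show "w (m + face_expo \<sigma>) = 0"
        using down[OF m0(1)] \<sigma>(2) by (auto simp: w_def)
    next
      fix g :: "'k mpoly" and m c assume "g \<in> ?S"
      then obtain i where g: "g = single (single i a) 1" by (auto simp: mvar_power)
      have "a \<le> lookup (m + single i a) i" by (simp add: lookup_add)
      then have "m + single i a \<noteq> m0" using m0(2)[of i] by auto
      then show "functional w (single m c * g) = 0"
        by (simp add: g mult_single w_def)
    qed
    moreover have "functional w p = lookup p m0"
      by (simp add: functional_def w_def if_distrib[of "\<lambda>x. _ * x"] in_keys_iff cong: if_cong)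
    ultimately show ?thesis by simp
  qed
  have "1 \<notin> SR_ideal_plus n \<Delta> ?S"
    using indep[of 1 0] \<Delta>(2) a by auto
  then show ?thesis
  proof (rule HF_eq_card[OF I(1)])
    show "finite (truncated_monomials \<Delta> a t)" using \<Delta>(1) by (rule finite_truncated_monomials)
    fix m c assume m: "keys m \<subseteq> {1..n}" "mon_degree m = t" "m \<notin> truncated_monomials \<Delta> a t"
    then consider "keys m \<notin> \<Delta>" | i where "a \<le> lookup m i"
      by (auto simp: truncated_monomials_def not_less)
    then show "single m c \<in> SR_ideal_plus n \<Delta> ?S"
    proof cases
      case 1
      then show ?thesis using nonface_mem_ideal[OF I(1,3) m(1)] by blast
    next
      case 2
      then have "i \<in> keys m" using a by (simp add: in_keys_iff)
      then have "i \<in> {1..n}" using m(1) by blast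
      then have "single (single i a) 1 \<in> SR_ideal_plus n \<Delta> ?S"
        using I(2) by (auto simp: mvar_power)
      then show ?thesis
        by (rule single_mem_ideal[OF I(1) _ m(1)]) (use 2 in \<open>auto simp: lookup_single when_def\<close>)
    qed
  qed (use \<Delta>(1) indep in \<open>auto simp: truncated_monomials_def\<close>)
qed

section \<open>Growth of truncated Stanley-Reisner rings\<close>

text \<open>Discharging: each \<open>x\<close> splits weight 1 equally among its neighbours. A
  neighbour \<open>y\<close> gets less than \<open>1 / real (dn y)\<close> from each of its
  \<open>dn y\<close> elements, so no element of \<open>B\<close> collects more than 1.\<close>

lemma card_less_by_degrees:
  assumes fin: "finite A" "finite B" and "A \<noteq> {}"
    and pos: "\<And>x. x \<in> A \<Longrightarrow> \<exists>y\<in>B. E x y"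
    and less: "\<And>x y. x \<in> A \<Longrightarrow> y \<in> B \<Longrightarrow> E x y \<Longrightarrow> card {x'\<in>A. E x' y} < card {y'\<in>B. E x y'}"
  shows "card A < card B"
proof -
  define up where "up x = card {y\<in>B. E x y}" for x
  define dn where "dn y = card {x\<in>A. E x y}" for y
  have up: "up x > 0" if "x \<in> A" for x
    using pos[OF that] fin(2) by (auto simp: up_def card_gt_0_iff)
  have "real (card A) = (\<Sum>x\<in>A. \<Sum>y\<in>{y\<in>B. E x y}. 1 / real (up x))"
  proof -
    have "(\<Sum>y\<in>{y\<in>B. E x y}. 1 / real (up x)) = 1" if "x \<in> A" for x
      using up[OF that] by (simp add: up_def)
    then have eq: "(\<Sum>x\<in>A. \<Sum>y\<in>{y\<in>B. E x y}. 1 / real (up x)) = (\<Sum>x\<in>A. 1)"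
      by (intro sum.cong refl)
    show ?thesis unfolding eq by simp
  qed
  also have "\<dots> < (\<Sum>x\<in>A. \<Sum>y\<in>{y\<in>B. E x y}. 1 / real (dn y))"
  proof (intro sum_strict_mono fin(1) \<open>A \<noteq> {}\<close>)
    fix x y assume x: "x \<in> A" and y: "y \<in> {y\<in>B. E x y}"
    then have "dn y < up x" using less[of x y] by (simp add: dn_def up_def)
    moreover have "dn y > 0" using x y fin(1) by (auto simp: dn_def card_gt_0_iff)
    ultimately show "1 / real (up x) < 1 / real (dn y)"
      by (simp add: frac_less2)
  qed (use fin pos in auto)
  also have "\<dots> = (\<Sum>x\<in>A. \<Sum>y\<in>B. if E x y then 1 / real (dn y) else 0)"
    by (intro sum.cong refl sum.inter_filter fin(2))
  also have "\<dots> = (\<Sum>y\<in>B. \<Sum>x\<in>A. if E x y then 1 / real (dn y) else 0)"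
    by (rule sum.swap)
  also have "\<dots> = (\<Sum>y\<in>B. \<Sum>x\<in>{x\<in>A. E x y}. 1 / real (dn y))"
    by (intro sum.cong refl sum.inter_filter[symmetric] fin(1))
  also have "\<dots> \<le> (\<Sum>y\<in>B. 1)"
    by (intro sum_mono) (simp flip: dn_def)
  finally show ?thesis by simp
qed

context punctured_acyclic begin

text \<open>Let \<open>m\<close> have support K, and let r be the set of variables with the maximal
  exponent \<open>a - 1\<close>. As \<open>a - 1 \<ge> 2\<close>, the degree gives |K| + |r| \<le>
  t. Raising an unsaturated variable or adding a link vertex yields at least (|K| - |r|) + (D + 1 -
  |K|) \<ge> |K| + 2 multiples, while each of these has at most |K| + 1 divisors.\<close>

lemma truncated_monomials_growth:
  assumes a: "3 \<le> a" and t: "Suc t \<le> D"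
  shows "card (truncated_monomials \<Delta> a t) < card (truncated_monomials \<Delta> a (Suc t))"
proof (rule card_less_by_degrees[where E = "\<lambda>m m'. \<exists>i. m' = m + expo i"])
  let ?A = "truncated_monomials \<Delta> a t" and ?B = "truncated_monomials \<Delta> a (Suc t)"
  show fin: "finite ?A" "finite ?B"
    using finite_truncated_monomials[OF faces] by auto
  obtain \<sigma> where \<sigma>: "\<sigma> \<in> \<Delta>" "card \<sigma> = D" using ex_facet by blast
  obtain \<tau> where \<tau>: "\<tau> \<subseteq> \<sigma>" "card \<tau> = t"
    using obtain_subset_with_card_n[of t \<sigma>] t \<sigma>(2) by auto
  have "finite \<tau>" using \<tau>(1) finite_face[OF \<sigma>(1)] finite_subset by blast
  then have "face_expo \<tau> \<in> ?A"
    using \<tau> down[OF \<sigma>(1) \<tau>(1)] a by (simp add: truncated_monomials_def keys_face_expo lookup_face_expo mon_degree_face_expo)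
  then show "?A \<noteq> {}" by blast
  have up: "card (keys m) + 2 \<le> card {m'\<in>?B. \<exists>i. m' = m + expo i}" if m: "m \<in> ?A" for m
  proof -
    let ?K = "keys m"
    have K: "?K \<in> \<Delta>" and lt: "\<And>i. lookup m i < a" and deg: "mon_degree m = t"
      using m by (auto simp: truncated_monomials_def)
    define r where "r = {i\<in>?K. lookup m i = a - 1}"
    define U where "U = (?K - r) \<union> {v. v \<notin> ?K \<and> insert v ?K \<in> \<Delta>}"
    have "card ?K + card r = (\<Sum>i\<in>?K. 1 + (if i \<in> r then 1 else 0))"
      by (simp only: sum.distrib) (simp add: r_def flip: sum.inter_filter)
    also have "\<dots> \<le> (\<Sum>i\<in>?K. lookup m i)"
    proof (rule sum_mono)
      fix i assume "i \<in> ?K"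
      then have "lookup m i \<ge> 1" by (simp add: in_keys_iff)
      then show "1 + (if i \<in> r then 1 else 0) \<le> lookup m i"
        using a by (auto simp: r_def)
    qed
    finally have sr: "card ?K + card r \<le> t" using deg by (simp add: mon_degree_def)
    have link: "D + 1 - card ?K \<le> card {v. v \<notin> ?K \<and> insert v ?K \<in> \<Delta>}"
      by (rule card_link[OF K]) (use sr t in simp)
    have finl: "finite {v. v \<notin> ?K \<and> insert v ?K \<in> \<Delta>}"
      by (rule finite_subset[of _ "{1..n}"]) (use faces in auto)
    have "card U = card (?K - r) + card {v. v \<notin> ?K \<and> insert v ?K \<in> \<Delta>}"
      unfolding U_def by (rule card_Un_disjoint) (use finl in auto)
    moreover have "card (?K - r) = card ?K - card r"
      by (rule card_Diff_subset) (auto simp: r_def)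
    moreover have "card r \<le> card ?K" by (rule card_mono) (auto simp: r_def)
    ultimately have U: "card ?K + 2 \<le> card U" using sr link t by linarith
    have "(\<lambda>i. m + expo i) ` U \<subseteq> {m'\<in>?B. \<exists>i. m' = m + expo i}"
    proof
      fix m' assume "m' \<in> (\<lambda>i. m + expo i) ` U"
      then obtain i where i: "i \<in> U" "m' = m + expo i" by blast
      have "keys m' = insert i ?K"
        by (simp add: i(2) keys_add_nat)
      then have k: "keys m' \<in> \<Delta>"
        using i(1) K by (auto simp: U_def insert_absorb)
      have "lookup m i + 1 < a"
      proof (cases "i \<in> ?K")
        case True
        then have "lookup m i \<noteq> a - 1" using i(1) by (auto simp: U_def r_def)
        then show ?thesis using lt[of i] by linarith
      next
        case False
        then have "lookup m i = 0" by (simp add: in_keys_iff)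
        then show ?thesis using a by simp
      qed
      then have "lookup m' j < a" for j
        using lt[of j] by (auto simp: i(2) lookup_add lookup_single when_def)
      then show "m' \<in> {m'\<in>?B. \<exists>i. m' = m + expo i}"
        using k i(2) deg by (auto simp: truncated_monomials_def mon_degree_add)
    qed
    then have "card ((\<lambda>i. m + expo i) ` U) \<le> card {m'\<in>?B. \<exists>i. m' = m + expo i}"
      by (intro card_mono) (use fin in auto)
    moreover have "inj_on (\<lambda>i. m + expo i) U"
    proof (rule inj_onI)
      fix x y assume "m + expo x = m + expo y"
      then have "expo x = expo y" by simp
      from arg_cong[OF this, of keys] show "x = y" by simp
    qed
    ultimately show ?thesis using U by (simp add: card_image)
  qed
  show "\<exists>m'\<in>?B. \<exists>i. m' = m + expo i" if "m \<in> ?A" for m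
  proof (rule ccontr)
    assume "\<not> ?thesis"
    then have e: "{m'\<in>?B. \<exists>i. m' = m + expo i} = {}" by blast
    show False using up[OF that] unfolding e by simp
  qed
  fix m m' assume m: "m \<in> ?A" and m': "m' \<in> ?B" "\<exists>i. m' = m + expo i"
  obtain i where i: "m' = m + expo i" using m'(2) by blast
  have "{x\<in>?A. \<exists>i. m' = x + expo i} \<subseteq> (\<lambda>j. m' - expo j) ` keys m'"
  proof
    fix x assume "x \<in> {x\<in>?A. \<exists>i. m' = x + expo i}"
    then obtain j where "m' = x + expo j" by blast
    then show "x \<in> (\<lambda>j. m' - expo j) ` keys m'"
      by (intro image_eqI[of _ _ j]) (simp_all add: keys_add_nat)
  qed
  then have "card {x\<in>?A. \<exists>i. m' = x + expo i} \<le> card ((\<lambda>j. m' - expo j) ` keys m')"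
    by (intro card_mono) auto
  also have "\<dots> \<le> card (keys m')" by (rule card_image_le) simp
  also have "keys m' = insert i (keys m)"
    by (simp add: i keys_add_nat)
  also have "card \<dots> \<le> card (keys m) + 1"
    by (simp add: card_insert_if)
  finally show "card {x\<in>?A. \<exists>i. m' = x + expo i} < card {y\<in>?B. \<exists>i. y = m + expo i}"
    using up[OF m] by linarith
qed

end

subsection \<open>Coordinates with respect to a facet\<close>

text \<open>Induction adding one vector \<open>t\<close>: a coordinate functional is made to vanish
  on \<open>S\<close> and normalised on \<open>t\<close>, and the old dual functionals are corrected
  by it. The result later inverts the coefficient matrix of the parameters on a facet.\<close>

lemma dual_covectors:
  fixes p :: "'s \<Rightarrow> 'j \<Rightarrow> 'k::field"
  assumes "finite S" "finite J"
    and "\<And>c s. (\<And>j. j \<in> J \<Longrightarrow> (\<Sum>s\<in>S. c s * p s j) = 0) \<Longrightarrow> s \<in> S \<Longrightarrow> c s = 0"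
  shows "\<exists>g. \<forall>s\<in>S. \<forall>t\<in>S. (\<Sum>j\<in>J. g s j * p t j) = (if s = t then 1 else 0)"
  using assms(1,3)
proof (induction S rule: finite_induct)
  case (insert t S)
  have indep: "c s = 0" if c: "\<And>j. j \<in> J \<Longrightarrow> (\<Sum>s\<in>S. c s * p s j) = 0" and s: "s \<in> S" for c s
  proof -
    define c' where "c' s = (if s = t then 0 else c s)" for s
    have c'S: "(\<Sum>s\<in>S. c' s * p s j) = (\<Sum>s\<in>S. c s * p s j)" for j
      by (rule sum.cong) (use insert.hyps in \<open>auto simp: c'_def\<close>)
    have "c' s = 0"
    proof (rule insert.prems)
      fix j assume "j \<in> J"
      then show "(\<Sum>s\<in>insert t S. c' s * p s j) = 0"
        using c insert.hyps by (simp add: c'S) (simp add: c'_def)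
    qed (use s in simp)
    then show ?thesis using s insert.hyps by (auto simp: c'_def split: if_splits)
  qed
  have "\<exists>g. \<forall>s\<in>S. \<forall>r\<in>S. (\<Sum>j\<in>J. g s j * p r j) = (if s = r then 1 else 0)"
    by (rule insert.IH) (rule indep)
  then obtain g where g: "\<forall>s\<in>S. \<forall>r\<in>S. (\<Sum>j\<in>J. g s j * p r j) = (if s = r then 1 else 0)"
    by (elim exE)
  define q where "q s = (\<Sum>j\<in>J. g s j * p t j)" for s
  \<comment> \<open>The part of \<open>p t\<close> left after removing its
    \<open>S\<close>-components. Independence makes some coordinate \<open>k\<close> of it nonzero,
    and \<open>r k\<close> is the normalising constant of \<open>gt\<close>.\<close>
  define r where "r j = p t j - (\<Sum>s\<in>S. q s * p s j)" for j
  have "\<exists>j\<in>J. r j \<noteq> 0"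
  proof (rule ccontr)
    assume "\<not> (\<exists>j\<in>J. r j \<noteq> 0)"
    then have r0: "r j = 0" if "j \<in> J" for j using that by blast
    define c where "c s = (if s = t then 1 else - q s)" for s
    have "(\<Sum>s\<in>S. c s * p s j) = (\<Sum>s\<in>S. - (q s * p s j))" for j
      by (rule sum.cong) (use insert.hyps in \<open>auto simp: c_def\<close>)
    then have "(\<Sum>s\<in>insert t S. c s * p s j) = 0" if "j \<in> J" for j
      using r0[OF that] insert.hyps by (simp add: r_def c_def sum_negf)
    from insert.prems[of c t, OF this] show False by (simp add: c_def)
  qed
  then obtain k where k: "k \<in> J" "r k \<noteq> 0" by blast
  define gt where "gt j = ((if j = k then 1 else 0) - (\<Sum>s\<in>S. p s k * g s j)) / r k" for j
  have gt: "(\<Sum>j\<in>J. gt j * x j) = (x k - (\<Sum>s\<in>S. p s k * (\<Sum>j\<in>J. g s j * x j))) / r k" for x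
  proof -
    have "(\<Sum>j\<in>J. gt j * x j) = (\<Sum>j\<in>J. (if j = k then x j else 0) - (\<Sum>s\<in>S. p s k * (g s j * x j))) / r k"
      unfolding sum_divide_distrib
      by (rule sum.cong) (auto simp: gt_def left_diff_distrib sum_distrib_right diff_divide_distrib mult.assoc)
    also have "(\<Sum>j\<in>J. (if j = k then x j else 0) - (\<Sum>s\<in>S. p s k * (g s j * x j))) =
        x k - (\<Sum>j\<in>J. \<Sum>s\<in>S. p s k * (g s j * x j))"
      using k(1) assms(2) by (simp add: sum_subtractf)
    also have "(\<Sum>j\<in>J. \<Sum>s\<in>S. p s k * (g s j * x j)) = (\<Sum>s\<in>S. p s k * (\<Sum>j\<in>J. g s j * x j))"
      by (subst sum.swap) (simp add: sum_distrib_left)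
    finally show ?thesis .
  qed
  have gtS: "(\<Sum>j\<in>J. gt j * p s j) = 0" if "s \<in> S" for s
  proof -
    have "(\<Sum>s'\<in>S. p s' k * (\<Sum>j\<in>J. g s' j * p s j)) = (\<Sum>s'\<in>S. if s' = s then p s k else 0)"
      by (rule sum.cong) (use g that in auto)
    then show ?thesis using that insert.hyps by (simp add: gt)
  qed
  have gtt: "(\<Sum>j\<in>J. gt j * p t j) = 1"
    using k(2) by (simp add: gt r_def mult.commute flip: q_def)
  define g' where "g' s j = (if s = t then gt j else g s j - q s * gt j)" for s j
  have g'sum: "(\<Sum>j\<in>J. g' s j * x j) = (if s = t then (\<Sum>j\<in>J. gt j * x j) else (\<Sum>j\<in>J. g s j * x j) - q s * (\<Sum>j\<in>J. gt j * x j))" for s x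
    by (simp add: g'_def left_diff_distrib sum_subtractf sum_distrib_left mult.assoc)
  show ?case
    by (intro exI[of _ g'] ballI) (use g gtS gtt insert.hyps in \<open>auto simp: g'sum q_def[symmetric]\<close>)
qed simp

lemma underdetermined_system:
  fixes p :: "'s \<Rightarrow> 'j \<Rightarrow> 'k::field"
  assumes "finite J" "finite S" "card J < card S"
  shows "\<exists>c. (\<exists>s\<in>S. c s \<noteq> 0) \<and> (\<forall>j\<in>J. (\<Sum>s\<in>S. c s * p s j) = 0)"
  using assms
proof (induction J arbitrary: S p rule: finite_induct)
  case empty
  then have "S \<noteq> {}" by auto
  then show ?case by (intro exI[of _ "\<lambda>_. 1"]) auto
next
  case (insert k J)
  show ?case
  proof (cases "\<forall>s\<in>S. p s k = 0")
    case True
    have "card J < card S" using insert by simp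
    from insert.IH[OF insert.prems(1) this] obtain c where
      "\<exists>s\<in>S. c s \<noteq> 0" "\<forall>j\<in>J. (\<Sum>s\<in>S. c s * p s j) = 0" by blast
    with True show ?thesis by (intro exI[of _ c]) simp
  next
    case False
    then obtain t where t: "t \<in> S" "p t k \<noteq> 0" by blast
    let ?S = "S - {t}"
    define p' where "p' s j = p s j - p t j * p s k / p t k" for s j
    have "card J < card ?S" using insert t by simp
    with insert.IH[of ?S p'] insert.prems(1) obtain c where
      c: "\<exists>s\<in>?S. c s \<noteq> 0" "\<forall>j\<in>J. (\<Sum>s\<in>?S. c s * p' s j) = 0" by auto
    define e where "e = - (\<Sum>s\<in>?S. c s * p s k) / p t k"
    define c' where "c' s = (if s = t then e else c s)" for s
    have sum: "(\<Sum>s\<in>S. c' s * p s j) = e * p t j + (\<Sum>s\<in>?S. c s * p s j)" for j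
    proof -
      have "(\<Sum>s\<in>?S. c' s * p s j) = (\<Sum>s\<in>?S. c s * p s j)"
        by (rule sum.cong) (auto simp: c'_def)
      then show ?thesis
        using insert.prems(1) t(1) by (simp add: sum.remove[of S t] c'_def)
    qed
    have "(\<Sum>s\<in>S. c' s * p s j) = 0" if "j \<in> insert k J" for j
    proof (cases "j = k")
      case True
      then show ?thesis using t(2) by (simp add: sum e_def)
    next
      case False
      then have "0 = (\<Sum>s\<in>?S. c s * p' s j)" using c(2) that by simp
      also have "\<dots> = (\<Sum>s\<in>?S. c s * p s j - c s * p s k * (p t j / p t k))"
        by (rule sum.cong) (simp_all add: p'_def algebra_simps)
      also have "\<dots> = (\<Sum>s\<in>S. c' s * p s j)"
        by (simp add: sum e_def sum_subtractf sum_distrib_right sum_divide_distrib)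
      finally show ?thesis by simp
    qed
    moreover have "\<exists>s\<in>S. c' s \<noteq> 0" using c(1) by (auto simp: c'_def)
    ultimately show ?thesis by blast
  qed
qed

text \<open>Treat \<open>x\<close> as one more vector, indexed by \<open>None\<close>: there are
  then more vectors than coordinates, and independence forces \<open>x\<close> to occur in the
  resulting relation.\<close>

lemma independent_spans:
  fixes p :: "'s \<Rightarrow> 'j \<Rightarrow> 'k::field"
  assumes fin: "finite S" "finite J" and card: "card J = card S"
    and indep: "\<And>c s. (\<And>j. j \<in> J \<Longrightarrow> (\<Sum>s\<in>S. c s * p s j) = 0) \<Longrightarrow> s \<in> S \<Longrightarrow> c s = 0"
  shows "\<exists>y. \<forall>j\<in>J. x j = (\<Sum>s\<in>S. y s * p s j)"
proof -
  define q where "q o' j = (case o' of None \<Rightarrow> x j | Some s \<Rightarrow> p s j)" for o' j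
  have "card (insert None (Some ` S)) = Suc (card S)"
    using fin by (simp add: card_image)
  then obtain c where c: "\<exists>s\<in>insert None (Some ` S). c s \<noteq> 0"
      "\<forall>j\<in>J. (\<Sum>s\<in>insert None (Some ` S). c s * q s j) = 0"
    using underdetermined_system[of J "insert None (Some ` S)" q] fin card by auto
  have sum: "c None * x j + (\<Sum>s\<in>S. c (Some s) * p s j) = 0" if "j \<in> J" for j
    using c(2) that fin by (simp add: sum.reindex q_def)
  have "c None \<noteq> 0"
  proof
    assume c0: "c None = 0"
    then have "c (Some s) = 0" if "s \<in> S" for s
      using indep[of "\<lambda>s. c (Some s)", OF _ that] sum by simp
    then show False using c(1) c0 by auto
  qed
  have "x j = (\<Sum>s\<in>S. - (c (Some s) / c None) * p s j)" if "j \<in> J" for j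
  proof -
    have "(\<Sum>s\<in>S. - (c (Some s) / c None) * p s j) = - (1 / c None) * (\<Sum>s\<in>S. c (Some s) * p s j)"
      unfolding sum_distrib_left by (rule sum.cong) simp_all
    also have "(\<Sum>s\<in>S. c (Some s) * p s j) = - (c None * x j)"
      using sum[OF that] by (simp add: eq_neg_iff_add_eq_0 add.commute)
    finally show ?thesis using \<open>c None \<noteq> 0\<close> by simp
  qed
  then show ?thesis
    by (intro exI[of _ "\<lambda>s. - (c (Some s) / c None)"] ballI)
qed

section \<open>Stresses on the star of a codimension-two face\<close>

text \<open>A \<open>stress\<close> is a linear functional on quadrics killing the ideal, so squares in the ideal
  have vanishing diagonal entries.\<close>

locale square_zero_parameters = punctured_acyclic +
  fixes p :: "nat \<Rightarrow> nat \<Rightarrow> 'k::field_char_0"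
  assumes indep: "\<And>\<sigma> c v. \<sigma> \<in> \<Delta> \<Longrightarrow> (\<And>j. j < D \<Longrightarrow> (\<Sum>v\<in>\<sigma>. c v * p v j) = 0) \<Longrightarrow> v \<in> \<sigma> \<Longrightarrow> c v = 0"
    and sum_relation: "\<And>c. (\<And>j. j < D \<Longrightarrow> (\<Sum>v\<in>{1..n}. c v * p v j) = 0) \<Longrightarrow> (\<Sum>v\<in>{1..n}. c v) = 0"
    and stress: "\<And>\<phi> w. (\<And>a b. \<phi> a b = \<phi> b a) \<Longrightarrow> (\<And>a b. \<phi> a b \<noteq> 0 \<Longrightarrow> {a, b} \<in> \<Delta>) \<Longrightarrow>
      (\<And>a j. j < D \<Longrightarrow> (\<Sum>b\<in>{1..n}. \<phi> a b * p b j) = 0) \<Longrightarrow> w \<in> {1..n} \<Longrightarrow> \<phi> w w = 0"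
begin

lemma facet_coordinates:
  assumes \<sigma>: "\<sigma> \<in> \<Delta>" "card \<sigma> = D"
  shows "\<exists>y. (\<forall>x. \<forall>j<D. p x j = (\<Sum>s\<in>\<sigma>. y s x * p s j)) \<and> (\<forall>s\<in>\<sigma>. \<forall>t\<in>\<sigma>. y s t = (if s = t then 1 else 0))"
proof -
  have fin: "finite \<sigma>" by (rule finite_face[OF \<sigma>(1)])
  have ind: "c v = 0" if "\<And>j. j \<in> {..<D} \<Longrightarrow> (\<Sum>v\<in>\<sigma>. c v * p v j) = 0" "v \<in> \<sigma>" for c v
    by (rule indep[OF \<sigma>(1) _ that(2)]) (use that(1) in simp)
  have "\<exists>y. \<forall>j\<in>{..<D}. p x j = (\<Sum>s\<in>\<sigma>. y s * p s j)" for x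
    by (rule independent_spans) (use fin \<sigma>(2) ind in auto)
  then have "\<forall>x. \<exists>y. \<forall>j\<in>{..<D}. p x j = (\<Sum>s\<in>\<sigma>. y s * p s j)" by blast
  from choice[OF this] obtain y where y: "\<And>x j. j < D \<Longrightarrow> p x j = (\<Sum>s\<in>\<sigma>. y x s * p s j)"
    by auto
  have "y t s = (if s = t then 1 else 0)" if st: "s \<in> \<sigma>" "t \<in> \<sigma>" for s t
  proof -
    have "y t s - (if s = t then 1 else 0) = 0"
    proof (rule indep[OF \<sigma>(1) _ st(1)])
      fix j assume j: "j < D"
      have "(\<Sum>s\<in>\<sigma>. (if s = t then 1 else 0) * p s j) = (\<Sum>s\<in>\<sigma>. if s = t then p t j else 0)"
        by (rule sum.cong) auto
      then show "(\<Sum>s\<in>\<sigma>. (y t s - (if s = t then 1 else 0)) * p s j) = 0"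
        using y[OF j, of t] fin st(2) by (simp add: left_diff_distrib sum_subtractf)
    qed
    then show ?thesis by simp
  qed
  then show ?thesis
    using y by (intro exI[of _ "\<lambda>s x. y x s"]) auto
qed

text \<open>The fundamental cycle on the facets above \<open>G\<close>, read as antisymmetric
  weights on the edges of the link; the cycle condition at the ridge \<open>insert a G\<close> is
  the row sum at \<open>a\<close>. The weights reach the field by \<open>of_int\<close>, which is
  injective in characteristic zero.\<close>

lemma link_orientation:
  assumes G: "G \<in> \<Delta>" "Suc (Suc (card G)) = D"
  shows "\<exists>e :: nat \<Rightarrow> nat \<Rightarrow> 'k. (\<forall>a b. e a b = - e b a) \<and>
    (\<forall>a b. e a b \<noteq> 0 \<longleftrightarrow> a \<noteq> b \<and> a \<notin> G \<and> b \<notin> G \<and> insert a (insert b G) \<in> \<Delta>) \<and>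
    (\<forall>a. (\<Sum>b\<in>{1..n}. e a b) = 0)"
proof -
  from fundamental_cycle
  obtain z where z: "keys z \<subseteq> {\<tau> \<in> \<Delta>. card \<tau> = D}" "bd z = 0"
    "\<forall>\<sigma>\<in>\<Delta>. card \<sigma> = D \<longrightarrow> lookup z \<sigma> \<noteq> 0"
    by (elim exE conjE)
  have fin: "finite G" by (rule finite_face[OF G(1)])
  have Gn: "G \<subseteq> {1..n}" using G(1) faces by blast
  \<comment> \<open>The coefficient of \<open>z\<close> along the wedge of \<open>b\<close>,
    \<open>a\<close> and \<open>G\<close>: the three signs sort this wedge.\<close>
  define i where "i a b = (if a \<noteq> b \<and> a \<notin> G \<and> b \<notin> G then
      (if a < b then -1 else 1) * vertex_sign a G * vertex_sign b G * lookup z (insert a (insert b G)) else 0)" for a b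
  have anti: "i a b = - i b a" for a b
  proof (cases "a = b")
    case False
    then show ?thesis by (auto simp: i_def insert_commute mult_ac)
  qed (simp add: i_def)
  have nz: "i a b \<noteq> 0 \<longleftrightarrow> a \<noteq> b \<and> a \<notin> G \<and> b \<notin> G \<and> insert a (insert b G) \<in> \<Delta>" for a b
  proof (cases "a \<noteq> b \<and> a \<notin> G \<and> b \<notin> G")
    case True
    then have "card (insert a (insert b G)) = D" using fin G(2) by simp
    then have "lookup z (insert a (insert b G)) \<noteq> 0 \<longleftrightarrow> insert a (insert b G) \<in> \<Delta>"
      using z(1,3) unfolding in_keys_iff[symmetric] by blast
    moreover have "i a b = (if a < b then -1 else 1) * vertex_sign a G * vertex_sign b G * lookup z (insert a (insert b G))"
      using True by (simp add: i_def)
    ultimately show ?thesis using True by simp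
  next
    case False
    then have "i a b = 0" unfolding i_def by (rule if_not_P)
    then show ?thesis using False by auto
  qed
  have sum: "(\<Sum>b\<in>{1..n}. i a b) = 0" for a
  proof (cases "a \<in> {1..n} \<and> a \<notin> G")
    case True
    have "0 = vertex_sign a G * lookup (bd z) (insert a G)" using z(2) by simp
    also have "lookup (bd z) (insert a G) =
        (\<Sum>b\<in>{1..n} - insert a G. vertex_sign b (insert a G) * lookup z (insert b (insert a G)))"
      by (rule lookup_bd) (use z(1) faces Gn True in auto)
    also have "vertex_sign a G * \<dots> = (\<Sum>b\<in>{1..n} - insert a G. i a b)"
      unfolding sum_distrib_left
    proof (rule sum.cong[OF refl])
      fix b assume b: "b \<in> {1..n} - insert a G"
      have "vertex_sign b (insert a G) = (if a < b then - vertex_sign b G else vertex_sign b G)"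
        by (rule vertex_sign_insert) (use fin True in auto)
      then show "vertex_sign a G * (vertex_sign b (insert a G) * lookup z (insert b (insert a G))) = i a b"
        using b True by (auto simp: i_def insert_commute)
    qed
    also have "\<dots> = (\<Sum>b\<in>{1..n}. i a b)"
      by (rule sum.mono_neutral_left) (auto simp: i_def)
    finally show ?thesis by simp
  next
    case False
    have "i a b = 0" for b
    proof (rule ccontr)
      assume "i a b \<noteq> 0"
      then have "insert a (insert b G) \<in> \<Delta>" "a \<notin> G" using nz by auto
      then show False using False faces by blast
    qed
    then show ?thesis by simp
  qed
  have "(\<Sum>b\<in>{1..n}. (of_int (i a b) :: 'k)) = 0" for a
    using arg_cong[OF sum[of a], of "of_int :: int \<Rightarrow> 'k"] by (simp add: of_int_sum)
  moreover have "(of_int (i a b) :: 'k) = - of_int (i b a)" for a b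
    by (subst anti) simp
  moreover have "(of_int (i a b) :: 'k) \<noteq> 0 \<longleftrightarrow> a \<noteq> b \<and> a \<notin> G \<and> b \<notin> G \<and> insert a (insert b G) \<in> \<Delta>" for a b
    unfolding of_int_eq_0_iff by (rule nz)
  ultimately show ?thesis
    by (intro exI[of _ "\<lambda>a b. of_int (i a b)"] conjI allI)
qed

text \<open>Take the stress on the star of \<open>F - {w}\<close>. At \<open>w\<close> only the
  neighbours \<open>u\<close> and \<open>v\<close> carry weight, and \<open>u\<close> has no
  \<open>w\<close>-coordinate, so the diagonal entry at \<open>w\<close> is up to sign a nonzero
  weight times \<open>y w v\<close>.\<close>

lemma ridge_coordinate_zero:
  assumes F: "F \<in> \<Delta>" "Suc (card F) = D" and uv: "u \<noteq> v" "u \<notin> F" "v \<notin> F" "insert u F \<in> \<Delta>" "insert v F \<in> \<Delta>"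
    and y: "\<And>x j. j < D \<Longrightarrow> p x j = (\<Sum>s\<in>insert u F. y s x * p s j)"
    and yd: "\<And>s t. s \<in> insert u F \<Longrightarrow> t \<in> insert u F \<Longrightarrow> y s t = (if s = t then 1 else 0)"
    and w: "w \<in> F"
  shows "y w v = 0"
proof -
  define G where "G = F - {w}"
  have finF: "finite F" by (rule finite_face[OF F(1)])
  have G: "G \<in> \<Delta>" "Suc (Suc (card G)) = D" "w \<notin> G" "insert w G = F" "u \<notin> G" "finite G"
    using down[OF F(1), of G] F(2) w finF uv card_Suc_Diff1[OF finF w] by (auto simp: G_def)
  have un: "u \<noteq> w" using w uv by auto
  from link_orientation[OF G(1,2)]
  obtain e :: "nat \<Rightarrow> nat \<Rightarrow> 'k" where e0: "\<forall>a b. e a b = - e b a"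
    "\<forall>a b. e a b \<noteq> 0 \<longleftrightarrow> a \<noteq> b \<and> a \<notin> G \<and> b \<notin> G \<and> insert a (insert b G) \<in> \<Delta>"
    "\<forall>a. (\<Sum>b\<in>{1..n}. e a b) = 0"
    by (elim exE conjE)
  note e = e0[rule_format]
  \<comment> \<open>Modulo the span of \<open>G\<close>, the vector of a vertex \<open>a\<close>
    becomes the plane vector with coordinates \<open>y w a\<close> and \<open>y u a\<close>;
    \<open>dt\<close> is the determinant of two of these.\<close>
  define dt where "dt a b = y w a * y u b - y u a * y w b" for a b
  have dt_anti: "dt a b = - dt b a" for a b by (simp add: dt_def mult.commute)
  have expand: "p x j = (\<Sum>g\<in>G. y g x * p g j) + y w x * p w j + y u x * p u j" if "j < D" for x j
  proof -
    have "p x j = (\<Sum>s\<in>insert u (insert w G). y s x * p s j)"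
      unfolding G(4) by (rule y[OF that])
    also have "\<dots> = y u x * p u j + (y w x * p w j + (\<Sum>g\<in>G. y g x * p g j))"
      using G(3,5,6) un by simp
    finally show ?thesis by (simp only: add_ac)
  qed
  \<comment> \<open>Independence on the facet \<open>insert a (insert b G)\<close> survives in this
    plane: a relation between the plane vectors of \<open>a\<close> and \<open>b\<close> lifts to
    the facet by adding a combination of \<open>G\<close>.\<close>
  have comb: "\<alpha> = 0 \<and> \<beta> = 0"
    if ab: "e a b \<noteq> 0" and z: "\<alpha> * y w a + \<beta> * y w b = 0" "\<alpha> * y u a + \<beta> * y u b = 0" for a b \<alpha> \<beta>
  proof -
    have ab': "a \<noteq> b" "a \<notin> G" "b \<notin> G" "insert a (insert b G) \<in> \<Delta>" using ab e(2) by auto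
    define c where "c x = (if x = a then \<alpha> else if x = b then \<beta> else - (\<alpha> * y x a + \<beta> * y x b))" for x
    have "(\<Sum>x\<in>insert a (insert b G). c x * p x j) = 0" if j: "j < D" for j
    proof -
      have "(\<Sum>x\<in>G. c x * p x j) = (\<Sum>x\<in>G. - (\<alpha> * (y x a * p x j) + \<beta> * (y x b * p x j)))"
        by (rule sum.cong) (use ab' in \<open>auto simp: c_def algebra_simps\<close>)
      also have "\<dots> = - (\<alpha> * (\<Sum>x\<in>G. y x a * p x j) + \<beta> * (\<Sum>x\<in>G. y x b * p x j))"
        unfolding sum_negf sum.distrib sum_distrib_left ..
      finally have "(\<Sum>x\<in>insert a (insert b G). c x * p x j) =
          \<alpha> * p a j + \<beta> * p b j - (\<alpha> * (\<Sum>x\<in>G. y x a * p x j) + \<beta> * (\<Sum>x\<in>G. y x b * p x j))"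
        using ab' G(6) by (simp add: c_def)
      also have "\<dots> = (\<alpha> * y w a + \<beta> * y w b) * p w j + (\<alpha> * y u a + \<beta> * y u b) * p u j"
        by (simp add: expand[OF j, of a] expand[OF j, of b] algebra_simps)
      finally show ?thesis using z by simp
    qed
    from indep[OF ab'(4), of c, OF this] have "c a = 0" "c b = 0" by auto
    then show ?thesis using ab'(1) by (simp add: c_def)
  qed
  have dt: "dt a b \<noteq> 0" if ab: "e a b \<noteq> 0" for a b
  proof
    assume d0: "dt a b = 0"
    then have 1: "y w b = 0 \<and> - y w a = 0"
      using comb[OF ab, of "y w b" "- y w a"] by (simp add: dt_def algebra_simps)
    have 2: "y u b = 0 \<and> - y u a = 0"
      using comb[OF ab, of "y u b" "- y u a"] d0 by (simp add: dt_def algebra_simps)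
    show False using comb[OF ab, of 1 0] 1 2 by simp
  qed
  \<comment> \<open>A quotient of two antisymmetric functions is symmetric. Off the edges of the
    link the numerator is zero, whatever \<open>dt\<close> is.\<close>
  define f where "f a b = e a b / dt a b" for a b
  have f_sym: "f a b = f b a" for a b
    using e(1)[of a b] dt_anti[of a b] by (simp add: f_def)
  define Qw where "Qw a = (\<Sum>b\<in>{1..n}. f a b * y w b)" for a
  define Qu where "Qu a = (\<Sum>b\<in>{1..n}. f a b * y u b)" for a
  \<comment> \<open>\<open>Qw a\<close> and \<open>Qu a\<close> are the coordinates of the weighted
    sum of the neighbours of \<open>a\<close>; \<open>l a\<close> is its ratio to the vector of
    \<open>a\<close>, taken from a nonzero coordinate. The default 0 is for zero plane vectors,
    whose vertices have no link edge.\<close>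
  define l where "l a = (if y w a \<noteq> 0 then Qw a / y w a else if y u a \<noteq> 0 then Qu a / y u a else 0)" for a
  \<comment> \<open>The determinant of the vector of \<open>a\<close> with the weighted sum of its
    neighbours is the row sum of \<open>e\<close>, hence zero: the two are parallel.\<close>
  have cross: "y w a * Qu a = y u a * Qw a" for a
  proof -
    have "y w a * Qu a - y u a * Qw a = (\<Sum>b\<in>{1..n}. f a b * dt a b)"
      by (simp add: Qu_def Qw_def dt_def sum_distrib_left right_diff_distrib sum_subtractf mult_ac)
    also have "\<dots> = (\<Sum>b\<in>{1..n}. e a b)"
      by (rule sum.cong) (use dt in \<open>auto simp: f_def\<close>)
    finally show ?thesis using e(3) by simp
  qed
  have Q0: "Qw a = 0 \<and> Qu a = 0" if "\<And>b. e a b = 0" for a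
    using that by (simp add: Qw_def Qu_def f_def)
  have l: "Qw a = l a * y w a" "Qu a = l a * y u a" for a
  proof -
    have "Qw a = l a * y w a \<and> Qu a = l a * y u a"
    proof (cases "y w a = 0 \<and> y u a = 0")
      case True
      have "e a b = 0" for b
      proof (rule ccontr)
        assume "e a b \<noteq> 0"
        from dt[OF this] True show False by (simp add: dt_def)
      qed
      with Q0[of a] True show ?thesis by simp
    next
      case False
      then show ?thesis using cross[of a] by (auto simp: l_def field_simps)
    qed
    then show "Qw a = l a * y w a" "Qu a = l a * y u a" by auto
  qed
  have l0: "l a = 0" if "\<And>b. e a b = 0" for a
    using Q0[OF that] by (simp add: l_def)
  \<comment> \<open>The diagonal entry \<open>- l a\<close> balances the neighbours, so the rows of
    \<open>B\<close> are relations between the plane vectors.\<close>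
  define B where "B a b = (if a = b then - l a else f a b)" for a b
  have B_sym: "B a b = B b a" for a b using f_sym by (simp add: B_def)
  have B_link: "b \<notin> G \<and> insert b G \<in> \<Delta> \<and> b \<in> {1..n}" if "B a b \<noteq> 0" for a b
  proof -
    have "\<exists>x. e b x \<noteq> 0"
    proof (cases "a = b")
      case True
      then show ?thesis using that l0[of b] by (auto simp: B_def)
    next
      case False
      then have "e a b \<noteq> 0" using that by (auto simp: B_def f_def)
      then show ?thesis using e(1)[of a b] by (intro exI[of _ a]) auto
    qed
    then obtain x where "b \<notin> G" "insert b (insert x G) \<in> \<Delta>" using e(2) by blast
    then show ?thesis using down[of "insert b (insert x G)" "insert b G"] faces by auto
  qed
  have Bw: "(\<Sum>b\<in>{1..n}. B a b * y w b) = 0" and Bu: "(\<Sum>b\<in>{1..n}. B a b * y u b) = 0" for a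
  proof -
    have "(\<Sum>b\<in>{1..n}. B a b * x b) = (\<Sum>b\<in>{1..n}. f a b * x b) - (if a \<in> {1..n} then l a * x a else 0)" for x :: "nat \<Rightarrow> 'k"
    proof -
      have faa: "f a a = 0" using e(2)[of a a] by (auto simp: f_def)
      have "(\<Sum>b\<in>{1..n}. B a b * x b) = (\<Sum>b\<in>{1..n}. f a b * x b - (if b = a then l a * x a else 0))"
        by (rule sum.cong) (auto simp: B_def faa)
      then show ?thesis by (simp add: sum_subtractf)
    qed
    moreover have "l a = 0" if "a \<notin> {1..n}"
    proof (rule l0)
      fix b show "e a b = 0"
      proof (rule ccontr)
        assume "e a b \<noteq> 0"
        then show False using e(2)[of a b] that faces by blast
      qed
    qed
    ultimately show "(\<Sum>b\<in>{1..n}. B a b * y w b) = 0" "(\<Sum>b\<in>{1..n}. B a b * y u b) = 0"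
      using l[of a] by (auto simp: Qw_def Qu_def)
  qed
  \<comment> \<open>For \<open>c\<close> in the link, column \<open>c\<close> of \<open>M\<close>
    removes from vertex \<open>c\<close> its \<open>G\<close>-part, so it writes the plane vector of
    \<open>c\<close> in terms of the original vectors. \<open>\<phi>\<close>, the product of
    \<open>M\<close>, \<open>B\<close> and the transpose of \<open>M\<close>, lifts the plane
    relations to the star of \<open>G\<close>.\<close>
  define M where "M a c = (if a \<in> G then - y a c else if a = c then 1 else 0 :: 'k)" for a c
  define \<phi> where "\<phi> a b = (\<Sum>c\<in>{1..n}. \<Sum>c'\<in>{1..n}. M a c * M b c' * B c c')" for a b
  have Gn: "G \<subseteq> {1..n}" using G(1) faces by blast
  have "\<phi> w w = 0"
  proof (rule stress[where \<phi> = \<phi> and w = w])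
    show "\<phi> a b = \<phi> b a" for a b
      unfolding \<phi>_def by (subst sum.swap) (simp add: B_sym mult_ac)
    show "{a, b} \<in> \<Delta>" if ab: "\<phi> a b \<noteq> 0" for a b
    proof -
      obtain c c' where c: "M a c \<noteq> 0" "M b c' \<noteq> 0" "B c c' \<noteq> 0"
        using ab unfolding \<phi>_def by (metis (no_types, lifting) mult_not_zero sum.not_neutral_contains_not_neutral)
      have c': "c' \<notin> G" "insert c' G \<in> \<Delta>" "c \<notin> G" "insert c G \<in> \<Delta>"
        using B_link[OF c(3)] B_link[of c' c] B_sym[of c c'] c(3) by auto
      have a: "a \<in> G \<or> a = c" and b: "b \<in> G \<or> b = c'" using c by (auto simp: M_def split: if_splits)
      show ?thesis
      proof (cases "a = c \<and> b = c'")
        case True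
        show ?thesis
        proof (cases "c = c'")
          case False
          then have "e c c' \<noteq> 0" using c(3) by (auto simp: B_def f_def)
          then have "insert c (insert c' G) \<in> \<Delta>" using e(2)[of c c'] by simp
          from down[OF this, of "{a, b}"] show ?thesis using True by simp
        next
          case True
          with \<open>a = c \<and> b = c'\<close> show ?thesis using down[OF c'(4), of "{a, b}"] by simp
        qed
      next
        case False
        then have "{a, b} \<subseteq> insert c G \<or> {a, b} \<subseteq> insert c' G" using a b by auto
        then show ?thesis using down[OF c'(2), of "{a, b}"] down[OF c'(4), of "{a, b}"] by blast
      qed
    qed
    show "(\<Sum>b\<in>{1..n}. \<phi> a b * p b j) = 0" if j: "j < D" for a j
    proof -
      have proj: "(\<Sum>b\<in>{1..n}. M b c' * p b j) = y w c' * p w j + y u c' * p u j"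
        if c': "c' \<notin> G" "c' \<in> {1..n}" for c'
      proof -
        have "(\<Sum>b\<in>{1..n}. M b c' * p b j) = (\<Sum>b\<in>{1..n}. (if b = c' then p c' j else 0) - (if b \<in> G then y b c' * p b j else 0))"
          by (rule sum.cong) (use c' in \<open>auto simp: M_def\<close>)
        also have "\<dots> = p c' j - (\<Sum>b\<in>G. y b c' * p b j)"
          using c' Gn by (simp add: sum_subtractf sum.If_cases Int_absorb1)
        finally show ?thesis using expand[OF j, of c'] by simp
      qed
      have inner: "(\<Sum>c'\<in>{1..n}. B c c' * (\<Sum>b\<in>{1..n}. M b c' * p b j)) = 0" for c
      proof -
        have "(\<Sum>c'\<in>{1..n}. B c c' * (\<Sum>b\<in>{1..n}. M b c' * p b j)) =
            (\<Sum>c'\<in>{1..n}. B c c' * y w c' * p w j + B c c' * y u c' * p u j)"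
        proof (rule sum.cong[OF refl])
          fix c' assume "c' \<in> {1..n}"
          then show "B c c' * (\<Sum>b\<in>{1..n}. M b c' * p b j) = B c c' * y w c' * p w j + B c c' * y u c' * p u j"
            using proj[of c'] B_link[of c c'] by (cases "B c c' = 0") (auto simp: algebra_simps)
        qed
        also have "\<dots> = 0"
          using Bw[of c] Bu[of c] by (simp add: sum.distrib flip: sum_distrib_right)
        finally show ?thesis .
      qed
      have "(\<Sum>b\<in>{1..n}. \<phi> a b * p b j) = (\<Sum>b\<in>{1..n}. \<Sum>c\<in>{1..n}. \<Sum>c'\<in>{1..n}. M a c * (B c c' * (M b c' * p b j)))"
        unfolding \<phi>_def sum_distrib_right by (intro sum.cong refl) (simp add: mult_ac)
      also have "\<dots> = (\<Sum>c\<in>{1..n}. \<Sum>b\<in>{1..n}. \<Sum>c'\<in>{1..n}. M a c * (B c c' * (M b c' * p b j)))"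
        by (rule sum.swap)
      also have "\<dots> = (\<Sum>c\<in>{1..n}. \<Sum>c'\<in>{1..n}. \<Sum>b\<in>{1..n}. M a c * (B c c' * (M b c' * p b j)))"
        by (intro sum.cong refl sum.swap)
      also have "\<dots> = (\<Sum>c\<in>{1..n}. M a c * (\<Sum>c'\<in>{1..n}. B c c' * (\<Sum>b\<in>{1..n}. M b c' * p b j)))"
        by (simp add: sum_distrib_left)
      finally show ?thesis unfolding inner by simp
    qed
    show "w \<in> {1..n}" using w F(1) faces by blast
  qed
  moreover have "\<phi> w w = B w w"
  proof -
    have wn: "w \<in> {1..n}" using w F(1) faces by blast
    have Mw: "M w c = (if c = w then 1 else 0)" for c
      using G(3) by (auto simp: M_def)
    have "\<phi> w w = (\<Sum>c\<in>{1..n}. \<Sum>c'\<in>{1..n}. if c' = w then (if c = w then B w w else 0) else 0)"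
      unfolding \<phi>_def by (intro sum.cong refl) (simp add: Mw)
    then show ?thesis using wn by simp
  qed
  ultimately have "l w = 0" by (simp add: B_def)
  then have Qw0: "Qw w = 0" using l by simp
  have yw: "y w w = 1" "y u w = 0" "y w u = 0"
    using yd[of w w] yd[of u w] yd[of w u] w un by auto
  obtain a b where ab: "{x. x \<notin> F \<and> insert x F \<in> \<Delta>} = {a, b}"
    using ridge_in_two_facets[OF F] by blast
  have uv': "u \<in> {a, b}" "v \<in> {a, b}" unfolding ab[symmetric] using uv by auto
  then have ab': "{a, b} = {u, v}" using uv(1) by auto
  have nb: "x = u \<or> x = v" if "e w x \<noteq> 0" for x
  proof -
    have "x \<noteq> w" "x \<notin> G" "insert w (insert x G) \<in> \<Delta>" using e(2) that by auto
    then have "x \<in> {x. x \<notin> F \<and> insert x F \<in> \<Delta>}"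
      using G(4) by (auto simp: insert_commute)
    then show ?thesis unfolding ab ab' by simp
  qed
  have vn: "u \<in> {1..n}" "v \<in> {1..n}" using uv(4,5) faces by auto
  have ewv: "e w v \<noteq> 0"
    using e(2)[of w v] G w uv by (auto simp: insert_commute)
  have "Qw w = (\<Sum>b\<in>{u, v}. f w b * y w b)"
    unfolding Qw_def by (rule sum.mono_neutral_right) (use vn nb in \<open>auto simp: f_def\<close>)
  also have "\<dots> = f w v * y w v" using uv(1) yw by simp
  finally have "f w v * y w v = 0" using Qw0 by simp
  moreover have "f w v \<noteq> 0" using ewv dt[OF ewv] by (simp add: f_def)
  ultimately show ?thesis by simp
qed

lemma adjacent_equal:
  assumes F: "F \<in> \<Delta>" "Suc (card F) = D" and uv: "u \<noteq> v" "u \<notin> F" "v \<notin> F" "insert u F \<in> \<Delta>" "insert v F \<in> \<Delta>"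
    and j: "j < D"
  shows "p u j = p v j"
proof -
  have finF: "finite F" by (rule finite_face[OF F(1)])
  have "card (insert u F) = D" using finF uv F(2) by simp
  from facet_coordinates[OF uv(4) this] obtain y where
    y0: "\<forall>x. \<forall>j<D. p x j = (\<Sum>s\<in>insert u F. y s x * p s j)"
    and yd0: "\<forall>s\<in>insert u F. \<forall>t\<in>insert u F. y s t = (if s = t then 1 else 0)"
    by (elim exE conjE)
  note y = y0[rule_format] and yd = yd0[rule_format]
  have "y w v = 0" if "w \<in> F" for w
    by (rule ridge_coordinate_zero[OF F uv y yd that]) auto
  then have pv: "p v j = y u v * p u j" if "j < D" for j
    using y[OF that, of v] finF uv(2) by simp
  have vn: "u \<in> {1..n}" "v \<in> {1..n}" using uv(4,5) faces by auto
  \<comment> \<open>The relation between \<open>v\<close> and \<open>u\<close> just found; its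
    coefficients must sum to zero, so the factor \<open>y u v\<close> is 1.\<close>
  define c where "c x = (if x = v then 1 else 0) - (if x = u then y u v else 0)" for x
  have cs: "(\<Sum>x\<in>{1..n}. c x * q x) = q v - y u v * q u" for q :: "nat \<Rightarrow> 'k"
  proof -
    have "(\<Sum>x\<in>{1..n}. c x * q x) = (\<Sum>x\<in>{1..n}. (if x = v then q v else 0) - (if x = u then y u v * q u else 0))"
      by (rule sum.cong) (use uv(1) in \<open>auto simp: c_def\<close>)
    then show ?thesis using vn by (simp add: sum_subtractf)
  qed
  have "(\<Sum>x\<in>{1..n}. c x) = 0"
    by (rule sum_relation) (subst cs, simp add: pv)
  then have "y u v = 1" using cs[of "\<lambda>_. 1"] by simp
  then show ?thesis using pv[OF j] by simp
qed

end

section \<open>From linear systems of parameters to colorings\<close>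

lemma mon_degree_eq_0: "mon_degree m = 0 \<longleftrightarrow> m = 0"
proof
  assume "mon_degree m = 0"
  then have "lookup m i = 0" for i
    by (cases "i \<in> keys m") (auto simp: mon_degree_def in_keys_iff)
  then show "m = 0" by (intro poly_mapping_eqI) simp
qed (simp add: mon_degree_def)

lemma expo_inject [simp]: "expo a = expo b \<longleftrightarrow> a = b"
proof
  assume "expo a = expo b"
  from arg_cong[OF this, of keys] show "a = b" by simp
qed simp

lemma add_expo_eq_expo: "m + expo u = expo v \<Longrightarrow> m = 0 \<and> u = v"
proof -
  assume eq: "m + expo u = expo v"
  from arg_cong[OF eq, of mon_degree] have "m = 0"
    by (simp add: mon_degree_add mon_degree_eq_0)
  then show ?thesis using eq by (simp del: One_nat_def)
qed

lemma expo_add_eq_iff: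
  assumes "expo a + expo b = expo c + expo d"
  shows "a = c \<and> b = d \<or> a = d \<and> b = c"
proof (cases "a = c")
  case True
  then show ?thesis using assms by (simp del: One_nat_def)
next
  case False
  have "keys (expo a + expo b) = keys (expo c + expo d)"
    using assms by (rule arg_cong)
  then have "a \<in> {c, d}" by (auto simp: keys_add_nat)
  then have ad: "a = d" using False by simp
  then have "expo a + expo b = expo a + expo c" using assms by (simp add: add.commute)
  then show ?thesis using ad by (simp del: One_nat_def)
qed

lemma single_sum: "single m (sum f A) = (\<Sum>i\<in>A. single m (f i))"
  by (induction A rule: infinite_finite_induct) (simp_all add: single_add)

lemma hom_component_1_expand:
  assumes q: "q \<in> hom_component n 1"
  shows "q = (\<Sum>v\<in>{1..n}. single (expo v) (lookup q (expo v)))"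
proof -
  have "keys q \<subseteq> expo ` {1..n}"
  proof
    fix m assume m: "m \<in> keys q"
    then have "mon_degree m = 1" "keys m \<subseteq> {1..n}"
      using q by (auto simp: hom_component_def carrier_mpoly_ring)
    then show "m \<in> expo ` {1..n}" using mon_degree_1[of m] by auto
  qed
  then have "q = (\<Sum>m\<in>expo ` {1..n}. single m (lookup q m))"
    by (intro mpoly_expand_superset) auto
  also have "\<dots> = (\<Sum>v\<in>{1..n}. single (expo v) (lookup q (expo v)))"
    by (subst sum.reindex) (auto simp: inj_on_def simp del: One_nat_def)
  finally show ?thesis .
qed

lemma functional_times_linear:
  assumes q: "q \<in> hom_component n 1"
  shows "functional w (single m c * q) = c * (\<Sum>v\<in>{1..n}. lookup q (expo v) * w (m + expo v))"
proof -
  have "single m c * q = (\<Sum>v\<in>{1..n}. single (m + expo v) (c * lookup q (expo v)))"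
    by (subst hom_component_1_expand[OF q]) (simp add: sum_distrib_left mult_single)
  then show ?thesis
    by (simp add: functional_sum sum_distrib_left mult.assoc)
qed

lemma total_degree_linear_le:
  assumes "q \<in> hom_component n 1" shows "total_degree q \<le> 1"
  using assms unfolding total_degree_def hom_component_def by (intro Max.boundedI) auto

section \<open>Ideal membership turned into properties of the coefficient vectors\<close>

context punctured_acyclic begin

text \<open>Each of the three conditions tests one member of the ideal against one functional: a
  square against evaluation at a point, the sum of the variables against a functional on linear
  forms, a square against one on quadrics.\<close>

lemma square_zero_parameters_of_linear_forms:
  fixes \<theta> :: "('k::field_char_0) mpoly list"
  assumes vert: "\<And>v. v \<in> {1..n} \<Longrightarrow> {v} \<in> \<Delta>"
    and len: "length \<theta> = D" and lin: "\<And>q. q \<in> set \<theta> \<Longrightarrow> q \<in> hom_component n 1"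
    and L: "(\<Sum>i\<in>{1..n}. mvar i) \<in> SR_ideal_plus n \<Delta> (set \<theta>)"
    and sq: "\<And>i. i \<in> {1..n} \<Longrightarrow> mvar i ^ 2 \<in> SR_ideal_plus n \<Delta> (set \<theta>)"
  shows "square_zero_parameters n \<Delta> (\<lambda>v j. lookup (\<theta> ! j) (expo v))"
proof (intro square_zero_parameters.intro[OF punctured_acyclic_axioms] square_zero_parameters_axioms.intro)
  let ?p = "\<lambda>v j. lookup (\<theta> ! j) (expo v)"
  have S: "set \<theta> \<subseteq> carrier (mpoly_ring n)"
    using lin by (auto simp: hom_component_def)
  show "c v = 0" if \<sigma>: "\<sigma> \<in> \<Delta>" and c: "\<And>j. j < D \<Longrightarrow> (\<Sum>v\<in>\<sigma>. c v * ?p v j) = 0" and v: "v \<in> \<sigma>" for \<sigma> c v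
  proof -
    have \<sigma>n: "\<sigma> \<subseteq> {1..n}" using \<sigma> faces by blast
    define c' where "c' x = (if x \<in> \<sigma> then c x else 0)" for x
    \<comment> \<open>Evaluation at the point \<open>c'\<close>. Its support lies in a face and all
      parameters vanish there, so it is a zero of the ideal; membership of \<open>mvar v ^ 2\<close>
      then gives \<open>c v = 0\<close>.\<close>
    define w where "w m = (\<Prod>i\<in>{1..n}. c' i ^ lookup m i)" for m
    have wadd: "w (m + expo x) = w m * c' x" if "x \<in> {1..n}" for m x
    proof -
      have "w (m + expo x) = (\<Prod>i\<in>{1..n}. c' i ^ lookup m i * (if i = x then c' x else 1))"
        unfolding w_def by (rule prod.cong) (auto simp: lookup_add lookup_single when_def)
      then show ?thesis using that by (simp add: prod.distrib w_def)
    qed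
    have "functional w (mvar v ^ 2) = 0"
    proof (rule SR_functional[OF S _ _ sq])
      fix \<rho> m assume \<rho>: "\<rho> \<subseteq> {1..n}" "\<rho> \<notin> \<Delta>"
      then obtain i where i: "i \<in> \<rho>" "i \<notin> \<sigma>" using down[OF \<sigma>] by blast
      have "c' i ^ lookup (m + face_expo \<rho>) i = 0"
        using i finite_subset[OF \<rho>(1)] by (simp add: c'_def lookup_add lookup_face_expo)
      then show "w (m + face_expo \<rho>) = 0"
        unfolding w_def using i(1) \<rho>(1) by (intro prod_zero) auto
    next
      fix g :: "'k mpoly" and m d assume g: "g \<in> set \<theta>"
      then obtain j where j: "j < D" "g = \<theta> ! j" using len by (auto simp: in_set_conv_nth)
      have "(\<Sum>x\<in>{1..n}. lookup g (expo x) * w (m + expo x)) = w m * (\<Sum>x\<in>{1..n}. c' x * ?p x j)"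
        unfolding sum_distrib_left
      proof (rule sum.cong[OF refl])
        fix x assume x: "x \<in> {1..n}"
        show "lookup g (expo x) * w (m + expo x) = w m * (c' x * ?p x j)"
          unfolding wadd[OF x] j(2) by (simp add: mult_ac)
      qed
      also have "(\<Sum>x\<in>{1..n}. c' x * ?p x j) = (\<Sum>x\<in>\<sigma>. c x * ?p x j)"
        by (rule sum.mono_neutral_cong_right) (use \<sigma>n in \<open>auto simp: c'_def\<close>)
      finally show "functional w (single m d * g) = 0"
        using c[OF j(1)] by (simp add: functional_times_linear[OF lin[OF g]])
    qed (use v \<sigma>n in auto)
    moreover have "functional w (mvar v ^ 2) = c v ^ 2"
    proof -
      have "single v 2 = expo v + expo v" by (simp flip: single_add add: numeral_2_eq_2)
      then have "w (single v 2) = w 0 * c' v * c' v"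
        using wadd[of v 0] wadd[of v "expo v"] v \<sigma>n by auto
      moreover have "w 0 = 1" by (simp add: w_def)
      ultimately have "w (single v 2) = c v * c v" using v by (simp add: c'_def)
      then show ?thesis unfolding mvar_power functional_single by (simp add: power2_eq_square)
    qed
    ultimately show ?thesis by simp
  qed
  show "(\<Sum>v\<in>{1..n}. c v) = 0" if c: "\<And>j. j < D \<Longrightarrow> (\<Sum>v\<in>{1..n}. c v * ?p v j) = 0" for c
  proof -
    define w where "w m = (\<Sum>v\<in>{1..n}. if m = expo v then c v else 0)" for m
    have w1: "w (expo v) = c v" if "v \<in> {1..n}" for v
    proof -
      have "w (expo v) = (\<Sum>u\<in>{1..n}. if u = v then c v else 0)"
        unfolding w_def by (rule sum.cong) (auto simp del: One_nat_def)
      then show ?thesis using that by simp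
    qed
    have "functional w (\<Sum>i\<in>{1..n}. mvar i) = 0"
    proof (rule SR_functional[OF S _ _ L])
      fix \<rho> m assume \<rho>: "\<rho> \<subseteq> {1..n}" "\<rho> \<notin> \<Delta>"
      show "w (m + face_expo \<rho>) = 0"
        unfolding w_def
      proof (intro sum.neutral ballI)
        fix v assume v: "v \<in> {1..n}"
        \<comment> \<open>A nonface has at least two elements, since the vertices and the empty set
          are faces, so its monomial has no multiple of degree 1.\<close>
        have "m + face_expo \<rho> \<noteq> expo v"
        proof
          assume "m + face_expo \<rho> = expo v"
          from arg_cong[OF this, of keys] have "\<rho> \<subseteq> {v}"
            using finite_subset[OF \<rho>(1)] by (auto simp: keys_add_nat keys_face_expo)
          then show False using down[OF vert[OF v]] \<rho>(2) by blast
        qed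
        then show "(if m + face_expo \<rho> = expo v then c v else 0) = 0" by simp
      qed
    next
      fix g :: "'k mpoly" and m d assume g: "g \<in> set \<theta>"
      then obtain j where j: "j < D" "g = \<theta> ! j" using len by (auto simp: in_set_conv_nth)
      have "(\<Sum>x\<in>{1..n}. lookup g (expo x) * w (m + expo x)) = 0"
      proof (cases "m = 0")
        case True
        have "(\<Sum>x\<in>{1..n}. lookup g (expo x) * w (m + expo x)) = (\<Sum>x\<in>{1..n}. c x * ?p x j)"
          by (rule sum.cong) (simp_all add: True w1[simplified] j(2))
        then show ?thesis using c[OF j(1)] by simp
      next
        case False
        then have "w (m + expo x) = 0" for x
          unfolding w_def using add_expo_eq_expo by (intro sum.neutral) (metis (mono_tags))
        then show ?thesis by simp
      qed
      then show "functional w (single m d * g) = 0"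
        by (simp add: functional_times_linear[OF lin[OF g]])
    qed
    then show ?thesis
      by (simp add: functional_sum mvar_def w1[simplified])
  qed
  show "\<phi> x x = 0" if sym: "\<And>a b. \<phi> a b = \<phi> b a" and supp: "\<And>a b. \<phi> a b \<noteq> 0 \<Longrightarrow> {a, b} \<in> \<Delta>"
    and rel: "\<And>a j. j < D \<Longrightarrow> (\<Sum>b\<in>{1..n}. \<phi> a b * ?p b j) = 0" and x: "x \<in> {1..n}" for \<phi> :: "nat \<Rightarrow> nat \<Rightarrow> 'k" and x
  proof -
    \<comment> \<open>A quadratic monomial determines its two variables only up to order; every
      choice gives the same value because \<open>\<phi>\<close> is symmetric.\<close>
    define w where "w m = (if \<exists>a b. m = expo a + expo b
      then (let z = SOME z. m = expo (fst z) + expo (snd z) in \<phi> (fst z) (snd z)) else 0)" for m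
    have w2: "w (expo a + expo b) = \<phi> a b" for a b
    proof -
      define z where "z = (SOME z. expo a + expo b = expo (fst z) + expo (snd z))"
      have "\<exists>z. expo a + expo b = expo (fst z) + expo (snd z)"
        by (rule exI[of _ "(a, b)"]) simp
      then have "expo a + expo b = expo (fst z) + expo (snd z)"
        unfolding z_def by (rule someI_ex)
      from expo_add_eq_iff[OF this] have "\<phi> (fst z) (snd z) = \<phi> a b"
        using sym by metis
      then show ?thesis unfolding w_def Let_def z_def[symmetric] by auto
    qed
    have w0: "w m = 0" if "\<And>a b. m \<noteq> expo a + expo b" for m
      using that by (simp add: w_def)
    have "functional w (mvar x ^ 2) = 0"
    proof (rule SR_functional[OF S _ _ sq[OF x]])
      fix \<rho> m assume \<rho>: "\<rho> \<subseteq> {1..n}" "\<rho> \<notin> \<Delta>"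
      show "w (m + face_expo \<rho>) = 0"
      proof (cases "\<exists>a b. m + face_expo \<rho> = expo a + expo b")
        case True
        then obtain a b where ab: "m + face_expo \<rho> = expo a + expo b" by blast
        from arg_cong[OF this, of keys] have "\<rho> \<subseteq> {a, b}"
          using finite_subset[OF \<rho>(1)] by (auto simp: keys_add_nat keys_face_expo)
        then have "\<phi> a b = 0" using supp[of a b] down[of "{a, b}" \<rho>] \<rho>(2) by blast
        then show ?thesis unfolding ab w2 .
      next
        case False
        then show ?thesis by (intro w0) blast
      qed
    next
      fix g :: "'k mpoly" and m d assume g: "g \<in> set \<theta>"
      then obtain j where j: "j < D" "g = \<theta> ! j" using len by (auto simp: in_set_conv_nth)
      have "(\<Sum>v\<in>{1..n}. lookup g (expo v) * w (m + expo v)) = 0"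
      proof (cases "\<exists>a. m = expo a")
        case True
        then obtain a where a: "m = expo a" by blast
        have "(\<Sum>v\<in>{1..n}. lookup g (expo v) * w (m + expo v)) = (\<Sum>b\<in>{1..n}. \<phi> a b * ?p b j)"
          unfolding a w2 by (rule sum.cong) (simp_all add: j(2))
        then show ?thesis using rel[OF j(1)] by simp
      next
        case False
        have "w (m + expo v) = 0" for v
        proof (rule w0)
          fix a b show "m + expo v \<noteq> expo a + expo b"
          proof
            assume "m + expo v = expo a + expo b"
            from arg_cong[OF this, of mon_degree] have "mon_degree m = 1"
              by (simp add: mon_degree_add)
            then show False using mon_degree_1 False by blast
          qed
        qed
        then show ?thesis by simp
      qed
      then show "functional w (single m d * g) = 0"
        by (simp add: functional_times_linear[OF lin[OF g]])
    qed
    moreover have "single x 2 = expo x + expo x" by (simp flip: single_add add: numeral_2_eq_2)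
    ultimately show ?thesis by (simp add: mvar_power w2[simplified])
  qed
qed

lemma unexpected_linear_sop_squares:
  fixes \<theta> :: "('k::field_char_0) mpoly list"
  assumes un: "unexpected_linear_sop n \<Delta> \<theta>" and i: "i \<in> {1..n}"
  shows "mvar i ^ 2 \<in> SR_ideal_plus n \<Delta> (set \<theta>)"
proof -
  obtain a t where a: "0 < a" "0 < t" and us: "unexpected_sop n \<Delta> a t \<theta>" and ls: "is_linear_sop n \<Delta> \<theta>"
    using un by (auto simp: unexpected_linear_sop_def)
  have lin: "q \<in> hom_component n 1" if "q \<in> set \<theta>" for q
    using ls that by (simp add: is_linear_sop_def)
  have len: "length \<theta> = D" using ls by (simp add: is_linear_sop_def is_sop_def D_def)
  have S: "set \<theta> \<subseteq> carrier (mpoly_ring n)"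
    using lin by (auto simp: hom_component_def)
  note I = SR_ideal_plus_ideal[OF S, of \<Delta>]
  have ia: "mvar i ^ a \<in> SR_ideal_plus n \<Delta> (set \<theta>)"
    and deg: "sum_list (map total_degree \<theta>) + Polynomial.degree (h_poly \<Delta>) = t + complex_dim \<Delta> + 1"
    and HF: "HF n (int t) (SR_ideal_plus n \<Delta> ((\<lambda>i. (mvar i :: 'k mpoly) ^ a) ` {1..n}))
      \<le> HF n (int t - 1) (SR_ideal_plus n \<Delta> ((\<lambda>i. (mvar i :: 'k mpoly) ^ a) ` {1..n}))"
    using us i by (auto simp: unexpected_sop_def Let_def)
  \<comment> \<open>Only an inequality, because a zero form counts with total degree 0. Together
    with \<open>degree_h_poly\<close> it gives \<open>t \<le> D\<close>, the range of the growth
    lemma.\<close>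
  have "sum_list (map total_degree \<theta>) \<le> length \<theta>"
    using lin
  proof (induction \<theta>)
    case (Cons q \<theta>)
    have "total_degree q \<le> 1" using Cons.prems[of q] by (intro total_degree_linear_le[of q n]) simp
    moreover have "sum_list (map total_degree \<theta>) \<le> length \<theta>" using Cons.prems by (intro Cons.IH) simp
    ultimately show ?case by simp
  qed simp
  then have tD: "t \<le> D" using deg len by (simp add: degree_h_poly D_def)
  have empty: "{} \<in> \<Delta>" using ex_facet down by blast
  obtain s where s: "t = Suc s" using a(2) by (cases t) auto
  have hf: "HF n (int q) (SR_ideal_plus n \<Delta> ((\<lambda>i. (mvar i :: 'k mpoly) ^ a) ` {1..n})) = card (truncated_monomials \<Delta> a q)" for q
    by (rule HF_truncated[OF faces empty _ a(1)]) (rule down)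
  have s': "int t - 1 = int s" using s by simp
  have "card (truncated_monomials \<Delta> a (Suc s)) \<le> card (truncated_monomials \<Delta> a s)"
    using HF unfolding s' hf unfolding s .
  then have "\<not> 3 \<le> a"
    using truncated_monomials_growth[of a s] tD s by auto
  then consider "a = 1" | "a = 2" using a(1) by linarith
  then show ?thesis
  proof cases
    case 1
    then have "mvar i \<in> SR_ideal_plus n \<Delta> (set \<theta>)" using ia by simp
    from mpoly_ideal_closed(2)[OF I(1) this mvar_carrier[OF i]]
    show ?thesis by (simp add: power2_eq_square)
  qed (use ia in simp)
qed

lemma facet_of_vertex: "{v} \<in> \<Delta> \<Longrightarrow> \<exists>\<sigma>\<in>\<Delta>. card \<sigma> = D \<and> v \<in> \<sigma>"
  using face_in_facet[of "{v}"] by auto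

lemma coloring_bij_facet:
  assumes \<rho>: "balanced_coloring n \<Delta> \<rho>" and \<sigma>: "\<sigma> \<in> \<Delta>" "card \<sigma> = D"
  shows "bij_betw \<rho> \<sigma> {1..D}"
proof -
  have inj: "inj_on \<rho> \<sigma>"
  proof (rule inj_onI, rule ccontr)
    fix u v assume uv: "u \<in> \<sigma>" "v \<in> \<sigma>" "\<rho> u = \<rho> v" "u \<noteq> v"
    have "{u, v} \<in> \<Delta>" using down[OF \<sigma>(1), of "{u, v}"] uv by simp
    then show False using \<rho> uv(3,4) unfolding balanced_coloring_def by metis
  qed
  have "\<rho> ` \<sigma> \<subseteq> {1..D}"
    using \<rho> \<sigma>(1) faces by (auto simp: balanced_coloring_def D_def)
  then have "\<rho> ` \<sigma> = {1..D}"
    using card_image[OF inj] \<sigma>(2) by (intro card_subset_eq) auto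
  then show ?thesis using inj by (simp add: bij_betw_def)
qed

end

section \<open>Vertex vectors as colors\<close>

context square_zero_parameters begin

text \<open>Zero from \<open>D\<close> on, so that equal coordinates below \<open>D\<close> give
  equal functions.\<close>

definition vec :: "nat \<Rightarrow> nat \<Rightarrow> 'k" where "vec v j = (if j < D then p v j else 0)"

lemma vec_adjacent:
  assumes "F \<in> \<Delta>" "Suc (card F) = D" "u \<noteq> v" "u \<notin> F" "v \<notin> F" "insert u F \<in> \<Delta>" "insert v F \<in> \<Delta>"
  shows "vec u = vec v"
  using adjacent_equal[OF assms] by (auto simp: vec_def)

lemma vec_inj_on:
  assumes \<sigma>: "\<sigma> \<in> \<Delta>"
  shows "inj_on vec \<sigma>"
proof (rule inj_onI, rule ccontr)
  fix u v assume uv: "u \<in> \<sigma>" "v \<in> \<sigma>" "vec u = vec v" "u \<noteq> v"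
  define c :: "nat \<Rightarrow> 'k" where "c x = (if x = u then 1 else 0) - (if x = v then 1 else 0)" for x
  have "c u = 0"
  proof (rule indep[OF \<sigma> _ uv(1)])
    fix j assume j: "j < D"
    have "(\<Sum>x\<in>\<sigma>. c x * p x j) = (\<Sum>x\<in>\<sigma>. (if x = u then p u j else 0) - (if x = v then p v j else 0))"
      by (rule sum.cong) (auto simp: c_def)
    also have "\<dots> = p u j - p v j"
      using uv(1,2) finite_face[OF \<sigma>] by (simp add: sum_subtractf)
    also have "\<dots> = 0" using fun_cong[OF uv(3), of j] j by (simp add: vec_def)
    finally show "(\<Sum>x\<in>\<sigma>. c x * p x j) = 0" .
  qed
  then show False using uv(4) by (simp add: c_def)
qed

lemma balanced:
  assumes vert: "\<And>v. v \<in> {1..n} \<Longrightarrow> {v} \<in> \<Delta>"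
  shows "balanced n \<Delta>"
proof -
  obtain \<phi> where \<phi>: "\<phi> \<in> \<Delta>" "card \<phi> = D" using ex_facet by blast
  \<comment> \<open>Crossing a ridge replaces a vertex by one with the same vector, so all facets
    carry the same \<open>D\<close> vectors; \<open>f\<close> then numbers them as colors.\<close>
  have img: "vec ` \<tau> = vec ` \<phi>" if "\<tau> \<in> \<Delta>" "card \<tau> = D" for \<tau>
    using \<phi> that
  proof (rule facet_induct[where P = "\<lambda>\<tau>. vec ` \<tau> = vec ` \<phi>"])
    fix F u v assume "F \<in> \<Delta>" "Suc (card F) = D" "u \<noteq> v" "u \<notin> F" "v \<notin> F" "insert u F \<in> \<Delta>" "insert v F \<in> \<Delta>"
      and eq: "vec ` insert u F = vec ` \<phi>"
    then have "vec u = vec v" by (intro vec_adjacent)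
    then show "vec ` insert v F = vec ` \<phi>" using eq by simp
  qed simp
  have "card (vec ` \<phi>) = D" using card_image[OF vec_inj_on[OF \<phi>(1)]] \<phi>(2) by simp
  then obtain f where f: "bij_betw f (vec ` \<phi>) {1..D}"
    using finite_same_card_bij[of "vec ` \<phi>" "{1..D}"] finite_face[OF \<phi>(1)] by auto
  define \<rho> where "\<rho> v = f (vec v)" for v
  have mem: "vec v \<in> vec ` \<phi>" if "{v} \<in> \<Delta>" for v
    using facet_of_vertex[OF that] img by blast
  have "\<rho> v \<in> {1..complex_dim \<Delta> + 1}" if "v \<in> {1..n}" for v
    using bij_betw_apply[OF f mem[OF vert[OF that]]] by (simp only: \<rho>_def D_def)
  moreover have "\<rho> u \<noteq> \<rho> v" if uv: "{u, v} \<in> \<Delta>" "u \<noteq> v" for u v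
  proof
    assume "\<rho> u = \<rho> v"
    then have eq: "f (vec u) = f (vec v)" by (simp only: \<rho>_def)
    have "{u} \<in> \<Delta>" "{v} \<in> \<Delta>" using down[OF uv(1), of "{u}"] down[OF uv(1), of "{v}"] by simp_all
    from inj_onD[OF bij_betw_imp_inj_on[OF f] eq mem[OF this(1)] mem[OF this(2)]]
    have "u = v" by (rule inj_onD[OF vec_inj_on[OF uv(1)]]) auto
    then show False using uv(2) by simp
  qed
  ultimately show ?thesis
    unfolding balanced_def balanced_coloring_def by (intro exI[of _ \<rho>]) blast
qed

text \<open>Crossing a ridge changes neither the color nor the vector of the exchanged vertex, so
  for any given coloring the vector depends on the color alone. Uniqueness needs this for a coloring
  that is not assumed to come from the vectors.\<close>

lemma vec_color:
  assumes \<rho>: "balanced_coloring n \<Delta> \<rho>" and \<phi>: "\<phi> \<in> \<Delta>" "card \<phi> = D" and \<tau>: "\<tau> \<in> \<Delta>" "card \<tau> = D" and v: "v \<in> \<tau>"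
  shows "vec v = vec (inv_into \<phi> \<rho> (\<rho> v))"
proof -
  have "\<forall>v\<in>\<tau>. vec v = vec (inv_into \<phi> \<rho> (\<rho> v))"
    using \<phi> \<tau>
  proof (rule facet_induct[where P = "\<lambda>\<tau>. \<forall>v\<in>\<tau>. vec v = vec (inv_into \<phi> \<rho> (\<rho> v))"])
    show "\<forall>v\<in>\<phi>. vec v = vec (inv_into \<phi> \<rho> (\<rho> v))"
      using bij_betw_imp_inj_on[OF coloring_bij_facet[OF \<rho> \<phi>]] by simp
    fix F u v assume F: "F \<in> \<Delta>" "Suc (card F) = D" "u \<noteq> v" "u \<notin> F" "v \<notin> F" "insert u F \<in> \<Delta>" "insert v F \<in> \<Delta>"
      and IH: "\<forall>x\<in>insert u F. vec x = vec (inv_into \<phi> \<rho> (\<rho> x))"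
    have fin: "finite F" by (rule finite_face[OF F(1)])
    have c: "card (insert u F) = D" "card (insert v F) = D" using F fin by auto
    have bu: "bij_betw \<rho> (insert u F) {1..D}" and bv: "bij_betw \<rho> (insert v F) {1..D}"
      using coloring_bij_facet[OF \<rho>] F c by auto
    \<comment> \<open>Both facets use each color once, so the color missing on \<open>F\<close> is
      that of \<open>u\<close> and of \<open>v\<close>.\<close>
    have "\<rho> u \<in> \<rho> ` insert v F"
      using bij_betw_imp_surj_on[OF bu] bij_betw_imp_surj_on[OF bv] by blast
    moreover have "\<rho> u \<notin> \<rho> ` F"
      using inj_onD[OF bij_betw_imp_inj_on[OF bu], of u] F(4) by auto
    ultimately have "\<rho> u = \<rho> v" by auto
    moreover have "vec u = vec v" by (rule vec_adjacent[OF F])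
    ultimately have "vec v = vec (inv_into \<phi> \<rho> (\<rho> v))" using IH by simp
    then show "\<forall>x\<in>insert v F. vec x = vec (inv_into \<phi> \<rho> (\<rho> x))" using IH by blast
  qed
  then show ?thesis using v by blast
qed

end

section \<open>The colored system of parameters\<close>

definition color_form :: "nat \<Rightarrow> (nat \<Rightarrow> nat) \<Rightarrow> nat \<Rightarrow> ('k::field) mpoly" where
  "color_form n \<rho> i = (\<Sum>v\<in>{v \<in> {1..n}. \<rho> v = i}. mvar v)"

lemma color_form_linear: "(color_form n \<rho> i :: ('k::field) mpoly) \<in> hom_component n 1"
proof -
  have car: "color_form n \<rho> i \<in> carrier (mpoly_ring n :: 'k mpoly ring)"
    unfolding color_form_def by (intro mpoly_carrier_sum mvar_carrier) simp
  have "mon_degree m = 1" if m: "m \<in> keys (color_form n \<rho> i :: 'k mpoly)" for m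
  proof -
    have "m \<in> (\<Union>v\<in>{v \<in> {1..n}. \<rho> v = i}. keys (mvar v :: 'k mpoly))"
      using m unfolding color_form_def by (rule set_mp[OF Poly_Mapping.keys_sum])
    then show ?thesis by (auto simp: mvar_def)
  qed
  with car show ?thesis by (simp add: hom_component_def)
qed

lemma color_form_total_degree:
  assumes "v \<in> {1..n}" "\<rho> v = i"
  shows "total_degree (color_form n \<rho> i :: ('k::field) mpoly) = 1"
proof -
  let ?C = "color_form n \<rho> i :: 'k mpoly"
  have "lookup ?C (expo v) = (\<Sum>u\<in>{u \<in> {1..n}. \<rho> u = i}. if u = v then 1 else 0)"
    unfolding color_form_def lookup_sum mvar_def lookup_single when_def
    by (rule sum.cong) (simp_all del: One_nat_def)
  also have "\<dots> = 1" using assms by simp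
  finally have k: "expo v \<in> keys ?C" by (simp add: in_keys_iff)
  then have "mon_degree (expo v) \<in> insert 0 (mon_degree ` keys ?C)" by blast
  then have "mon_degree (expo v) \<le> total_degree ?C"
    unfolding total_degree_def by (intro Max_ge) auto
  then show ?thesis using total_degree_linear_le[OF color_form_linear[of n \<rho> i, where 'k = 'k]] by simp
qed

context punctured_acyclic begin

lemma colored_sop_eq: "colored_sop n \<Delta> \<rho> = map (color_form n \<rho>) [1..<Suc D]"
  by (simp add: colored_sop_def color_form_def D_def cong: map_cong)

lemma set_colored_sop: "set (colored_sop n \<Delta> \<rho>) = color_form n \<rho> ` {1..D}"
  unfolding colored_sop_eq by (simp add: atLeastLessThanSuc_atLeastAtMost del: upt_Suc)

lemma color_forms_carrier: "set (colored_sop n \<Delta> \<rho>) \<subseteq> carrier (mpoly_ring n :: ('k::field) mpoly ring)"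
proof -
  have "color_form n \<rho> i \<in> carrier (mpoly_ring n :: 'k mpoly ring)" for i
    using color_form_linear[of n \<rho> i, where 'k = 'k] by (simp add: hom_component_def)
  then show ?thesis unfolding set_colored_sop by blast
qed

text \<open>With \<open>g\<close> constant this expresses the sum of all variables; with
  \<open>g\<close> read off from vertex vectors it expresses the parameters by color forms.\<close>

lemma linear_form_sum_colors:
  assumes "\<rho> \<in> {1..n} \<rightarrow> {1..D}"
  shows "(\<Sum>v\<in>{1..n}. single (expo v) (g (\<rho> v))) = (\<Sum>i\<in>{1..D}. mconst (g i) * (color_form n \<rho> i :: ('k::field) mpoly))"
proof -
  have "mconst (g i) * (color_form n \<rho> i :: 'k mpoly) = (\<Sum>v\<in>{v \<in> {1..n}. \<rho> v = i}. single (expo v) (g (\<rho> v)))" for i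
    unfolding color_form_def sum_distrib_left by (rule sum.cong) (simp_all add: mconst_def mvar_def mult_single)
  then have "(\<Sum>i\<in>{1..D}. mconst (g i) * (color_form n \<rho> i :: 'k mpoly)) =
      (\<Sum>i\<in>{1..D}. \<Sum>v\<in>{v \<in> {1..n}. \<rho> v = i}. single (expo v) (g (\<rho> v)))"
    by (intro sum.cong refl)
  also have "\<dots> = (\<Sum>v\<in>{1..n}. single (expo v) (g (\<rho> v)))"
    by (rule sum.group) (use assms in auto)
  finally show ?thesis by simp
qed

lemma mconst_carrier: "mconst c \<in> carrier (mpoly_ring n)"
  unfolding mconst_def by (rule single_carrier) simp

lemma truncated_monomials_2: "card (truncated_monomials \<Delta> 2 t) = card {\<sigma> \<in> \<Delta>. card \<sigma> = t}"
proof -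
  have "truncated_monomials \<Delta> 2 t = face_expo ` {\<sigma> \<in> \<Delta>. card \<sigma> = t}"
  proof (intro equalityI subsetI)
    fix m assume "m \<in> truncated_monomials \<Delta> 2 t"
    then have m: "keys m \<in> \<Delta>" "\<And>i. lookup m i < 2" "mon_degree m = t"
      by (auto simp: truncated_monomials_def)
    have "lookup m i = lookup (face_expo (keys m)) i" for i
      using m(2)[of i] by (cases "i \<in> keys m") (auto simp: lookup_face_expo in_keys_iff)
    then have eq: "m = face_expo (keys m)" by (intro poly_mapping_eqI)
    then have "card (keys m) = t"
      using m(3) mon_degree_face_expo[of "keys m"] by simp
    then show "m \<in> face_expo ` {\<sigma> \<in> \<Delta>. card \<sigma> = t}" using eq m(1) by blast
  next
    fix m assume "m \<in> face_expo ` {\<sigma> \<in> \<Delta>. card \<sigma> = t}"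
    then obtain \<sigma> where "m = face_expo \<sigma>" "\<sigma> \<in> \<Delta>" "card \<sigma> = t" by blast
    then show "m \<in> truncated_monomials \<Delta> 2 t"
      using finite_face[of \<sigma>] by (simp add: truncated_monomials_def keys_face_expo lookup_face_expo mon_degree_face_expo)
  qed
  moreover have "inj_on face_expo {\<sigma> \<in> \<Delta>. card \<sigma> = t}"
  proof (rule inj_onI)
    fix \<sigma> \<tau> assume "\<sigma> \<in> {\<sigma> \<in> \<Delta>. card \<sigma> = t}" "\<tau> \<in> {\<sigma> \<in> \<Delta>. card \<sigma> = t}" and eq: "face_expo \<sigma> = face_expo \<tau>"
    then have "finite \<sigma>" "finite \<tau>" using finite_face by auto
    then show "\<sigma> = \<tau>" using arg_cong[OF eq, of keys] by (simp add: keys_face_expo)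
  qed
  ultimately show ?thesis by (simp add: card_image)
qed

text \<open>The witnesses are \<open>a = 2\<close> and \<open>t = D\<close>. A variable times the
  form of its color is its square plus products over nonedges, and condition (iv) becomes the
  comparison of facets with ridges.\<close>

lemma colored_sop_unexpected:
  assumes \<rho>: "balanced_coloring n \<Delta> \<rho>"
  shows "unexpected_linear_sop n \<Delta> (colored_sop n \<Delta> \<rho> :: ('k::field_char_0) mpoly list)"
proof -
  let ?\<theta> = "colored_sop n \<Delta> \<rho> :: 'k mpoly list"
  let ?I = "SR_ideal_plus n \<Delta> (set ?\<theta>)"
  note S = color_forms_carrier[of \<rho>, where 'k = 'k]
  note I = SR_ideal_plus_ideal[OF S, of \<Delta>]
  have \<rho>1: "\<rho> \<in> {1..n} \<rightarrow> {1..D}" and \<rho>2: "\<And>u v. {u, v} \<in> \<Delta> \<Longrightarrow> u \<noteq> v \<Longrightarrow> \<rho> u \<noteq> \<rho> v"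
    using \<rho> unfolding balanced_coloring_def D_def by blast+
  have empty: "{} \<in> \<Delta>" using ex_facet down by blast
  have lin: "q \<in> hom_component n 1" if "q \<in> set ?\<theta>" for q
    using that color_form_linear unfolding set_colored_sop by blast
  have len: "length ?\<theta> = D" by (simp add: colored_sop_eq del: upt_Suc)
  have mem: "color_form n \<rho> i \<in> ?I" if "i \<in> {1..D}" for i
    using I(2) that unfolding set_colored_sop by blast
  have L: "(\<Sum>i\<in>{1..n}. mvar i) \<in> ?I"
  proof -
    have "(\<Sum>v\<in>{1..n}. mvar v :: 'k mpoly) = (\<Sum>i\<in>{1..D}. mconst 1 * color_form n \<rho> i)"
      using linear_form_sum_colors[OF \<rho>1, of "\<lambda>_. 1 :: 'k"] unfolding mvar_def .
    moreover have "(\<Sum>i\<in>{1..D}. mconst 1 * color_form n \<rho> i) \<in> ?I"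
      by (intro mpoly_ideal_sum[OF I(1)] mpoly_ideal_closed(2)[OF I(1)] mem mconst_carrier)
    ultimately show ?thesis by simp
  qed
  have sq: "mvar v ^ 2 \<in> ?I" if v: "v \<in> {1..n}" for v
  proof -
    let ?A = "{u \<in> {1..n}. \<rho> u = \<rho> v}"
    have "mvar v * color_form n \<rho> (\<rho> v) = (\<Sum>u\<in>?A. mvar v * mvar u :: 'k mpoly)"
      by (simp add: color_form_def sum_distrib_left)
    also have "\<dots> = mvar v * mvar v + (\<Sum>u\<in>?A - {v}. mvar v * mvar u)"
      using v by (intro sum.remove) auto
    finally have "mvar v ^ 2 = mvar v * color_form n \<rho> (\<rho> v) + (\<Sum>u\<in>?A - {v}. - (mvar v * mvar u) :: 'k mpoly)"
      by (simp add: power2_eq_square sum_negf)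
    moreover have "mvar v * color_form n \<rho> (\<rho> v) \<in> ?I"
    proof (rule mpoly_ideal_closed(2)[OF I(1) mem mvar_carrier[OF v]])
      show "\<rho> v \<in> {1..D}" using \<rho>1 v by (rule funcset_mem)
    qed
    moreover have "(\<Sum>u\<in>?A - {v}. - (mvar v * mvar u) :: 'k mpoly) \<in> ?I"
    proof (rule mpoly_ideal_sum[OF I(1)])
      fix u assume u: "u \<in> ?A - {v}"
      then have "{v, u} \<notin> \<Delta>" using \<rho>2[of v u] by auto
      moreover have "keys (expo v + expo u) = {v, u}" by (auto simp: keys_add_nat)
      ultimately have "single (expo v + expo u) (- 1) \<in> ?I"
        using u v by (intro nonface_mem_ideal[OF I(1,3)]) auto
      then show "- (mvar v * mvar u) \<in> ?I"
        by (simp add: mvar_def mult_single single_uminus)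
    qed
    ultimately show ?thesis by (simp only: mpoly_ideal_closed(1)[OF I(1)])
  qed
  have proper: "1 \<notin> ?I"
  proof
    assume one: "1 \<in> ?I"
    define w where "w m = (if m = 0 then 1 else 0 :: 'k)" for m :: "nat \<Rightarrow>\<^sub>0 nat"
    have "functional w 1 = 0"
    proof (rule SR_functional[OF S _ _ one])
      fix \<sigma> m assume \<sigma>: "\<sigma> \<subseteq> {1..n}" "\<sigma> \<notin> \<Delta>"
      have "m + face_expo \<sigma> \<noteq> 0"
      proof
        assume "m + face_expo \<sigma> = 0"
        from arg_cong[OF this, of keys] have "\<sigma> = {}"
          using finite_subset[OF \<sigma>(1)] by (simp add: keys_add_nat keys_face_expo)
        then show False using \<sigma> empty by simp
      qed
      then show "w (m + face_expo \<sigma>) = 0" by (simp add: w_def)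
    next
      fix g :: "'k mpoly" and m c assume "g \<in> set ?\<theta>"
      from functional_times_linear[OF lin[OF this], of w m c]
      have eq: "functional w (single m c * g) = c * (\<Sum>v\<in>{1..n}. lookup g (expo v) * w (m + expo v))" .
      have "w (m + expo v) = 0" for v
      proof -
        have "m + expo v \<noteq> 0"
        proof
          assume "m + expo v = 0"
          from arg_cong[OF this, of mon_degree] show False
            using mon_degree_eq_0[of 0] by (simp add: mon_degree_add)
        qed
        then show ?thesis by (simp add: w_def)
      qed
      then show "functional w (single m c * g) = 0" unfolding eq by simp
    qed
    moreover have "functional w 1 = 1"
      using functional_single[of w 0 1] by (simp add: w_def)
    ultimately show False by simp
  qed
  \<comment> \<open>All monomials outside the finitely many squarefree ones on faces lie in the
    ideal.\<close>
  have fd: "finite_dim_quot n ?I"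
  proof (rule finite_dim_quot_monomials[OF I(1) proper])
    let ?M = "{m. keys m \<in> \<Delta> \<and> (\<forall>i. lookup m i < (2::nat))}"
    show "finite ?M" by (rule finite_truncated[OF faces])
    show "keys m \<subseteq> {1..n}" if "m \<in> ?M" for m using that faces by blast
    fix m and c :: 'k assume m: "keys m \<subseteq> {1..n}" "m \<notin> ?M"
    show "single m c \<in> ?I"
    proof (cases "keys m \<in> \<Delta>")
      case True
      then obtain i where i: "2 \<le> lookup m i" using m(2) by (auto simp: not_less)
      then have "i \<in> keys m" by (simp add: in_keys_iff)
      then have "mvar i ^ 2 \<in> ?I" using sq m(1) by blast
      then have "single (single i 2) 1 \<in> ?I" by (simp add: mvar_power)
      then show ?thesis
        by (rule single_mem_ideal[OF I(1) _ m(1)]) (use i in \<open>auto simp: lookup_single when_def\<close>)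
    next
      case False
      then show ?thesis using nonface_mem_ideal[OF I(1,3) m(1)] by blast
    qed
  qed
  have sop: "is_linear_sop n \<Delta> ?\<theta>"
    using len lin fd unfolding is_linear_sop_def is_sop_def homogeneous_def D_def by blast
  have hf: "HF n (int q) (SR_ideal_plus n \<Delta> ((\<lambda>i. (mvar i :: 'k mpoly) ^ 2) ` {1..n})) = card (truncated_monomials \<Delta> 2 q)" for q
    by (rule HF_truncated[OF faces empty]) (rule down, auto)
  obtain d where d: "D = Suc d" using D_ge by (cases D) auto
  have HF: "HF n (int D) (SR_ideal_plus n \<Delta> ((\<lambda>i. (mvar i :: 'k mpoly) ^ 2) ` {1..n})) \<le>
     HF n (int D - 1) (SR_ideal_plus n \<Delta> ((\<lambda>i. (mvar i :: 'k mpoly) ^ 2) ` {1..n}))"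
  proof -
    have d': "int D - 1 = int d" using d by simp
    have "{F \<in> \<Delta>. Suc (card F) = D} = {F \<in> \<Delta>. card F = d}" using d by simp
    then have "card (truncated_monomials \<Delta> 2 D) \<le> card (truncated_monomials \<Delta> 2 d)"
      unfolding truncated_monomials_2 using card_facets_le_ridges by simp
    then show ?thesis unfolding d' hf .
  qed
  \<comment> \<open>Every color occurs on a facet, so no form is zero and each has degree exactly
    1.\<close>
  have td: "sum_list (map total_degree ?\<theta>) = D"
  proof -
    obtain \<phi> where \<phi>: "\<phi> \<in> \<Delta>" "card \<phi> = D" using ex_facet by blast
    have "total_degree (color_form n \<rho> i :: 'k mpoly) = 1" if i: "i \<in> {1..D}" for i
    proof -
      have "i \<in> \<rho> ` \<phi>" using bij_betw_imp_surj_on[OF coloring_bij_facet[OF \<rho> \<phi>]] i by simp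
      then obtain v where v: "v \<in> \<phi>" "\<rho> v = i" by blast
      then have "v \<in> {1..n}" using \<phi>(1) faces by blast
      then show ?thesis using v(2) by (rule color_form_total_degree)
    qed
    then have "map total_degree ?\<theta> = map (\<lambda>_. 1) [1..<Suc D]"
      unfolding colored_sop_eq map_map o_def by (intro map_cong refl) auto
    then show ?thesis by (simp add: sum_list_triv del: upt_Suc)
  qed
  have "unexpected_sop n \<Delta> 2 D ?\<theta>"
    unfolding unexpected_sop_def Let_def
    using sop L sq HF by (simp add: is_linear_sop_def degree_h_poly td D_def)
  then show ?thesis
    unfolding unexpected_linear_sop_def using sop D_ge by (intro conjI exI[of _ 2] exI[of _ D]) auto
qed

lemma unexpected_linear_sop_parameters:
  fixes \<theta> :: "('k::field_char_0) mpoly list"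
  assumes vert: "\<And>v. v \<in> {1..n} \<Longrightarrow> {v} \<in> \<Delta>" and un: "unexpected_linear_sop n \<Delta> \<theta>"
  shows "square_zero_parameters n \<Delta> (\<lambda>v j. lookup (\<theta> ! j) (expo v))"
proof (rule square_zero_parameters_of_linear_forms[OF vert])
  show "length \<theta> = D" using un by (simp add: unexpected_linear_sop_def is_linear_sop_def is_sop_def D_def)
  show "q \<in> hom_component n 1" if "q \<in> set \<theta>" for q
    using un that by (simp add: unexpected_linear_sop_def is_linear_sop_def)
  show "(\<Sum>i\<in>{1..n}. mvar i) \<in> SR_ideal_plus n \<Delta> (set \<theta>)"
    using un by (auto simp: unexpected_linear_sop_def unexpected_sop_def)
  show "mvar i ^ 2 \<in> SR_ideal_plus n \<Delta> (set \<theta>)" if "i \<in> {1..n}" for i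
    by (rule unexpected_linear_sop_squares[OF un that])
qed

text \<open>The coefficients of the parameters are constant on color classes, so the parameters are
  combinations of the color forms; independence on one facet makes the coefficient matrix
  invertible, which gives the converse inclusion.\<close>

lemma unexpected_linear_sop_unique:
  fixes \<theta> :: "('k::field_char_0) mpoly list"
  assumes vert: "\<And>v. v \<in> {1..n} \<Longrightarrow> {v} \<in> \<Delta>" and un: "unexpected_linear_sop n \<Delta> \<theta>"
    and \<rho>: "balanced_coloring n \<Delta> \<rho>"
  shows "SR_ideal_plus n \<Delta> (set \<theta>) = SR_ideal_plus n \<Delta> (set (colored_sop n \<Delta> \<rho>))"
proof -
  let ?p = "\<lambda>v j. lookup (\<theta> ! j) (expo v)"
  interpret q: square_zero_parameters n \<Delta> ?p
    by (rule unexpected_linear_sop_parameters[OF vert un])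
  have len: "length \<theta> = D" using un by (simp add: unexpected_linear_sop_def is_linear_sop_def is_sop_def D_def)
  have lin: "\<theta> ! j \<in> hom_component n 1" if "j < D" for j
    using un that len by (simp add: unexpected_linear_sop_def is_linear_sop_def)
  have S: "set \<theta> \<subseteq> carrier (mpoly_ring n)"
    using un by (auto simp: unexpected_linear_sop_def is_linear_sop_def hom_component_def)
  note T = color_forms_carrier[of \<rho>, where 'k = 'k]
  note I = SR_ideal_plus_ideal[OF S, of \<Delta>] and I\<rho> = SR_ideal_plus_ideal[OF T, of \<Delta>]
  have \<rho>1: "\<rho> \<in> {1..n} \<rightarrow> {1..D}"
    using \<rho> unfolding balanced_coloring_def D_def by blast
  obtain \<phi> where \<phi>: "\<phi> \<in> \<Delta>" "card \<phi> = D" using ex_facet by blast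
  note bij = coloring_bij_facet[OF \<rho> \<phi>]
  \<comment> \<open>The vertex of color \<open>i\<close> on the fixed facet represents its color
    class.\<close>
  define s where "s i = inv_into \<phi> \<rho> i" for i
  have pv: "?p v j = ?p (s (\<rho> v)) j" if v: "v \<in> {1..n}" and j: "j < D" for v j
  proof -
    obtain \<tau> where \<tau>: "\<tau> \<in> \<Delta>" "card \<tau> = D" "v \<in> \<tau>" using facet_of_vertex[OF vert[OF v]] by blast
    from fun_cong[OF q.vec_color[OF \<rho> \<phi> \<tau>], of j] show ?thesis
      using j unfolding q.vec_def s_def by simp
  qed
  have expand: "\<theta> ! j = (\<Sum>v\<in>{1..n}. single (expo v) (?p (s (\<rho> v)) j))" if j: "j < D" for j
  proof -
    have "\<theta> ! j = (\<Sum>v\<in>{1..n}. single (expo v) (?p v j))"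
      by (rule hom_component_1_expand[OF lin[OF j]])
    also have "\<dots> = (\<Sum>v\<in>{1..n}. single (expo v) (?p (s (\<rho> v)) j))"
      by (intro sum.cong refl arg_cong[where f = "single _"] pv j)
    finally show ?thesis .
  qed
  have "\<theta> ! j \<in> SR_ideal_plus n \<Delta> (set (colored_sop n \<Delta> \<rho>))" if j: "j < D" for j
  proof -
    have "\<theta> ! j = (\<Sum>i\<in>{1..D}. mconst (?p (s i) j) * color_form n \<rho> i)"
      by (rule trans[OF expand[OF j] linear_form_sum_colors[OF \<rho>1, of "\<lambda>i. ?p (s i) j"]])
    also have "\<dots> \<in> SR_ideal_plus n \<Delta> (set (colored_sop n \<Delta> \<rho>))"
    proof (intro mpoly_ideal_sum[OF I\<rho>(1)] mpoly_ideal_closed(2)[OF I\<rho>(1)] mconst_carrier)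
      fix i assume "i \<in> {1..D}"
      then have "color_form n \<rho> i \<in> set (colored_sop n \<Delta> \<rho> :: 'k mpoly list)"
        unfolding set_colored_sop by (rule imageI)
      then show "(color_form n \<rho> i :: 'k mpoly) \<in> SR_ideal_plus n \<Delta> (set (colored_sop n \<Delta> \<rho>))"
        by (rule set_mp[OF I\<rho>(2)])
    qed
    finally show ?thesis .
  qed
  then have "set \<theta> \<subseteq> SR_ideal_plus n \<Delta> (set (colored_sop n \<Delta> \<rho>))"
    using len by (auto simp: in_set_conv_nth)
  then have sub1: "SR_ideal_plus n \<Delta> (set \<theta>) \<subseteq> SR_ideal_plus n \<Delta> (set (colored_sop n \<Delta> \<rho>))"
    by (rule SR_ideal_plus_subset[OF S T])
  have ind: "c v = 0" if "\<And>j. j \<in> {..<D} \<Longrightarrow> (\<Sum>v\<in>\<phi>. c v * ?p v j) = 0" "v \<in> \<phi>" for c v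
    by (rule q.indep[OF \<phi>(1) _ that(2)]) (use that(1) in simp)
  \<comment> \<open>The dual covectors on \<open>\<phi>\<close> are the rows of the inverse
    matrix.\<close>
  have "\<exists>g. \<forall>x\<in>\<phi>. \<forall>y\<in>\<phi>. (\<Sum>j\<in>{..<D}. g x j * ?p y j) = (if x = y then 1 else 0)"
    by (rule dual_covectors) (use finite_face[OF \<phi>(1)] ind in auto)
  then obtain g where g: "\<forall>x\<in>\<phi>. \<forall>y\<in>\<phi>. (\<Sum>j\<in>{..<D}. g x j * ?p y j) = (if x = y then 1 else 0)"
    by (elim exE)
  have s\<phi>: "s i \<in> \<phi>" "\<rho> (s i) = i" if "i \<in> {1..D}" for i
    using that bij_betw_imp_surj_on[OF bij] inv_into_into[of i \<rho> \<phi>] f_inv_into_f[of i \<rho> \<phi>] by (auto simp: s_def)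
  have "color_form n \<rho> i \<in> SR_ideal_plus n \<Delta> (set \<theta>)" if i: "i \<in> {1..D}" for i
  proof -
    have "(\<Sum>j\<in>{..<D}. mconst (g (s i) j) * \<theta> ! j) =
        (\<Sum>j\<in>{..<D}. \<Sum>v\<in>{1..n}. single (expo v) (g (s i) j * ?p (s (\<rho> v)) j))"
    proof (intro sum.cong refl)
      fix j assume "j \<in> {..<D}"
      then have "mconst (g (s i) j) * \<theta> ! j =
          mconst (g (s i) j) * (\<Sum>v\<in>{1..n}. single (expo v) (?p (s (\<rho> v)) j))"
        by (intro arg_cong[where f = "(*) _"] expand) simp
      also have "\<dots> = (\<Sum>v\<in>{1..n}. single (expo v) (g (s i) j * ?p (s (\<rho> v)) j))"
        by (simp only: sum_distrib_left mconst_def mult_single add_0)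
      finally show "mconst (g (s i) j) * \<theta> ! j =
          (\<Sum>v\<in>{1..n}. single (expo v) (g (s i) j * ?p (s (\<rho> v)) j))" .
    qed
    also have "\<dots> = (\<Sum>v\<in>{1..n}. single (expo v) (\<Sum>j\<in>{..<D}. g (s i) j * ?p (s (\<rho> v)) j))"
      unfolding single_sum by (rule sum.swap)
    also have "\<dots> = (\<Sum>v\<in>{1..n}. single (expo v) (if \<rho> v = i then 1 else 0))"
    proof (intro sum.cong refl arg_cong[where f = "single _"])
      fix v assume "v \<in> {1..n}"
      then have \<rho>v: "\<rho> v \<in> {1..D}" using \<rho>1 by (rule funcset_mem[rotated])
      have "s i = s (\<rho> v) \<longleftrightarrow> i = \<rho> v" using s\<phi>(2)[OF i] s\<phi>(2)[OF \<rho>v] by metis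
      then show "(\<Sum>j\<in>{..<D}. g (s i) j * ?p (s (\<rho> v)) j) = (if \<rho> v = i then 1 else 0)"
        using g s\<phi>(1)[OF i] s\<phi>(1)[OF \<rho>v] by auto
    qed
    also have "\<dots> = color_form n \<rho> i"
      unfolding color_form_def mvar_def
      by (rule sum.mono_neutral_cong_right) auto
    finally have "color_form n \<rho> i = (\<Sum>j\<in>{..<D}. mconst (g (s i) j) * \<theta> ! j)" by (rule sym)
    also have "\<dots> \<in> SR_ideal_plus n \<Delta> (set \<theta>)"
      using I(2) len by (intro mpoly_ideal_sum[OF I(1)] mpoly_ideal_closed(2)[OF I(1)] mconst_carrier) auto
    finally show ?thesis .
  qed
  then have "set (colored_sop n \<Delta> \<rho>) \<subseteq> SR_ideal_plus n \<Delta> (set \<theta>)"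
    unfolding set_colored_sop by blast
  then have "SR_ideal_plus n \<Delta> (set (colored_sop n \<Delta> \<rho>)) \<subseteq> SR_ideal_plus n \<Delta> (set \<theta>)"
    by (rule SR_ideal_plus_subset[OF T S])
  with sub1 show ?thesis by (rule antisym)
qed

end

theorem theorem1p2:
  fixes n d :: nat and \<Delta> :: "nat set set"
  assumes "0 < d"
    and "complex_on n \<Delta>"
    and "realization n \<Delta> homeomorphic_space nsphere d"
  shows "((\<exists>\<theta> :: ('k::field_char_0) mpoly list. unexpected_linear_sop n \<Delta> \<theta>) \<longleftrightarrow> balanced n \<Delta>) \<and>
    (\<forall>\<rho>. balanced_coloring n \<Delta> \<rho> \<longrightarrow>
      unexpected_linear_sop n \<Delta> (colored_sop n \<Delta> \<rho> :: 'k mpoly list) \<and>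
      (\<forall>\<theta>' :: 'k mpoly list. unexpected_linear_sop n \<Delta> \<theta>' \<longrightarrow>
        SR_ideal_plus n \<Delta> (set \<theta>') = SR_ideal_plus n \<Delta> (set (colored_sop n \<Delta> \<rho>))))"
proof -
  interpret punctured_acyclic n \<Delta>
    by (rule punctured_acyclic_sphere[OF assms])
  have vert: "{v} \<in> \<Delta>" if "v \<in> {1..n}" for v
    using assms(2) that by (simp add: complex_on_def)
  have bal: "balanced n \<Delta>" if "unexpected_linear_sop n \<Delta> \<theta>" for \<theta> :: "'k mpoly list"
    using square_zero_parameters.balanced[OF unexpected_linear_sop_parameters[OF vert that] vert] .
  have uniq: "SR_ideal_plus n \<Delta> (set \<theta>') = SR_ideal_plus n \<Delta> (set (colored_sop n \<Delta> \<rho>))"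
    if "balanced_coloring n \<Delta> \<rho>" "unexpected_linear_sop n \<Delta> \<theta>'" for \<rho> and \<theta>' :: "'k mpoly list"
    by (rule unexpected_linear_sop_unique[OF vert that(2,1)])
  have ex: "\<exists>\<theta> :: 'k mpoly list. unexpected_linear_sop n \<Delta> \<theta>" if "balanced n \<Delta>"
    using that colored_sop_unexpected unfolding balanced_def by blast
  show ?thesis
    using bal ex uniq colored_sop_unexpected by blast
qed

end
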